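(* Let $(X,d)$ be a proper hyperbolic metric space with basepoint $o$, and let $\Gamma$ be a geometrically finite group of isometries of $X$. Let $\{\mu_x\}_{x\in X}$ be a quasi-conformal density of dimension $\delta$ on $\Lambda_\Gamma$ with no atoms, write $\mu=\mu_o$, and assume that $\Gamma$ has $\delta$-tempered parabolic subgroups. Then there exists a constant $C\ge1$ such that for all $\xi\in\Lambda_\Gamma$ and all $t\ge0$, $$C^{-1}\,b(\xi_t)\,e^{-\delta(t+d(\xi_t,\Gamma o))}\le\mu(V(o,\xi,t))\le C\,b(\xi_t)\,e^{-\delta(t+d(\xi_t,\Gamma o))},$$ where $\xi_t$ is the point at distance $t$ from $o$ on a geodesic ray $[o,\xi)$.
   Context: Hyperbolic spaces. $(X,d)$ is a geodesic Gromov hyperbolic space with Gromov boundary $\partial X$. Gromov product: $\langle y,z\rangle_o=\frac12(d(o,y)+d(o,z)-d(y,z))$, extended to $\xi,\eta\in\partial X$ by $\langle\xi,\eta\rangle_o=\liminf_{y\to\xi,z\to\eta}\langle y,z\rangle_o$. Busemann function: $\beta_\xi(x,y)=\liminf_{z\to\xi}(d(x,z)-d(y,z))$. Shadow: $V(o,\xi,t)=\{\eta\in\partial X:\langle\eta,\xi\rangle_o\ge t\}$. Horoball of center $\xi\in\partial X$ and radius $r>0$: $H_\xi(r)=\{x\in X:\beta_\xi(x,o)\le\log r\}$. Groups. $\Gamma$ acts properly discontinuously by isometries on $X$. The limit set $\Lambda_\Gamma\subset\partial X$ is the set of accumulation points of $\Gamma o$; $C_\Gamma$ is the union of all biinfinite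 geodesics with both endpoints in $\Lambda_\Gamma$. A subgroup of $\Gamma$ is parabolic if it is infinite, fixes a single point of $\partial X$ and contains no loxodromic element. $\xi\in\Lambda_\Gamma$ is a parabolic point if its stabilizer in $\Gamma$ is a parabolic subgroup, bounded parabolic if moreover $(\Lambda_\Gamma\setminus\{\xi\})/\mathrm{stab}_\Gamma(\xi)$ is compact, and conical if there are $\gamma_n\in\Gamma$ and distinct $a,b\in\Lambda_\Gamma$ with $\gamma_n\xi\to a$ and $\gamma_n\eta\to b$ for all $\eta\in\Lambda_\Gamma\setminus\{\xi\}$. $\Gamma$ is geometrically finite if $|\Lambda_\Gamma|\ge3$ and every point of $\Lambda_\Gamma$ is conical or bounded parabolic. The set $\mathcal P$ of parabolic points then consists of finitely many $\Gamma$-orbits $\mathcal P^1,\dots,\mathcal P^a$; choose $p_i\in\mathcal P^i$ with stabilizer $\Pi_i$ and put $B_i(t)=\#\{g\in\Pi_i:d(o,go)\le t\}$. Horoball decomposition. Fix a family of pairwise disjoint horoballs $\{H_p\}_{p\in\mathcal P}$, $H_p$ centered at $p$, which is quasi-invariant (the Hausdorff distance between $H_{\gamma p}$ and $\gamma H_p$ is bounded uniformly in $\gamma\in\Gamma$, $p\in\mathcal P$) and such that $C_\Gamma\setminus\bigcup_pH_p$ has relatively compact image in $C_\Gamma/\Gamma$; such a family exists. Define $b:X\to\mathbb R$ by $b(x)=B_i(2d(x,\Gamma o))$ if $x$ lies in some $H_p$ with $p\in\mathcal P^i$, and $b(x)=1$ if $x$ lies in no $H_p$. Tempered growth. For a parabolic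 subgroup $\Pi$ put $B_\Pi(t)=\#\{g\in\Pi:d(o,go)\le t\}$, $A_{\Pi,r}(t)=\frac1r\log\frac{B_\Pi(t+r)}{B_\Pi(t)}$, $\delta_\Pi^-=\lim_{r\to\infty}\inf_{t>0}A_{\Pi,r}(t)$, $\delta_\Pi^+=\lim_{r\to\infty}\sup_{t>0}A_{\Pi,r}(t)$. $\Pi$ has $\delta$-tempered growth if $0<\delta_\Pi^-\le\delta_\Pi^+<\delta$. $\Gamma$ has $\delta$-tempered parabolic subgroups if every maximal parabolic subgroup of $\Gamma$ has $\delta$-tempered growth. Quasi-conformal density of dimension $\delta>0$ on $\Lambda_\Gamma$: a family $\{\mu_x\}_{x\in X}$ of mutually absolutely continuous, finite, non-trivial Borel measures on $\partial X$, supported on $\Lambda_\Gamma$, for which there is $C>0$ with $C^{-1}\le\frac{d\gamma_*\mu_x}{d\mu_{\gamma x}}(\eta)\le C$ for all $\gamma\in\Gamma$, $x\in X$, a.e. $\eta$, and $C^{-1}e^{-\delta\beta_\eta(x,y)}\le\frac{d\mu_x}{d\mu_y}(\eta)\le Ce^{-\delta\beta_\eta(x,y)}$ for all $x,y\in X$, a.e. $\eta$. *)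

theory Defs
  imports "HOL-Analysis.Analysis" "HOL-Algebra.Bij"
begin

text \<open>
  The space \<open>X\<close> is the universe of a type \<open>'a\<close>; properness (closed bounded sets are
  compact) is the type class \<open>heine_borel\<close>.  Groups of isometries are subgroups of
  \<open>BijGroup UNIV\<close>.
\<close>

subsection \<open>Hyperbolic spaces and their Gromov boundary\<close>

definition geodesic_on :: "real set \<Rightarrow> (real \<Rightarrow> 'a::metric_space) \<Rightarrow> bool" where
  "geodesic_on I c \<longleftrightarrow> (\<forall>s\<in>I. \<forall>t\<in>I. dist (c s) (c t) = \<bar>s - t\<bar>)"

definition geodesic_space :: "'a::metric_space itself \<Rightarrow> bool" where
  "geodesic_space _ \<longleftrightarrow>
     (\<forall>x y::'a. \<exists>c. geodesic_on {0..dist x y} c \<and> c 0 = x \<and> c (dist x y) = y)"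

definition gromov_product :: "'a::metric_space \<Rightarrow> 'a \<Rightarrow> 'a \<Rightarrow> real" where
  "gromov_product w y z = (dist w y + dist w z - dist y z) / 2"

definition gromov_hyperbolic :: "'a::metric_space itself \<Rightarrow> bool" where
  "gromov_hyperbolic _ \<longleftrightarrow>
     (\<exists>D\<ge>0. \<forall>w x y z::'a.
        gromov_product w x z \<ge> min (gromov_product w x y) (gromov_product w y z) - D)"

definition gromov_sequence :: "'a::metric_space \<Rightarrow> (nat \<Rightarrow> 'a) \<Rightarrow> bool" where
  "gromov_sequence x\<^sub>0 u \<longleftrightarrow>
     filterlim (\<lambda>(m, n). gromov_product x\<^sub>0 (u m) (u n)) at_top (sequentially \<times>\<^sub>F sequentially)"

definition gromov_equiv :: "'a::metric_space \<Rightarrow> ((nat \<Rightarrow> 'a) \<times> (nat \<Rightarrow> 'a)) set" where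
  "gromov_equiv x\<^sub>0 = {(u, v). gromov_sequence x\<^sub>0 u \<and> gromov_sequence x\<^sub>0 v \<and>
     filterlim (\<lambda>n. gromov_product x\<^sub>0 (u n) (v n)) at_top sequentially}"

text \<open>
  A boundary point is an equivalence class of sequences; a sequence of points of \<open>X\<close>
  converges to \<open>\<xi>\<close> exactly if it is an element of the class \<open>\<xi>\<close>.  (In a hyperbolic space
  neither the relation nor its classes depend on the basepoint.)
\<close>

type_synonym 'a bdry = "(nat \<Rightarrow> 'a) set"

definition gromov_boundary :: "'a::metric_space \<Rightarrow> 'a bdry set" where
  "gromov_boundary x\<^sub>0 = {u. gromov_sequence x\<^sub>0 u} // gromov_equiv x\<^sub>0"

text \<open>
  The filter describing \<open>z \<rightarrow> \<xi>\<close> for \<open>z\<close> in \<open>X\<close>: a property holds eventually iff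
  it holds eventually along every sequence converging to \<open>\<xi>\<close>.
\<close>

definition towards :: "'a bdry \<Rightarrow> 'a filter" where
  "towards \<xi> = (SUP u\<in>\<xi>. filtermap u sequentially)"

text \<open>Extended real valued, since the product of a boundary point with itself is infinite.\<close>

definition bdry_product :: "'a::metric_space \<Rightarrow> 'a bdry \<Rightarrow> 'a bdry \<Rightarrow> ereal" where
  "bdry_product x\<^sub>0 \<xi> \<eta> =
     Liminf (towards \<xi> \<times>\<^sub>F towards \<eta>) (\<lambda>(y, z). ereal (gromov_product x\<^sub>0 y z))"

text \<open>The lower limit lies between \<open>-dist x y\<close> and \<open>dist x y\<close>, so no value is truncated.\<close>

definition busemann :: "'a bdry \<Rightarrow> 'a::metric_space \<Rightarrow> 'a \<Rightarrow> real" where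
  "busemann \<xi> x y = real_of_ereal (Liminf (towards \<xi>) (\<lambda>z. ereal (dist x z - dist y z)))"

definition shadow :: "'a::metric_space \<Rightarrow> 'a bdry \<Rightarrow> real \<Rightarrow> 'a bdry set" where
  "shadow x\<^sub>0 \<xi> t = {\<eta>\<in>gromov_boundary x\<^sub>0. bdry_product x\<^sub>0 \<eta> \<xi> \<ge> ereal t}"

definition horoball :: "'a::metric_space \<Rightarrow> 'a bdry \<Rightarrow> real \<Rightarrow> 'a set" where
  "horoball x\<^sub>0 \<xi> r = {x. busemann \<xi> x x\<^sub>0 \<le> ln r}"

definition geodesic_ray_to :: "'a::metric_space \<Rightarrow> 'a bdry \<Rightarrow> (real \<Rightarrow> 'a) \<Rightarrow> bool" where
  "geodesic_ray_to x \<xi> c \<longleftrightarrow> geodesic_on {0..} c \<and> c 0 = x \<and> (\<lambda>n. c (real n)) \<in> \<xi>"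

definition geodesic_line_between ::
    "'a bdry \<Rightarrow> 'a bdry \<Rightarrow> (real \<Rightarrow> 'a::metric_space) \<Rightarrow> bool" where
  "geodesic_line_between \<xi> \<eta> c \<longleftrightarrow>
     geodesic_on UNIV c \<and> (\<lambda>n. c (- real n)) \<in> \<xi> \<and> (\<lambda>n. c (real n)) \<in> \<eta>"

text \<open>The usual topology of the boundary, in which the shadows at \<open>\<xi>\<close> form a basis of
  (not necessarily open) neighbourhoods of \<open>\<xi>\<close>.\<close>

definition bdry_topology :: "'a::metric_space \<Rightarrow> 'a bdry topology" where
  "bdry_topology x\<^sub>0 = topology (\<lambda>U. U \<subseteq> gromov_boundary x\<^sub>0 \<and> (\<forall>\<xi>\<in>U. \<exists>t. shadow x\<^sub>0 \<xi> t \<subseteq> U))"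

lemma shadow_antimono: "s \<le> t \<Longrightarrow> shadow x\<^sub>0 \<xi> t \<subseteq> shadow x\<^sub>0 \<xi> s"
  unfolding shadow_def by (auto intro: order_trans[of "ereal s" "ereal t"])

lemma openin_bdry_topology:
  "openin (bdry_topology x\<^sub>0) U \<longleftrightarrow>
     U \<subseteq> gromov_boundary x\<^sub>0 \<and> (\<forall>\<xi>\<in>U. \<exists>t. shadow x\<^sub>0 \<xi> t \<subseteq> U)"
proof -
  have "istopology (\<lambda>U. U \<subseteq> gromov_boundary x\<^sub>0 \<and> (\<forall>\<xi>\<in>U. \<exists>t. shadow x\<^sub>0 \<xi> t \<subseteq> U))"
    unfolding istopology_def
  proof (intro conjI allI impI ballI; (elim conjE)?)
    fix S T \<xi>
    assume S: "\<forall>\<xi>\<in>S. \<exists>t. shadow x\<^sub>0 \<xi> t \<subseteq> S" and T: "\<forall>\<xi>\<in>T. \<exists>t. shadow x\<^sub>0 \<xi> t \<subseteq> T"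
      and "\<xi> \<in> S \<inter> T"
    then obtain s t where "shadow x\<^sub>0 \<xi> s \<subseteq> S" "shadow x\<^sub>0 \<xi> t \<subseteq> T" by blast
    then have "shadow x\<^sub>0 \<xi> (max s t) \<subseteq> S \<inter> T"
      using shadow_antimono[of s "max s t" x\<^sub>0 \<xi>] shadow_antimono[of t "max s t" x\<^sub>0 \<xi>] by auto
    then show "\<exists>t. shadow x\<^sub>0 \<xi> t \<subseteq> S \<inter> T" ..
  next
    fix K \<xi>
    assume K: "\<forall>U\<in>K. U \<subseteq> gromov_boundary x\<^sub>0 \<and> (\<forall>\<xi>\<in>U. \<exists>t. shadow x\<^sub>0 \<xi> t \<subseteq> U)"
      and "\<xi> \<in> \<Union> K"
    then obtain U t where "U \<in> K" "shadow x\<^sub>0 \<xi> t \<subseteq> U" by blast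
    then show "\<exists>t. shadow x\<^sub>0 \<xi> t \<subseteq> \<Union> K" by blast
  qed blast+
  then show ?thesis
    unfolding bdry_topology_def by (simp add: topology_inverse')
qed

lemma topspace_bdry_topology: "topspace (bdry_topology x\<^sub>0) = gromov_boundary x\<^sub>0"
proof
  show "topspace (bdry_topology x\<^sub>0) \<subseteq> gromov_boundary x\<^sub>0"
    using openin_topspace[of "bdry_topology x\<^sub>0"] by (simp only: openin_bdry_topology)
  have "openin (bdry_topology x\<^sub>0) (gromov_boundary x\<^sub>0)"
    unfolding openin_bdry_topology by (auto simp: shadow_def)
  then show "gromov_boundary x\<^sub>0 \<subseteq> topspace (bdry_topology x\<^sub>0)" by (rule openin_subset)
qed

definition bdry_borel :: "'a::metric_space \<Rightarrow> 'a bdry measure" where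
  "bdry_borel x\<^sub>0 = sigma (gromov_boundary x\<^sub>0) {U. openin (bdry_topology x\<^sub>0) U}"

subsection \<open>Quotient topologies and Hausdorff distance\<close>

definition quotient_topology :: "'b topology \<Rightarrow> ('b \<Rightarrow> 'c) \<Rightarrow> 'c topology" where
  "quotient_topology T q =
     topology (\<lambda>U. U \<subseteq> q ` topspace T \<and> openin T {x \<in> topspace T. q x \<in> U})"

lemma openin_quotient_topology:
  "openin (quotient_topology T q) U \<longleftrightarrow>
     U \<subseteq> q ` topspace T \<and> openin T {x \<in> topspace T. q x \<in> U}"
proof -
  have "istopology (\<lambda>U. U \<subseteq> q ` topspace T \<and> openin T {x \<in> topspace T. q x \<in> U})"
    unfolding istopology_def
  proof (intro conjI allI impI; (elim conjE)?)
    fix S U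
    assume "openin T {x \<in> topspace T. q x \<in> S}" "openin T {x \<in> topspace T. q x \<in> U}"
    then have "openin T ({x \<in> topspace T. q x \<in> S} \<inter> {x \<in> topspace T. q x \<in> U})"
      by (rule openin_Int)
    also have "{x \<in> topspace T. q x \<in> S} \<inter> {x \<in> topspace T. q x \<in> U}
      = {x \<in> topspace T. q x \<in> S \<inter> U}" by auto
    finally show "openin T {x \<in> topspace T. q x \<in> S \<inter> U}" .
  next
    fix K
    assume K: "\<forall>U\<in>K. U \<subseteq> q ` topspace T \<and> openin T {x \<in> topspace T. q x \<in> U}"
    then have "openin T (\<Union>U\<in>K. {x \<in> topspace T. q x \<in> U})" by auto
    also have "(\<Union>U\<in>K. {x \<in> topspace T. q x \<in> U}) = {x \<in> topspace T. q x \<in> \<Union> K}" by auto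
    finally show "openin T {x \<in> topspace T. q x \<in> \<Union> K}" .
  qed blast+
  then show ?thesis
    unfolding quotient_topology_def by (simp add: topology_inverse')
qed

definition hausdorff_distance :: "'a::metric_space set \<Rightarrow> 'a set \<Rightarrow> ennreal" where
  "hausdorff_distance A B =
     max (SUP a\<in>A. INF b\<in>B. ennreal (dist a b)) (SUP b\<in>B. INF a\<in>A. ennreal (dist a b))"

subsection \<open>Groups of isometries\<close>

definition isometry_group :: "('a::metric_space \<Rightarrow> 'a) set \<Rightarrow> bool" where
  "isometry_group \<Gamma> \<longleftrightarrow>
     subgroup \<Gamma> (BijGroup UNIV) \<and> (\<forall>g\<in>\<Gamma>. \<forall>x y. dist (g x) (g y) = dist x y)"

definition properly_discontinuous :: "('a::metric_space \<Rightarrow> 'a) set \<Rightarrow> bool" where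
  "properly_discontinuous \<Gamma> \<longleftrightarrow> (\<forall>K. compact K \<longrightarrow> finite {g\<in>\<Gamma>. g ` K \<inter> K \<noteq> {}})"

definition orbit_of :: "('a \<Rightarrow> 'a) set \<Rightarrow> 'a \<Rightarrow> 'a set" where
  "orbit_of \<Gamma> x = (\<lambda>g. g x) ` \<Gamma>"

definition bdry_act :: "('a \<Rightarrow> 'a) \<Rightarrow> 'a bdry \<Rightarrow> 'a bdry" where
  "bdry_act g \<xi> = (\<lambda>u. g \<circ> u) ` \<xi>"

definition bdry_orbit_of :: "('a \<Rightarrow> 'a) set \<Rightarrow> 'a bdry \<Rightarrow> 'a bdry set" where
  "bdry_orbit_of \<Gamma> \<xi> = (\<lambda>g. bdry_act g \<xi>) ` \<Gamma>"

definition bdry_stab :: "('a \<Rightarrow> 'a) set \<Rightarrow> 'a bdry \<Rightarrow> ('a \<Rightarrow> 'a) set" where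
  "bdry_stab \<Gamma> \<xi> = {g\<in>\<Gamma>. bdry_act g \<xi> = \<xi>}"

definition limit_set :: "'a::metric_space \<Rightarrow> ('a \<Rightarrow> 'a) set \<Rightarrow> 'a bdry set" where
  "limit_set x\<^sub>0 \<Gamma> = {\<xi>\<in>gromov_boundary x\<^sub>0. \<exists>u\<in>\<xi>. range u \<subseteq> orbit_of \<Gamma> x\<^sub>0}"

definition geodesic_hull :: "'a::metric_space \<Rightarrow> ('a \<Rightarrow> 'a) set \<Rightarrow> 'a set" where
  "geodesic_hull x\<^sub>0 \<Gamma> =
     \<Union> {range c | c \<xi> \<eta>. \<xi> \<in> limit_set x\<^sub>0 \<Gamma> \<and> \<eta> \<in> limit_set x\<^sub>0 \<Gamma> \<and> geodesic_line_between \<xi> \<eta> c}"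

text \<open>Loxodromic: the stable translation length \<open>lim d(x, g\<^sup>n x) / n\<close> is positive.  The limit
  exists by subadditivity and does not depend on \<open>x\<close>.\<close>

definition loxodromic :: "'a::metric_space \<Rightarrow> ('a \<Rightarrow> 'a) \<Rightarrow> bool" where
  "loxodromic x\<^sub>0 g \<longleftrightarrow> lim (\<lambda>n. dist x\<^sub>0 ((g ^^ n) x\<^sub>0) / real n) > 0"

definition parabolic_subgroup ::
    "'a::metric_space \<Rightarrow> ('a \<Rightarrow> 'a) set \<Rightarrow> ('a \<Rightarrow> 'a) set \<Rightarrow> bool" where
  "parabolic_subgroup x\<^sub>0 \<Gamma> P \<longleftrightarrow>
     subgroup P (BijGroup UNIV) \<and> P \<subseteq> \<Gamma> \<and> infinite P \<and>
     (\<exists>!\<xi>. \<xi> \<in> gromov_boundary x\<^sub>0 \<and> (\<forall>g\<in>P. bdry_act g \<xi> = \<xi>)) \<and>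
     (\<forall>g\<in>P. \<not> loxodromic x\<^sub>0 g)"

definition maximal_parabolic_subgroup ::
    "'a::metric_space \<Rightarrow> ('a \<Rightarrow> 'a) set \<Rightarrow> ('a \<Rightarrow> 'a) set \<Rightarrow> bool" where
  "maximal_parabolic_subgroup x\<^sub>0 \<Gamma> P \<longleftrightarrow>
     parabolic_subgroup x\<^sub>0 \<Gamma> P \<and> (\<forall>P'. parabolic_subgroup x\<^sub>0 \<Gamma> P' \<and> P \<subseteq> P' \<longrightarrow> P' = P)"

definition parabolic_points :: "'a::metric_space \<Rightarrow> ('a \<Rightarrow> 'a) set \<Rightarrow> 'a bdry set" where
  "parabolic_points x\<^sub>0 \<Gamma> = {\<xi>\<in>limit_set x\<^sub>0 \<Gamma>. parabolic_subgroup x\<^sub>0 \<Gamma> (bdry_stab \<Gamma> \<xi>)}"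

definition bounded_parabolic_points :: "'a::metric_space \<Rightarrow> ('a \<Rightarrow> 'a) set \<Rightarrow> 'a bdry set" where
  "bounded_parabolic_points x\<^sub>0 \<Gamma> =
     {\<xi>\<in>parabolic_points x\<^sub>0 \<Gamma>.
        compact_space (quotient_topology
          (subtopology (bdry_topology x\<^sub>0) (limit_set x\<^sub>0 \<Gamma> - {\<xi>}))
          (bdry_orbit_of (bdry_stab \<Gamma> \<xi>)))}"

definition conical_points :: "'a::metric_space \<Rightarrow> ('a \<Rightarrow> 'a) set \<Rightarrow> 'a bdry set" where
  "conical_points x\<^sub>0 \<Gamma> =
     {\<xi>\<in>limit_set x\<^sub>0 \<Gamma>. \<exists>g::nat \<Rightarrow> 'a \<Rightarrow> 'a. \<exists>a\<in>limit_set x\<^sub>0 \<Gamma>. \<exists>b\<in>limit_set x\<^sub>0 \<Gamma>.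
        (\<forall>n. g n \<in> \<Gamma>) \<and> a \<noteq> b \<and>
        limitin (bdry_topology x\<^sub>0) (\<lambda>n. bdry_act (g n) \<xi>) a sequentially \<and>
        (\<forall>\<eta>\<in>limit_set x\<^sub>0 \<Gamma> - {\<xi>}.
           limitin (bdry_topology x\<^sub>0) (\<lambda>n. bdry_act (g n) \<eta>) b sequentially)}"

definition geometrically_finite :: "'a::metric_space \<Rightarrow> ('a \<Rightarrow> 'a) set \<Rightarrow> bool" where
  "geometrically_finite x\<^sub>0 \<Gamma> \<longleftrightarrow>
     (\<exists>T\<subseteq>limit_set x\<^sub>0 \<Gamma>. card T = 3) \<and>
     limit_set x\<^sub>0 \<Gamma> \<subseteq> conical_points x\<^sub>0 \<Gamma> \<union> bounded_parabolic_points x\<^sub>0 \<Gamma>"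

subsection \<open>Orbit growth of parabolic subgroups\<close>

definition orbit_count :: "'a::metric_space \<Rightarrow> ('a \<Rightarrow> 'a) set \<Rightarrow> real \<Rightarrow> real" where
  "orbit_count x\<^sub>0 P t = real (card {g\<in>P. dist x\<^sub>0 (g x\<^sub>0) \<le> t})"

definition growth_rate :: "'a::metric_space \<Rightarrow> ('a \<Rightarrow> 'a) set \<Rightarrow> real \<Rightarrow> real \<Rightarrow> real" where
  "growth_rate x\<^sub>0 P r t = 1 / r * ln (orbit_count x\<^sub>0 P (t + r) / orbit_count x\<^sub>0 P t)"

text \<open>The supremum over \<open>t\<close> can be infinite, hence extended reals.  The two limits exist, as
  \<open>r\<close> times the infimum (supremum) is superadditive (subadditive) and monotone in \<open>r\<close>.\<close>

definition lower_growth :: "'a::metric_space \<Rightarrow> ('a \<Rightarrow> 'a) set \<Rightarrow> ereal" where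
  "lower_growth x\<^sub>0 P = Lim at_top (\<lambda>r::real. INF t\<in>{0<..}. ereal (growth_rate x\<^sub>0 P r t))"

definition upper_growth :: "'a::metric_space \<Rightarrow> ('a \<Rightarrow> 'a) set \<Rightarrow> ereal" where
  "upper_growth x\<^sub>0 P = Lim at_top (\<lambda>r::real. SUP t\<in>{0<..}. ereal (growth_rate x\<^sub>0 P r t))"

definition tempered_growth :: "'a::metric_space \<Rightarrow> real \<Rightarrow> ('a \<Rightarrow> 'a) set \<Rightarrow> bool" where
  "tempered_growth x\<^sub>0 \<delta> P \<longleftrightarrow>
     0 < lower_growth x\<^sub>0 P \<and> lower_growth x\<^sub>0 P \<le> upper_growth x\<^sub>0 P \<and> upper_growth x\<^sub>0 P < ereal \<delta>"

definition tempered_parabolic_subgroups ::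
    "'a::metric_space \<Rightarrow> real \<Rightarrow> ('a \<Rightarrow> 'a) set \<Rightarrow> bool" where
  "tempered_parabolic_subgroups x\<^sub>0 \<delta> \<Gamma> \<longleftrightarrow>
     (\<forall>P. maximal_parabolic_subgroup x\<^sub>0 \<Gamma> P \<longrightarrow> tempered_growth x\<^sub>0 \<delta> P)"

subsection \<open>Horoball decompositions\<close>

definition horoball_decomposition ::
    "'a::metric_space \<Rightarrow> ('a \<Rightarrow> 'a) set \<Rightarrow> ('a bdry \<Rightarrow> 'a set) \<Rightarrow> bool" where
  "horoball_decomposition x\<^sub>0 \<Gamma> H \<longleftrightarrow>
     (\<forall>p\<in>parabolic_points x\<^sub>0 \<Gamma>. \<exists>r>0. H p = horoball x\<^sub>0 p r) \<and>
     disjoint_family_on H (parabolic_points x\<^sub>0 \<Gamma>) \<and>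
     (\<exists>D::real. \<forall>g\<in>\<Gamma>. \<forall>p\<in>parabolic_points x\<^sub>0 \<Gamma>.
        hausdorff_distance (H (bdry_act g p)) (g ` H p) \<le> ennreal D) \<and>
     (let Q = quotient_topology (top_of_set (geodesic_hull x\<^sub>0 \<Gamma>)) (orbit_of \<Gamma>);
          Y = geodesic_hull x\<^sub>0 \<Gamma> - (\<Union>p\<in>parabolic_points x\<^sub>0 \<Gamma>. H p)
      in compactin Q (Q closure_of (orbit_of \<Gamma> ` Y)))"

text \<open>\<open>R\<close> is the set of the chosen points \<open>p\<^sub>i\<close>: it meets each \<open>\<Gamma>\<close>-orbit of parabolic points
  exactly once.\<close>

definition parabolic_representatives ::
    "'a::metric_space \<Rightarrow> ('a \<Rightarrow> 'a) set \<Rightarrow> 'a bdry set \<Rightarrow> bool" where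
  "parabolic_representatives x\<^sub>0 \<Gamma> R \<longleftrightarrow>
     R \<subseteq> parabolic_points x\<^sub>0 \<Gamma> \<and>
     (\<forall>p\<in>parabolic_points x\<^sub>0 \<Gamma>. \<exists>!q. q \<in> R \<and> q \<in> bdry_orbit_of \<Gamma> p)"

text \<open>Both definite descriptions are meaningful when \<open>H\<close> is a horoball decomposition and \<open>R\<close> a
  set of representatives: the \<open>H p\<close> are disjoint, and each orbit has one point in \<open>R\<close>.\<close>

definition cusp_function ::
    "'a::metric_space \<Rightarrow> ('a \<Rightarrow> 'a) set \<Rightarrow> ('a bdry \<Rightarrow> 'a set) \<Rightarrow> 'a bdry set \<Rightarrow> 'a \<Rightarrow> real" where
  "cusp_function x\<^sub>0 \<Gamma> H R x =
     (if \<exists>p\<in>parabolic_points x\<^sub>0 \<Gamma>. x \<in> H p then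
        let p = (THE p. p \<in> parabolic_points x\<^sub>0 \<Gamma> \<and> x \<in> H p);
            q = (THE q. q \<in> R \<and> q \<in> bdry_orbit_of \<Gamma> p)
        in orbit_count x\<^sub>0 (bdry_stab \<Gamma> q) (2 * infdist x (orbit_of \<Gamma> x\<^sub>0))
      else 1)"

subsection \<open>Quasi-conformal densities\<close>

text \<open>\<open>RN_deriv M N\<close> is the derivative of \<open>N\<close> with respect to \<open>M\<close>.\<close>

definition quasi_conformal_density ::
    "'a::metric_space \<Rightarrow> ('a \<Rightarrow> 'a) set \<Rightarrow> real \<Rightarrow> ('a \<Rightarrow> 'a bdry measure) \<Rightarrow> bool" where
  "quasi_conformal_density x\<^sub>0 \<Gamma> \<delta> \<mu> \<longleftrightarrow>
     \<delta> > 0 \<and>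
     (\<forall>x. sets (\<mu> x) = sets (bdry_borel x\<^sub>0) \<and> finite_measure (\<mu> x) \<and>
          emeasure (\<mu> x) (gromov_boundary x\<^sub>0) \<noteq> 0 \<and>
          (AE \<eta> in \<mu> x. \<eta> \<in> limit_set x\<^sub>0 \<Gamma>)) \<and>
     (\<forall>x y. absolutely_continuous (\<mu> x) (\<mu> y)) \<and>
     (\<exists>C>0.
        (\<forall>g\<in>\<Gamma>. \<forall>x. AE \<eta> in \<mu> (g x).
           ennreal (1 / C) \<le> RN_deriv (\<mu> (g x)) (distr (\<mu> x) (bdry_borel x\<^sub>0) (bdry_act g)) \<eta> \<and>
           RN_deriv (\<mu> (g x)) (distr (\<mu> x) (bdry_borel x\<^sub>0) (bdry_act g)) \<eta> \<le> ennreal C) \<and>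
        (\<forall>x y. AE \<eta> in \<mu> y.
           ennreal (1 / C * exp (- \<delta> * busemann \<eta> x y)) \<le> RN_deriv (\<mu> y) (\<mu> x) \<eta> \<and>
           RN_deriv (\<mu> y) (\<mu> x) \<eta> \<le> ennreal (C * exp (- \<delta> * busemann \<eta> x y))))"

end

theory Submission
  imports Defs
begin

text \<open>
  By conformality, \<open>\<mu>\<^bsub>o\<^esub>(V(o,\<xi>,t))\<close> is comparable to \<open>e\<^sup>-\<^sup>\<delta>\<^sup>t \<mu>\<^bsub>x\<^esub>(V(o,\<xi>,t))\<close> for the point \<open>x\<close> at
  distance \<open>t\<close> on the ray.  If \<open>x\<close> is near the orbit, then \<open>\<mu>\<^bsub>x\<^esub>\<close> has bounded total mass, and the shadow,
  seen from \<open>x\<close>, contains a shadow of bounded size, whose mass is bounded below since every limit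
  point is charged.  Otherwise \<open>x\<close> has large depth \<open>d\<close>, comparable to its distance to the orbit, in
  the horoball of a parabolic point \<open>p\<close>.  By cocompactness outside the horoballs we can move
  the point where the ray enters or leaves the horoball near \<open>o\<close>, which leaves finitely many \<open>p\<close>,
  and the translates \<open>gK\<close>, \<open>g \<in> stab(p)\<close>, of a fundamental set \<open>K\<close> away from \<open>p\<close> cover the limit set
  without \<open>p\<close>, with bounded multiplicity.
  One has \<open>\<mu>\<^bsub>x\<^esub>(gK) \<asymp> exp(-\<delta> max(d, \<bar>g\<bar> - d))\<close> for \<open>\<bar>g\<bar> = d(o,go)\<close>, and tempered growth makes the sum over
  all \<open>g\<close>, over \<open>\<bar>g\<bar> \<le> 2d\<close>, and over \<open>\<bar>g\<bar> \<ge> 2d\<close> comparable to \<open>B\<^sub>p(2d) e\<^sup>-\<^sup>\<delta>\<^sup>d\<close>.  On the way up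
  towards \<open>p\<close> the shadow contains the pieces with \<open>\<bar>g\<bar> \<ge> 2d\<close> (up to constants), on the way
  down those with \<open>\<bar>g\<bar> \<le> 2d\<close>.
\<close>

text \<open>Boundary data are lower limits over classes of sequences, so most identities hold only
  up to an error: an inequality at infinity is proved eventually along chosen representatives, as
  linear arithmetic of Gromov products, and transferred back at the cost of a multiple of
  \<open>D\<close>. The expression max(d, |g| - d) is a distance. The geodesic from
  \<open>x\<^sub>0\<close> to \<open>g x\<^sub>0\<close> climbs towards \<open>p\<close> for half
  its length |g|/2; a point above \<open>x\<^sub>0\<close> at depth d either lies near it (|g| \<ge>
  2d), at distance |g| - d from \<open>g x\<^sub>0\<close>, or has to descend the depth d. The
  regimes meet at |g| = 2d, which explains the argument of the counting function. Beyond it, an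
  upper growth exponent below \<delta> makes the sum geometric, and a positive lower exponent makes
  an annulus of bounded width contain at least B(2d) elements. The boundary is never treated as a
  compact space: uniformity comes from compactness of balls in X, from finiteness of the set of
  parabolic points whose horoballs come near \<open>x\<^sub>0\<close>, and from the absence of
  atoms.\<close>

locale hyp_space =
  fixes x\<^sub>0 :: "'a::heine_borel" and D :: real
  assumes D_ge_1: "1 \<le> D"
    and hyp: "\<And>w x y z::'a.
      min (gromov_product w x y) (gromov_product w y z) - D \<le> gromov_product w x z"
    and geod: "geodesic_space TYPE('a)"
begin

section \<open>Elementary estimates for Gromov products\<close>

abbreviation gp :: "'a \<Rightarrow> 'a \<Rightarrow> real" where "gp \<equiv> gromov_product x\<^sub>0"

lemma gp_hyp: "min (gp x y) (gp y z) - D \<le> gp x z"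
  by (rule hyp)

lemma gp_commute: "gromov_product w x y = gromov_product w y x"
  unfolding gromov_product_def by (simp add: dist_commute)

lemma gp_nonneg: "0 \<le> gromov_product w x y"
  unfolding gromov_product_def using dist_triangle3[of x y w] by (simp add: dist_commute)

lemma gp_le_dist: "gromov_product w x y \<le> dist w x" "gromov_product w x y \<le> dist w y"
  unfolding gromov_product_def using dist_triangle[of w x y] dist_triangle[of w y x]
  by (auto simp: dist_commute)

lemma gp_change_base: "gromov_product v x y \<le> gromov_product w x y + dist v w"
  unfolding gromov_product_def using dist_triangle[of v x w] dist_triangle[of v y w]
  by (simp add: dist_commute field_simps)

lemma gp_change_point: "gromov_product w x y \<le> gromov_product w x' y + dist x x'"
  unfolding gromov_product_def using dist_triangle[of w x x'] dist_triangle[of x' y x]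
  by (simp add: dist_commute field_simps)

text \<open>An exact change of base point, for the estimates in which \<open>dist v x\<close> is the
  main term and the Lipschitz bound \<open>gp_change_base\<close> would lose it.\<close>

lemma gp_base_formula:
  "gromov_product v y z = gromov_product x y z + dist v x - gromov_product x v y - gromov_product x v z"
  unfolding gromov_product_def by (simp add: dist_commute field_simps)

subsection \<open>Boundary points as classes of sequences\<close>

lemma gromov_sequenceD:
  assumes "gromov_sequence x\<^sub>0 u"
  obtains N where "\<And>m n. m \<ge> N \<Longrightarrow> n \<ge> N \<Longrightarrow> T \<le> gp (u m) (u n)"
proof -
  have "\<forall>\<^sub>F x in sequentially \<times>\<^sub>F sequentially. T \<le> (case x of (m, n) \<Rightarrow> gp (u m) (u n))"
    using assms unfolding gromov_sequence_def filterlim_at_top by blast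
  then show ?thesis using that unfolding eventually_prod_sequentially by auto
qed

lemma gromov_sequenceI:
  assumes "\<And>T. \<exists>N. \<forall>m\<ge>N. \<forall>n\<ge>N. T \<le> gp (u m) (u n)"
  shows "gromov_sequence x\<^sub>0 u"
  unfolding gromov_sequence_def filterlim_at_top eventually_prod_sequentially
proof
  fix T
  obtain N where "\<forall>m\<ge>N. \<forall>n\<ge>N. T \<le> gp (u m) (u n)" using assms by blast
  then show "\<exists>N. \<forall>m\<ge>N. \<forall>n\<ge>N. T \<le> (case (n, m) of (m, n) \<Rightarrow> gp (u m) (u n))" by auto
qed

text \<open>Equivalence is defined along the diagonal only. The chain \<open>u m\<close>,
  \<open>u k\<close>, \<open>v k\<close>, \<open>v n\<close> through a late index \<open>k\<close>
  makes it uniform in both indices; each of the two inner joints costs \<open>D\<close>.\<close>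

lemma gromov_equivD:
  assumes "(u, v) \<in> gromov_equiv x\<^sub>0"
  obtains N where "\<And>m n. m \<ge> N \<Longrightarrow> n \<ge> N \<Longrightarrow> T \<le> gp (u m) (v n)"
proof -
  have u: "gromov_sequence x\<^sub>0 u" and v: "gromov_sequence x\<^sub>0 v"
    and uv: "filterlim (\<lambda>n. gp (u n) (v n)) at_top sequentially"
    using assms by (auto simp: gromov_equiv_def)
  obtain N1 where N1: "\<And>m n. m \<ge> N1 \<Longrightarrow> n \<ge> N1 \<Longrightarrow> T + 2 * D \<le> gp (u m) (u n)"
    using gromov_sequenceD[OF u, of "T + 2 * D"] by metis
  obtain N2 where N2: "\<And>m n. m \<ge> N2 \<Longrightarrow> n \<ge> N2 \<Longrightarrow> T + 2 * D \<le> gp (v m) (v n)"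
    using gromov_sequenceD[OF v, of "T + 2 * D"] by metis
  obtain N3 where N3: "\<And>n. n \<ge> N3 \<Longrightarrow> T + 2 * D \<le> gp (u n) (v n)"
    using uv unfolding filterlim_at_top eventually_sequentially by meson
  obtain k where k: "k \<ge> N1" "k \<ge> N2" "k \<ge> N3" by (metis max.cobounded1 max.cobounded2 order_trans)
  show ?thesis
  proof (rule that)
    fix m n assume mn: "m \<ge> k" "n \<ge> k"
    have "T + 2 * D \<le> gp (u m) (u k)" "T + 2 * D \<le> gp (u k) (v k)" "T + 2 * D \<le> gp (v k) (v n)"
      using N1[of m k] N2[of k n] N3[of k] mn k by (meson order_trans)+
    then show "T \<le> gp (u m) (v n)"
      using gp_hyp[of "u m" "u k" "v k"] gp_hyp[of "u m" "v k" "v n"] D_ge_1 by linarith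
  qed
qed

text \<open>Infinitely many large diagonal products suffice, because both sequences already
  converge: one good index \<open>k\<close> is spread to all later ones.\<close>

lemma gromov_equivI:
  assumes "gromov_sequence x\<^sub>0 u" "gromov_sequence x\<^sub>0 v" "\<And>T. \<exists>\<^sub>F n in sequentially. T \<le> gp (u n) (v n)"
  shows "(u, v) \<in> gromov_equiv x\<^sub>0"
proof -
  have "\<forall>\<^sub>F n in sequentially. T \<le> gp (u n) (v n)" for T
  proof -
    obtain N1 where N1: "\<And>m n. m \<ge> N1 \<Longrightarrow> n \<ge> N1 \<Longrightarrow> T + 2 * D \<le> gp (u m) (u n)"
      using gromov_sequenceD[OF assms(1), of "T + 2 * D"] by metis
    obtain N2 where N2: "\<And>m n. m \<ge> N2 \<Longrightarrow> n \<ge> N2 \<Longrightarrow> T + 2 * D \<le> gp (v m) (v n)"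
      using gromov_sequenceD[OF assms(2), of "T + 2 * D"] by metis
    obtain k where k: "k \<ge> max N1 N2" "T + 2 * D \<le> gp (u k) (v k)"
      using assms(3)[of "T + 2 * D"] unfolding frequently_sequentially by blast
    show ?thesis unfolding eventually_sequentially
    proof (intro exI allI impI)
      fix n assume n: "max N1 N2 \<le> n"
      have "T + 2 * D \<le> gp (u n) (u k)" "T + 2 * D \<le> gp (v k) (v n)"
        using N1[of n k] N2[of k n] n k by auto
      then show "T \<le> gp (u n) (v n)"
        using k(2) gp_hyp[of "u n" "u k" "v k"] gp_hyp[of "u n" "v k" "v n"] D_ge_1 by linarith
    qed
  qed
  then show ?thesis
    using assms(1,2) unfolding gromov_equiv_def filterlim_at_top by auto
qed

lemma equiv_gromov_equiv: "equiv {u. gromov_sequence x\<^sub>0 u} (gromov_equiv x\<^sub>0)"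
proof (rule equivI)
  show "gromov_equiv x\<^sub>0 \<subseteq> {u. gromov_sequence x\<^sub>0 u} \<times> {u. gromov_sequence x\<^sub>0 u}"
    by (auto simp: gromov_equiv_def)
  show "refl_on {u. gromov_sequence x\<^sub>0 u} (gromov_equiv x\<^sub>0)"
  proof (rule refl_onI)
    fix u assume u: "u \<in> {u. gromov_sequence x\<^sub>0 u}"
    show "(u, u) \<in> gromov_equiv x\<^sub>0"
    proof (rule gromov_equivI)
      fix T
      obtain N where "\<And>m n. m \<ge> N \<Longrightarrow> n \<ge> N \<Longrightarrow> T \<le> gp (u m) (u n)"
        using gromov_sequenceD[of u T] u by blast
      then show "\<exists>\<^sub>F n in sequentially. T \<le> gp (u n) (u n)"
        unfolding frequently_sequentially by (meson nat_le_linear)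
    qed (use u in auto)
  qed
  show "sym (gromov_equiv x\<^sub>0)"
    by (auto simp: sym_def gromov_equiv_def gp_commute)
  show "trans (gromov_equiv x\<^sub>0)"
  proof (rule transI)
    fix u v w assume uv: "(u, v) \<in> gromov_equiv x\<^sub>0" and vw: "(v, w) \<in> gromov_equiv x\<^sub>0"
    show "(u, w) \<in> gromov_equiv x\<^sub>0"
    proof (rule gromov_equivI)
      fix T
      obtain N1 where N1: "\<And>m n. m \<ge> N1 \<Longrightarrow> n \<ge> N1 \<Longrightarrow> T + D \<le> gp (u m) (v n)"
        using gromov_equivD[OF uv, of "T + D"] by metis
      obtain N2 where N2: "\<And>m n. m \<ge> N2 \<Longrightarrow> n \<ge> N2 \<Longrightarrow> T + D \<le> gp (v m) (w n)"
        using gromov_equivD[OF vw, of "T + D"] by metis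
      have "T \<le> gp (u n) (w n)" if "n \<ge> max N1 N2" for n
        using N1[of n n] N2[of n n] gp_hyp[of "u n" "v n" "w n"] that by auto
      then show "\<exists>\<^sub>F n in sequentially. T \<le> gp (u n) (w n)"
        unfolding frequently_sequentially by (meson nat_le_linear)
    qed (use uv vw in \<open>auto simp: gromov_equiv_def\<close>)
  qed
qed

abbreviation bdry :: "'a bdry set" where "bdry \<equiv> gromov_boundary x\<^sub>0"

lemma bdry_nonempty: assumes "\<xi> \<in> bdry" obtains u where "u \<in> \<xi>"
  using assms in_quotient_imp_non_empty[OF equiv_gromov_equiv] unfolding gromov_boundary_def by blast

lemma bdry_equiv: "\<xi> \<in> bdry \<Longrightarrow> u \<in> \<xi> \<Longrightarrow> v \<in> \<xi> \<Longrightarrow> (u, v) \<in> gromov_equiv x\<^sub>0"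
  using in_quotient_imp_in_rel[OF equiv_gromov_equiv, of \<xi> u v] unfolding gromov_boundary_def by blast

lemma bdry_closed: "\<xi> \<in> bdry \<Longrightarrow> u \<in> \<xi> \<Longrightarrow> (u, v) \<in> gromov_equiv x\<^sub>0 \<Longrightarrow> v \<in> \<xi>"
  using in_quotient_imp_closed[OF equiv_gromov_equiv, of \<xi> u v] unfolding gromov_boundary_def by blast

lemma bdry_gromov_sequence: "\<xi> \<in> bdry \<Longrightarrow> u \<in> \<xi> \<Longrightarrow> gromov_sequence x\<^sub>0 u"
  using bdry_equiv[of \<xi> u u] by (auto simp: gromov_equiv_def)

lemma bdry_eqI:
  assumes "\<xi> \<in> bdry" "\<eta> \<in> bdry" "u \<in> \<xi>" "v \<in> \<eta>" "(u, v) \<in> gromov_equiv x\<^sub>0"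
  shows "\<xi> = \<eta>"
  using assms quotient_eqI[OF equiv_gromov_equiv, of \<xi> \<eta> u v] unfolding gromov_boundary_def by blast

lemma gromov_class_in_bdry:
  "gromov_sequence x\<^sub>0 u \<Longrightarrow> gromov_equiv x\<^sub>0 `` {u} \<in> bdry \<and> u \<in> gromov_equiv x\<^sub>0 `` {u}"
  unfolding gromov_boundary_def
  using equiv_class_self[OF equiv_gromov_equiv] by (auto intro: quotientI)

lemma bdry_ev_gp:
  assumes "\<xi> \<in> bdry" "u \<in> \<xi>" "v \<in> \<xi>"
  shows "\<forall>\<^sub>F n in sequentially. T \<le> gp (u n) (v n)"
proof -
  obtain N where "\<And>m n. m \<ge> N \<Longrightarrow> n \<ge> N \<Longrightarrow> T \<le> gp (u m) (v n)"
    using gromov_equivD[OF bdry_equiv[OF assms], of T] by metis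
  then show ?thesis unfolding eventually_sequentially by blast
qed

subsection \<open>The filter of neighbourhoods of a boundary point\<close>

text \<open>An explicit base of the filter \<open>towards \<xi>\<close>, which itself is only given
  as a supremum over the sequences in the class; that it is a base is \<open>eventually_near\<close>
  together with \<open>towards_contains_near\<close>.\<close>

definition near :: "'a bdry \<Rightarrow> real \<Rightarrow> 'a set" where
  "near \<xi> T = {z. \<forall>u\<in>\<xi>. \<forall>\<^sub>F n in sequentially. T \<le> gp z (u n)}"

lemma eventually_towards:
  "eventually P (towards \<xi>) \<longleftrightarrow> (\<forall>u\<in>\<xi>. \<forall>\<^sub>F n in sequentially. P (u n))"
  unfolding towards_def by (simp add: eventually_Sup eventually_filtermap)

lemma towards_neq_bot: assumes "\<xi> \<in> bdry" shows "towards \<xi> \<noteq> bot"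
proof
  assume "towards \<xi> = bot"
  then have "eventually (\<lambda>_. False) (towards \<xi>)" by simp
  then show False using bdry_nonempty[OF assms] unfolding eventually_towards by auto
qed

text \<open>Two members of the class are eventually as close as desired, so hyperbolicity passes
  from infinitely many indices of one of them to every other at the cost of
  \<open>D\<close>.\<close>

lemma nearI:
  assumes "\<xi> \<in> bdry" "u \<in> \<xi>" "\<exists>\<^sub>F n in sequentially. T + D \<le> gp z (u n)"
  shows "z \<in> near \<xi> T"
  unfolding near_def
proof (intro CollectI ballI)
  fix v assume v: "v \<in> \<xi>"
  obtain N where N: "\<And>m n. m \<ge> N \<Longrightarrow> n \<ge> N \<Longrightarrow> T + D \<le> gp (u m) (v n)"
    using gromov_equivD[OF bdry_equiv[OF assms(1,2) v], of "T + D"] by metis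
  obtain k where k: "k \<ge> N" "T + D \<le> gp z (u k)"
    using assms(3) unfolding frequently_sequentially by blast
  have "T \<le> gp z (v n)" if "n \<ge> N" for n
    using N[of k n] k that gp_hyp[of z "u k" "v n"] by auto
  then show "\<forall>\<^sub>F n in sequentially. T \<le> gp z (v n)" unfolding eventually_sequentially by blast
qed

lemma eventually_near:
  assumes "\<xi> \<in> bdry" shows "eventually (\<lambda>z. z \<in> near \<xi> T) (towards \<xi>)"
  unfolding eventually_towards
proof
  fix u assume u: "u \<in> \<xi>"
  obtain N where N: "\<And>m n. m \<ge> N \<Longrightarrow> n \<ge> N \<Longrightarrow> T + D \<le> gp (u m) (u n)"
    using gromov_sequenceD[OF bdry_gromov_sequence[OF assms u], of "T + D"] by metis
  have "u m \<in> near \<xi> T" if "m \<ge> N" for m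
  proof (rule nearI[OF assms u])
    show "\<exists>\<^sub>F n in sequentially. T + D \<le> gp (u m) (u n)"
      unfolding frequently_sequentially using N that by (meson nat_le_linear)
  qed
  then show "\<forall>\<^sub>F n in sequentially. u n \<in> near \<xi> T" unfolding eventually_sequentially by blast
qed

lemma near_ev:
  assumes "z \<in> near \<xi> T" "u \<in> \<xi>" shows "\<forall>\<^sub>F n in sequentially. T \<le> gp z (u n)"
  using assms unfolding near_def by blast

lemma near_gp:
  assumes "\<xi> \<in> bdry" "y \<in> near \<xi> T" "z \<in> near \<xi> T" shows "T - D \<le> gp y z"
proof -
  obtain u where u: "u \<in> \<xi>" using bdry_nonempty[OF assms(1)] .
  have "\<forall>\<^sub>F n in sequentially. T \<le> gp y (u n) \<and> T \<le> gp z (u n)"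
    using near_ev[OF assms(2) u] near_ev[OF assms(3) u] by eventually_elim auto
  then obtain n where "T \<le> gp y (u n)" "T \<le> gp z (u n)"
    using eventually_happens'[OF sequentially_bot] by blast
  then show ?thesis using gp_hyp[of y "u n" z] by (simp add: gp_commute)
qed

lemma near_mono: "S \<le> T \<Longrightarrow> near \<xi> T \<subseteq> near \<xi> S"
  unfolding near_def by (auto elim!: eventually_mono ballE)

lemma near_seq_mem:
  assumes \<xi>: "\<xi> \<in> bdry" and w: "\<And>T. \<forall>\<^sub>F n in sequentially. w n \<in> near \<xi> T"
  shows "w \<in> \<xi>"
proof -
  obtain u where u: "u \<in> \<xi>" using bdry_nonempty[OF \<xi>] .
  have gu: "gromov_sequence x\<^sub>0 u" by (rule bdry_gromov_sequence[OF \<xi> u])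
  have gw: "gromov_sequence x\<^sub>0 w"
  proof (rule gromov_sequenceI)
    fix T
    obtain N where "\<And>n. n \<ge> N \<Longrightarrow> w n \<in> near \<xi> (T + D)"
      using w[of "T + D"] unfolding eventually_sequentially by blast
    then show "\<exists>N. \<forall>m\<ge>N. \<forall>n\<ge>N. T \<le> gp (w m) (w n)"
      using near_gp[OF \<xi>, of _ "T + D"] by (metis add_diff_cancel_right')
  qed
  have "(u, w) \<in> gromov_equiv x\<^sub>0"
  proof (rule gromov_equivI[OF gu gw])
    fix T
    obtain N1 where N1: "\<And>m n. m \<ge> N1 \<Longrightarrow> n \<ge> N1 \<Longrightarrow> T + D \<le> gp (u m) (u n)"
      using gromov_sequenceD[OF gu, of "T + D"] by metis
    obtain N2 where N2: "\<And>n. n \<ge> N2 \<Longrightarrow> w n \<in> near \<xi> (T + D)"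
      using w[of "T + D"] unfolding eventually_sequentially by blast
    have "T \<le> gp (u n) (w n)" if n: "n \<ge> max N1 N2" for n
    proof -
      have "\<forall>\<^sub>F m in sequentially. T + D \<le> gp (w n) (u m) \<and> m \<ge> N1"
        using near_ev[OF N2 u] eventually_ge_at_top n by (auto intro: eventually_conj)
      then obtain m where "T + D \<le> gp (w n) (u m)" "m \<ge> N1"
        using eventually_happens'[OF sequentially_bot] by blast
      then show ?thesis
        using N1[of n m] n gp_hyp[of "u n" "u m" "w n"] gp_commute[of x\<^sub>0 "w n"] by auto
    qed
    then show "\<exists>\<^sub>F n in sequentially. T \<le> gp (u n) (w n)"
      unfolding frequently_sequentially by (meson nat_le_linear)
  qed
  then show ?thesis using bdry_closed[OF \<xi> u] by blast
qed

text \<open>If every \<open>near \<xi> T\<close> contained a counterexample, the counterexamples in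
  \<open>near \<xi> (real n)\<close> would form a sequence that belongs to the class by
  \<open>near_seq_mem\<close>, along which \<open>P\<close> has to hold eventually.\<close>

lemma towards_contains_near:
  assumes "\<xi> \<in> bdry" "eventually P (towards \<xi>)"
  obtains T where "\<And>z. z \<in> near \<xi> T \<Longrightarrow> P z"
proof (rule ccontr)
  assume "\<not> thesis"
  then have "\<forall>T. \<exists>z. z \<in> near \<xi> T \<and> \<not> P z" using that by blast
  then obtain z where z: "\<And>T. z T \<in> near \<xi> T" "\<And>T. \<not> P (z T)" by metis
  have "(\<lambda>n. z (real n)) \<in> \<xi>"
  proof (rule near_seq_mem[OF assms(1)])
    fix T
    obtain N :: nat where N: "T \<le> real N" using real_arch_simple by blast
    show "\<forall>\<^sub>F n in sequentially. z (real n) \<in> near \<xi> T"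
      using eventually_ge_at_top[of N]
    proof eventually_elim
      case (elim n)
      then have "T \<le> real n" using N by linarith
      then show ?case using near_mono z(1) by blast
    qed
  qed
  then have "\<forall>\<^sub>F n in sequentially. P (z (real n))"
    using assms(2)[unfolded eventually_towards] by (rule bspec[rotated])
  then show False using z(2) by simp
qed

subsection \<open>Boundary products and Busemann functions along sequences\<close>

abbreviation bprod :: "'a bdry \<Rightarrow> 'a bdry \<Rightarrow> ereal" where "bprod \<equiv> bdry_product x\<^sub>0"
abbreviation bus :: "'a bdry \<Rightarrow> 'a \<Rightarrow> real" where "bus \<xi> x \<equiv> busemann \<xi> x x\<^sub>0"

text \<open>The product of a point and a boundary point, tied exactly to the Busemann function; along
  sequences it is only approximated up to \<open>D\<close>.\<close>

definition pp :: "'a \<Rightarrow> 'a bdry \<Rightarrow> real" where "pp x \<xi> = (dist x\<^sub>0 x - bus \<xi> x) / 2"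

lemma busemann_approx_aux:
  assumes "\<xi> \<in> bdry"
  shows "\<exists>L. Liminf (towards \<xi>) (\<lambda>z. ereal (dist x z - dist y z)) = ereal L \<and>
    eventually (\<lambda>z. \<bar>dist x z - dist y z - L\<bar> \<le> 2 * D) (towards \<xi>)"
proof -
  define f where "f z = dist x z - dist y z" for z
  \<comment> \<open>On \<open>A\<close> two points have a product, seen from \<open>y\<close>,
    larger than \<open>dist x y\<close>: \<open>near_gp\<close> takes \<open>D\<close>, the change
    of base takes \<open>dist x\<^sub>0 y\<close>. This exceeds the products with \<open>x\<close>,
    so hyperbolicity compares the latter up to \<open>D\<close>, hence the distance differences up
    to \<open>2 * D\<close>.\<close>
  define A where "A = near \<xi> (dist x\<^sub>0 x + dist x y + D + 1 + dist x\<^sub>0 y)"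
  have A: "eventually (\<lambda>z. z \<in> A) (towards \<xi>)" unfolding A_def by (rule eventually_near[OF assms])
  have osc: "f z \<le> f z' + 2 * D" if "z \<in> A" "z' \<in> A" for z z'
  proof -
    have "dist x\<^sub>0 x + dist x y + 1 + dist x\<^sub>0 y \<le> gp z z'" using near_gp[OF assms that[unfolded A_def]] by simp
    then have "gromov_product y z z' > dist x y"
      using gp_change_base[of x\<^sub>0 z z' y] zero_le_dist[of x\<^sub>0 x] by linarith
    then have "gromov_product y z' z > gromov_product y x z" "gromov_product y z z' > gromov_product y x z'"
      using gp_le_dist(1)[of y x z] gp_le_dist(1)[of y x z'] by (auto simp: gp_commute dist_commute)
    then have "gromov_product y x z' - D \<le> gromov_product y x z"
      using hyp[of y x z' z] by (simp add: gp_commute)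
    then show ?thesis unfolding f_def gromov_product_def by (simp add: dist_commute field_simps)
  qed
  obtain u where u: "u \<in> \<xi>" using bdry_nonempty[OF assms] .
  have "\<forall>\<^sub>F n in sequentially. u n \<in> A" using A u unfolding eventually_towards by blast
  then obtain a where a: "a \<in> A" using eventually_happens'[OF sequentially_bot] by blast
  have ne: "towards \<xi> \<noteq> bot" by (rule towards_neq_bot[OF assms])
  define L where "L = Liminf (towards \<xi>) (\<lambda>z. ereal (f z))"
  have L1: "ereal (f z - 2 * D) \<le> L" if "z \<in> A" for z
    unfolding L_def
  proof (rule Liminf_bounded, rule eventually_mono[OF A])
    fix z' assume "z' \<in> A"
    from osc[OF that this] show "ereal (f z - 2 * D) \<le> ereal (f z')" by simp
  qed
  have L2: "L \<le> ereal (f z + 2 * D)" if "z \<in> A" for z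
  proof -
    have "L \<le> Limsup (towards \<xi>) (\<lambda>z. ereal (f z))" unfolding L_def by (rule Liminf_le_Limsup[OF ne])
    also have "\<dots> \<le> ereal (f z + 2 * D)"
    proof (rule Limsup_bounded, rule eventually_mono[OF A])
      fix z' assume "z' \<in> A"
      from osc[OF this that] show "ereal (f z') \<le> ereal (f z + 2 * D)" by simp
    qed
    finally show ?thesis .
  qed
  obtain l where l: "L = ereal l"
    using L1[OF a] L2[OF a] by (cases L) auto
  have "eventually (\<lambda>z. \<bar>f z - l\<bar> \<le> 2 * D) (towards \<xi>)"
  proof (rule eventually_mono[OF A])
    fix z assume "z \<in> A"
    then show "\<bar>f z - l\<bar> \<le> 2 * D" using L1[of z] L2[of z] l by (auto simp: abs_le_iff)
  qed
  then show ?thesis using l unfolding L_def f_def by auto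
qed

lemma busemann_approx:
  assumes "\<xi> \<in> bdry" "u \<in> \<xi>"
  shows "\<forall>\<^sub>F n in sequentially. \<bar>dist x (u n) - dist y (u n) - busemann \<xi> x y\<bar> \<le> 2 * D"
proof -
  obtain L where L: "Liminf (towards \<xi>) (\<lambda>z. ereal (dist x z - dist y z)) = ereal L"
    "eventually (\<lambda>z. \<bar>dist x z - dist y z - L\<bar> \<le> 2 * D) (towards \<xi>)"
    using busemann_approx_aux[OF assms(1)] by blast
  have "busemann \<xi> x y = L" unfolding busemann_def L(1) by simp
  then show ?thesis using L(2) assms(2) unfolding eventually_towards by blast
qed

text \<open>Proved on the lower limits themselves, so without the error \<open>2 * D\<close> of
  \<open>busemann_approx\<close>: the continuity of \<open>bus\<close>, on which all intermediate
  value arguments rest, would not survive an additive error.\<close>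

lemma busemann_lipschitz:
  assumes "\<xi> \<in> bdry"
  shows "busemann \<xi> x y \<le> busemann \<xi> x' y + dist x x'"
proof -
  obtain L where L: "Liminf (towards \<xi>) (\<lambda>z. ereal (dist x z - dist y z)) = ereal L"
    using busemann_approx_aux[OF assms] by blast
  obtain L' where L': "Liminf (towards \<xi>) (\<lambda>z. ereal (dist x' z - dist y z)) = ereal L'"
    using busemann_approx_aux[OF assms] by blast
  have "ereal (L - dist x x') \<le> ereal L'"
    unfolding L'[symmetric] le_Liminf_iff
  proof (intro allI impI)
    fix r assume r: "r < ereal (L - dist x x')"
    have *: "\<And>r. r < ereal L \<Longrightarrow> eventually (\<lambda>z. r < ereal (dist x z - dist y z)) (towards \<xi>)"
      using le_Liminf_iff[of "ereal L" "towards \<xi>" "\<lambda>z. ereal (dist x z - dist y z)"] L by simp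
    show "eventually (\<lambda>z. r < ereal (dist x' z - dist y z)) (towards \<xi>)"
    proof (cases r)
      case (real q)
      then have "ereal (q + dist x x') < ereal L" using r by simp
      from *[OF this] show ?thesis
      proof (rule eventually_mono)
        fix z assume "ereal (q + dist x x') < ereal (dist x z - dist y z)"
        then show "r < ereal (dist x' z - dist y z)" using real dist_triangle[of x z x'] by simp
      qed
    qed (use r in auto)
  qed
  then show ?thesis unfolding busemann_def L L' by simp
qed

lemma busemann_abs: assumes "\<xi> \<in> bdry" shows "\<bar>busemann \<xi> x y\<bar> \<le> dist x y + 2 * D"
proof -
  obtain u where u: "u \<in> \<xi>" using bdry_nonempty[OF assms] .
  obtain n where "\<bar>dist x (u n) - dist y (u n) - busemann \<xi> x y\<bar> \<le> 2 * D"
    using eventually_happens'[OF sequentially_bot busemann_approx[OF assms u]] by blast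
  then show ?thesis using dist_triangle[of x "u n" y] dist_triangle[of y "u n" x]
    by (simp add: dist_commute abs_le_iff)
qed

lemma bus_base: assumes "\<xi> \<in> bdry" shows "bus \<xi> x\<^sub>0 = 0"
proof -
  obtain L where L: "Liminf (towards \<xi>) (\<lambda>z. ereal (dist x\<^sub>0 z - dist x\<^sub>0 z)) = ereal L"
    using busemann_approx_aux[OF assms] by blast
  have ne: "towards \<xi> \<noteq> bot"
    by (rule towards_neq_bot[OF assms])
  have "Liminf (towards \<xi>) (\<lambda>z. ereal (dist x\<^sub>0 z - dist x\<^sub>0 z)) = 0"
    using Liminf_const[OF ne, of "0::ereal"] by (simp add: zero_ereal_def)
  then show ?thesis unfolding busemann_def by simp
qed

lemma continuous_on_bus: assumes "\<xi> \<in> bdry" shows "continuous_on S (bus \<xi>)"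
proof (rule continuous_on_subset)
  show "continuous_on UNIV (bus \<xi>)"
    unfolding continuous_on_iff
  proof (intro ballI allI impI)
    fix x e :: 'a and r :: real assume r: "0 < r"
    have "dist (bus \<xi> x') (bus \<xi> e) < r" if "dist x' e < r" for x'
      using busemann_lipschitz[OF assms, of x' x\<^sub>0 e] busemann_lipschitz[OF assms, of e x\<^sub>0 x'] that
      by (simp add: dist_real_def dist_commute abs_less_iff)
    then show "\<exists>d>0. \<forall>x'\<in>UNIV. dist x' e < d \<longrightarrow> dist (bus \<xi> x') (bus \<xi> e) < r" using r by blast
  qed
qed simp

lemma pp_approx:
  assumes "\<xi> \<in> bdry" "u \<in> \<xi>"
  shows "\<forall>\<^sub>F n in sequentially. \<bar>gp x (u n) - pp x \<xi>\<bar> \<le> D"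
  using busemann_approx[OF assms, of x x\<^sub>0]
  by eventually_elim (simp add: pp_def gromov_product_def dist_commute abs_le_iff field_simps)

lemma bus_pp: "bus \<xi> x = dist x\<^sub>0 x - 2 * pp x \<xi>"
  unfolding pp_def by (simp add: field_simps)

lemma less_bprod_obtain:
  assumes "r < bprod \<xi> \<eta>"
  obtains Pf Pg where "eventually Pf (towards \<xi>)" "eventually Pg (towards \<eta>)"
    "\<And>y z. Pf y \<Longrightarrow> Pg z \<Longrightarrow> r < ereal (gp y z)"
  using less_LiminfD[OF assms[unfolded bdry_product_def]] that unfolding eventually_prod_filter by auto

text \<open>A lower limit \<open>T\<close> only yields products above every smaller number;
  \<open>1\<close> is a convenient loss, later absorbed by \<open>1 \<le> D\<close>.\<close>

lemma bprod_ge_ev: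
  assumes "\<xi> \<in> bdry" "\<eta> \<in> bdry" "ereal T \<le> bprod \<xi> \<eta>" "u \<in> \<xi>" "v \<in> \<eta>"
  shows "\<forall>\<^sub>F n in sequentially. T - 1 \<le> gp (u n) (v n)"
proof -
  have "ereal (T - 1) < ereal T" by simp
  then have "ereal (T - 1) < bprod \<xi> \<eta>" using assms(3) by (rule less_le_trans)
  then obtain Pf Pg where P: "eventually Pf (towards \<xi>)" "eventually Pg (towards \<eta>)"
    "\<And>x y. Pf x \<Longrightarrow> Pg y \<Longrightarrow> ereal (T - 1) < ereal (gp x y)"
    by (rule less_bprod_obtain) blast
  then have "\<forall>\<^sub>F n in sequentially. Pf (u n)" "\<forall>\<^sub>F n in sequentially. Pg (v n)"
    using assms(4,5) unfolding eventually_towards by auto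
  then show ?thesis
  proof eventually_elim
    case (elim n)
    then show ?case using P(3)[of "u n" "v n"] by simp
  qed
qed

text \<open>The lower limit runs over all points near the two boundary points; replacing the chosen
  sequences by arbitrary points costs \<open>D\<close> on each side.\<close>

lemma bprod_geI:
  assumes "\<xi> \<in> bdry" "\<eta> \<in> bdry" "u \<in> \<xi>" "v \<in> \<eta>" "\<exists>\<^sub>F n in sequentially. T + 2 * D \<le> gp (u n) (v n)"
  shows "ereal T \<le> bprod \<xi> \<eta>"
  unfolding bdry_product_def
proof (rule Liminf_bounded)
  have "eventually (\<lambda>(y, z). y \<in> near \<xi> (T + 2 * D) \<and> z \<in> near \<eta> (T + 2 * D)) (towards \<xi> \<times>\<^sub>F towards \<eta>)"
    unfolding eventually_prod_filter
    using eventually_near[OF assms(1)] eventually_near[OF assms(2)] by blast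
  then show "eventually (\<lambda>x. ereal T \<le> (case x of (y, z) \<Rightarrow> ereal (gp y z))) (towards \<xi> \<times>\<^sub>F towards \<eta>)"
  proof (rule eventually_mono, clarsimp)
    fix y z assume y: "y \<in> near \<xi> (T + 2 * D)" and z: "z \<in> near \<eta> (T + 2 * D)"
    have "\<exists>\<^sub>F n in sequentially. T + 2 * D \<le> gp (u n) (v n) \<and> T + 2 * D \<le> gp y (u n) \<and> T + 2 * D \<le> gp z (v n)"
    proof (rule frequently_rev_mp[OF assms(5)])
      show "\<forall>\<^sub>F n in sequentially. T + 2 * D \<le> gp (u n) (v n) \<longrightarrow>
        T + 2 * D \<le> gp (u n) (v n) \<and> T + 2 * D \<le> gp y (u n) \<and> T + 2 * D \<le> gp z (v n)"
        using near_ev[OF y assms(3)] near_ev[OF z assms(4)] by eventually_elim simp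
    qed
    from frequently_ex[OF this] obtain n where "T + 2 * D \<le> gp (u n) (v n)" "T + 2 * D \<le> gp y (u n)" "T + 2 * D \<le> gp z (v n)"
      by blast
    then show "T \<le> gp y z"
      using gp_hyp[of y "u n" "v n"] gp_hyp[of y "v n" z] D_ge_1 by (simp add: gp_commute)
  qed
qed

lemma bprod_less_ev:
  assumes "\<xi> \<in> bdry" "\<eta> \<in> bdry" "\<not> ereal T \<le> bprod \<xi> \<eta>" "u \<in> \<xi>" "v \<in> \<eta>"
  shows "\<forall>\<^sub>F n in sequentially. gp (u n) (v n) \<le> T + 2 * D"
proof (rule ccontr)
  assume "\<not> ?thesis"
  then have "\<exists>\<^sub>F n in sequentially. T + 2 * D \<le> gp (u n) (v n)"
    by (auto simp: not_eventually elim!: frequently_elim1)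
  then show False using bprod_geI[OF assms(1,2,4,5)] assms(3) by blast
qed

lemma bprod_commute: "bprod \<xi> \<eta> = bprod \<eta> \<xi>"
proof -
  have *: "bprod \<xi> \<eta> \<le> bprod \<eta> \<xi>" for \<xi> \<eta>
    unfolding bdry_product_def[of x\<^sub>0 \<eta>] le_Liminf_iff
  proof (intro allI impI)
    fix y assume "y < bprod \<xi> \<eta>"
    then obtain Pf Pg where P: "eventually Pf (towards \<xi>)" "eventually Pg (towards \<eta>)"
      "\<And>a b. Pf a \<Longrightarrow> Pg b \<Longrightarrow> y < ereal (gp a b)"
      by (rule less_bprod_obtain) blast
    have "\<forall>x. \<forall>z. Pg x \<longrightarrow> Pf z \<longrightarrow> y < ereal (gp x z)" using P(3) gp_commute by metis
    then show "eventually (\<lambda>x. y < (case x of (y, z) \<Rightarrow> ereal (gp y z))) (towards \<eta> \<times>\<^sub>F towards \<xi>)"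
      unfolding eventually_prod_filter using P(1,2) by auto
  qed
  show ?thesis using *[of \<xi> \<eta>] *[of \<eta> \<xi>] by simp
qed

lemma bprod_self: assumes "\<xi> \<in> bdry" shows "bprod \<xi> \<xi> = \<infinity>"
proof -
  obtain u where u: "u \<in> \<xi>" using bdry_nonempty[OF assms] .
  have "ereal T \<le> bprod \<xi> \<xi>" for T
  proof (rule bprod_geI[OF assms assms u u])
    show "\<exists>\<^sub>F n in sequentially. T + 2 * D \<le> gp (u n) (u n)"
      by (rule eventually_frequently[OF sequentially_bot bdry_ev_gp[OF assms u u]])
  qed
  then show ?thesis using ereal_top by blast
qed

lemma bprod_infinite_eq:
  assumes "\<xi> \<in> bdry" "\<eta> \<in> bdry" "\<And>T. ereal T \<le> bprod \<xi> \<eta>" shows "\<xi> = \<eta>"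
proof -
  obtain u where u: "u \<in> \<xi>" using bdry_nonempty[OF assms(1)] .
  obtain v where v: "v \<in> \<eta>" using bdry_nonempty[OF assms(2)] .
  have "(u, v) \<in> gromov_equiv x\<^sub>0"
  proof (rule gromov_equivI)
    fix T
    have "\<forall>\<^sub>F n in sequentially. T + 1 - 1 \<le> gp (u n) (v n)"
      by (rule bprod_ge_ev[OF assms(1,2) assms(3) u v])
    then show "\<exists>\<^sub>F n in sequentially. T \<le> gp (u n) (v n)"
      using eventually_frequently[OF sequentially_bot] by simp
  qed (use u v assms bdry_gromov_sequence in auto)
  then show ?thesis using bdry_eqI assms u v by blast
qed

lemma bprod_finite:
  assumes "\<xi> \<in> bdry" "\<eta> \<in> bdry" "\<xi> \<noteq> \<eta>" obtains T where "\<not> ereal T \<le> bprod \<xi> \<eta>"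
  using bprod_infinite_eq assms by blast

text \<open>\<open>4 * D\<close> pays for \<open>bprod_ge_ev\<close>, one use of hyperbolicity and
  \<open>bprod_geI\<close>.\<close>

lemma bprod_hyp:
  assumes "\<xi> \<in> bdry" "\<eta> \<in> bdry" "\<zeta> \<in> bdry" "ereal T \<le> bprod \<xi> \<eta>" "ereal T \<le> bprod \<eta> \<zeta>"
  shows "ereal (T - 4 * D) \<le> bprod \<xi> \<zeta>"
proof -
  obtain u where u: "u \<in> \<xi>" using bdry_nonempty[OF assms(1)] .
  obtain v where v: "v \<in> \<eta>" using bdry_nonempty[OF assms(2)] .
  obtain w where w: "w \<in> \<zeta>" using bdry_nonempty[OF assms(3)] .
  have "\<forall>\<^sub>F n in sequentially. T - 4 * D + 2 * D \<le> gp (u n) (w n)"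
    using bprod_ge_ev[OF assms(1,2,4) u v] bprod_ge_ev[OF assms(2,3,5) v w]
  proof eventually_elim
    case (elim n)
    then show ?case using gp_hyp[of "u n" "v n" "w n"] D_ge_1 by linarith
  qed
  then show ?thesis
    using bprod_geI[OF assms(1,3) u w] eventually_frequently[OF sequentially_bot] by blast
qed

end

context hyp_space
begin

subsection \<open>Topology and measurability of shadows\<close>

abbreviation V :: "'a bdry \<Rightarrow> real \<Rightarrow> 'a bdry set" where "V \<equiv> shadow x\<^sub>0"

lemma V_iff: "\<eta> \<in> V \<xi> t \<longleftrightarrow> \<eta> \<in> bdry \<and> ereal t \<le> bprod \<eta> \<xi>"
  unfolding shadow_def by auto

lemma near_subset_near:
  assumes "\<eta> \<in> bdry" "\<eta>' \<in> V \<eta> (T + D + 1)"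
  shows "near \<eta>' (T + D) \<subseteq> near \<eta> T"
proof
  fix z assume z: "z \<in> near \<eta>' (T + D)"
  have \<eta>': "\<eta>' \<in> bdry" "ereal (T + D + 1) \<le> bprod \<eta>' \<eta>" using assms(2) by (auto simp: V_iff)
  obtain v where v: "v \<in> \<eta>'" using bdry_nonempty[OF \<eta>'(1)] .
  show "z \<in> near \<eta> T" unfolding near_def
  proof (intro CollectI ballI)
    fix u assume u: "u \<in> \<eta>"
    show "\<forall>\<^sub>F n in sequentially. T \<le> gp z (u n)"
      using near_ev[OF z v] bprod_ge_ev[OF \<eta>'(1) assms(1) \<eta>'(2) v u]
    proof eventually_elim
      case (elim n)
      then show ?case using gp_hyp[of z "v n" "u n"] by linarith
    qed
  qed
qed

text \<open>Lower semicontinuity of the product in its first argument: a small shadow around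
  \<open>\<eta>\<close> contains only points whose neighbourhoods in X can be taken inside a
  prescribed neighbourhood of \<open>\<eta>\<close>.\<close>

lemma open_bprod_greater:
  assumes "\<xi> \<in> bdry"
  shows "openin (bdry_topology x\<^sub>0) {\<eta> \<in> bdry. ereal t < bprod \<eta> \<xi>}"
  unfolding openin_bdry_topology
proof (intro conjI ballI)
  fix \<eta> assume "\<eta> \<in> {\<eta> \<in> bdry. ereal t < bprod \<eta> \<xi>}"
  then have \<eta>: "\<eta> \<in> bdry" and "ereal t < bprod \<eta> \<xi>" by auto
  then obtain s where s: "ereal t < s" "s < bprod \<eta> \<xi>" using dense by blast
  from s(2) obtain Pf Pg where P: "eventually Pf (towards \<eta>)" "eventually Pg (towards \<xi>)"
    "\<And>a b. Pf a \<Longrightarrow> Pg b \<Longrightarrow> s < ereal (gp a b)"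
    by (rule less_bprod_obtain) blast
  obtain T where T: "\<And>z. z \<in> near \<eta> T \<Longrightarrow> Pf z" using towards_contains_near[OF \<eta> P(1)] by blast
  have "V \<eta> (T + D + 1) \<subseteq> {\<eta> \<in> bdry. ereal t < bprod \<eta> \<xi>}"
  proof
    fix \<eta>' assume \<eta>': "\<eta>' \<in> V \<eta> (T + D + 1)"
    then have b: "\<eta>' \<in> bdry" by (simp add: V_iff)
    have "eventually Pf (towards \<eta>')"
      using eventually_near[OF b, of "T + D"] by (rule eventually_mono) (use near_subset_near[OF \<eta> \<eta>'] T in blast)
    then have "eventually (\<lambda>x. s \<le> (case x of (y, z) \<Rightarrow> ereal (gp y z))) (towards \<eta>' \<times>\<^sub>F towards \<xi>)"
      unfolding eventually_prod_filter using P(2,3) by (fastforce intro: less_imp_le)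
    then have "s \<le> bprod \<eta>' \<xi>" unfolding bdry_product_def by (rule Liminf_bounded)
    then show "\<eta>' \<in> {\<eta> \<in> bdry. ereal t < bprod \<eta> \<xi>}" using b s(1) by auto
  qed
  then show "\<exists>t'. V \<eta> t' \<subseteq> {\<eta> \<in> bdry. ereal t < bprod \<eta> \<xi>}" by blast
qed auto

lemma space_bdry_borel: "space (bdry_borel x\<^sub>0) = bdry"
  unfolding bdry_borel_def by (rule space_measure_of) (auto simp: openin_bdry_topology)

lemma sets_bdry_borel: "sets (bdry_borel x\<^sub>0) = sigma_sets bdry {U. openin (bdry_topology x\<^sub>0) U}"
  unfolding bdry_borel_def by (rule sets_measure_of) (auto simp: openin_bdry_topology)

text \<open>Shadows need not be open, but strict superlevel sets of the product are, and a shadow is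
  a countable intersection of them.\<close>

lemma shadow_measurable:
  assumes "\<xi> \<in> bdry" shows "V \<xi> t \<in> sets (bdry_borel x\<^sub>0)"
proof -
  have "V \<xi> t = (\<Inter>n::nat. {\<eta> \<in> bdry. ereal (t - 1 / Suc n) < bprod \<eta> \<xi>})"
  proof (intro equalityI subsetI)
    fix \<eta> assume "\<eta> \<in> V \<xi> t"
    then have \<eta>: "\<eta> \<in> bdry" "ereal t \<le> bprod \<eta> \<xi>" by (auto simp: V_iff)
    have "ereal (t - 1 / Suc n) < bprod \<eta> \<xi>" for n
      by (rule less_le_trans[OF _ \<eta>(2)]) simp
    then show "\<eta> \<in> (\<Inter>n::nat. {\<eta> \<in> bdry. ereal (t - 1 / Suc n) < bprod \<eta> \<xi>})" using \<eta> by auto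
  next
    fix \<eta> assume "\<eta> \<in> (\<Inter>n::nat. {\<eta> \<in> bdry. ereal (t - 1 / Suc n) < bprod \<eta> \<xi>})"
    then have \<eta>: "\<eta> \<in> bdry" "\<And>n. ereal (t - 1 / Suc n) < bprod \<eta> \<xi>" by auto
    have "ereal t \<le> bprod \<eta> \<xi>"
    proof (rule ccontr)
      assume n: "\<not> ereal t \<le> bprod \<eta> \<xi>"
      then obtain r where r: "bprod \<eta> \<xi> = ereal r"
        using \<eta>(2)[of 0] by (cases "bprod \<eta> \<xi>") auto
      then have "r < t" using n by simp
      then obtain n where "inverse (of_nat (Suc n)) < t - r" using reals_Archimedean[of "t - r"] by auto
      then show False using \<eta>(2)[of n] r by (simp add: field_simps)
    qed
    then show "\<eta> \<in> V \<xi> t" using \<eta> by (simp add: V_iff)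
  qed
  also have "\<dots> \<in> sets (bdry_borel x\<^sub>0)"
  proof (rule sets.countable_INT')
    show "(\<lambda>n::nat. {\<eta> \<in> bdry. ereal (t - 1 / Suc n) < bprod \<eta> \<xi>}) ` UNIV \<subseteq> sets (bdry_borel x\<^sub>0)"
      unfolding sets_bdry_borel using open_bprod_greater[OF assms] by (auto intro!: sigma_sets.Basic)
  qed auto
  finally show ?thesis .
qed

lemma shadow_INT_eq: assumes "\<xi> \<in> bdry" shows "(\<Inter>n::nat. V \<xi> (real n)) = {\<xi>}"
proof (intro equalityI subsetI)
  fix \<eta> assume "\<eta> \<in> (\<Inter>n::nat. V \<xi> (real n))"
  then have \<eta>: "\<eta> \<in> bdry" "\<And>n. ereal (real n) \<le> bprod \<eta> \<xi>" by (auto simp: V_iff)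
  have "\<eta> = \<xi>"
  proof (rule bprod_infinite_eq[OF \<eta>(1) assms])
    fix T :: real
    obtain n where "T \<le> real n" using real_arch_simple by blast
    then show "ereal T \<le> bprod \<eta> \<xi>" using \<eta>(2)[of n] by (meson ereal_less_eq(3) order_trans)
  qed
  then show "\<eta> \<in> {\<xi>}" by simp
qed (use assms bprod_self in \<open>auto simp: V_iff\<close>)

end

subsection \<open>Isometries acting on the boundary\<close>

locale hyp_group = hyp_space x\<^sub>0 D for x\<^sub>0 :: "'a::heine_borel" and D +
  fixes \<Gamma> :: "('a \<Rightarrow> 'a) set"
  assumes isom: "isometry_group \<Gamma>" and pdisc: "properly_discontinuous \<Gamma>"
begin

abbreviation ginv :: "('a \<Rightarrow> 'a) \<Rightarrow> 'a \<Rightarrow> 'a" where "ginv \<equiv> inv_into UNIV"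

text \<open>Over \<open>UNIV\<close> the extensional operations of \<open>BijGroup\<close> are plain
  composition and inversion, which is the form used from here on.\<close>

lemma subgroup_BijGroup_UNIV:
  assumes "subgroup P (BijGroup UNIV)"
  shows "id \<in> P" "\<And>g. g \<in> P \<Longrightarrow> bij g" "\<And>g h. g \<in> P \<Longrightarrow> h \<in> P \<Longrightarrow> g \<circ> h \<in> P"
    "\<And>g. g \<in> P \<Longrightarrow> ginv g \<in> P"
proof -
  have car: "carrier (BijGroup UNIV) = Bij UNIV" by (simp add: BijGroup_def)
  show "id \<in> P" using subgroup.one_closed[OF assms] by (simp add: BijGroup_def id_def restrict_UNIV)
  show b: "bij g" if "g \<in> P" for g
    using subgroup.mem_carrier[OF assms that] by (simp add: car Bij_def)
  show "g \<circ> h \<in> P" if "g \<in> P" "h \<in> P" for g h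
    using subgroup.m_closed[OF assms that] subgroup.mem_carrier[OF assms that(1)]
      subgroup.mem_carrier[OF assms that(2)]
    by (simp add: BijGroup_def compose_def comp_def restrict_UNIV)
  show "ginv g \<in> P" if "g \<in> P" for g
    using subgroup.m_inv_closed[OF assms that] subgroup.mem_carrier[OF assms that]
    by (simp add: inv_BijGroup car restrict_UNIV)
qed

lemma subgroup_BijGroup_UNIV_I:
  fixes P :: "('a \<Rightarrow> 'a) set"
  assumes "id \<in> P" "\<And>g. g \<in> P \<Longrightarrow> bij g" "\<And>g h. g \<in> P \<Longrightarrow> h \<in> P \<Longrightarrow> g \<circ> h \<in> P"
    "\<And>g. g \<in> P \<Longrightarrow> ginv g \<in> P"
  shows "subgroup P (BijGroup UNIV)"
proof -
  have B: "g \<in> Bij UNIV" if "g \<in> P" for g using assms(2)[OF that] by (simp add: Bij_def)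
  show ?thesis
  proof
    show "P \<subseteq> carrier (BijGroup UNIV)" using B by (auto simp: BijGroup_def)
    show "x \<otimes>\<^bsub>BijGroup UNIV\<^esub> y \<in> P" if "x \<in> P" "y \<in> P" for x y
      using assms(3)[OF that] B that by (simp add: BijGroup_def compose_def comp_def restrict_UNIV)
    show "\<one>\<^bsub>BijGroup UNIV\<^esub> \<in> P" using assms(1) by (simp add: BijGroup_def id_def restrict_UNIV)
    show "inv\<^bsub>BijGroup UNIV\<^esub> x \<in> P" if "x \<in> P" for x
      using assms(4)[OF that] B[OF that] by (simp add: inv_BijGroup restrict_UNIV)
  qed
qed

lemma subG: "subgroup \<Gamma> (BijGroup UNIV)" using isom unfolding isometry_group_def by blast

lemmas id_G = subgroup_BijGroup_UNIV(1)[OF subG]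
lemmas bij_G = subgroup_BijGroup_UNIV(2)[OF subG]
lemmas comp_G = subgroup_BijGroup_UNIV(3)[OF subG]
lemmas inv_G = subgroup_BijGroup_UNIV(4)[OF subG]

lemma dist_G: "g \<in> \<Gamma> \<Longrightarrow> dist (g x) (g y) = dist x y"
  using isom unfolding isometry_group_def by blast

lemma inv_cancel: "g \<in> \<Gamma> \<Longrightarrow> ginv g (g x) = x" "g \<in> \<Gamma> \<Longrightarrow> g (ginv g x) = x"
  using bij_G by (simp_all add: bij_is_inj bij_is_surj surj_f_inv_f)

lemma inv_comp: "g \<in> \<Gamma> \<Longrightarrow> ginv g \<circ> g = id" "g \<in> \<Gamma> \<Longrightarrow> g \<circ> ginv g = id"
  using inv_cancel by auto

lemma dist_inv: "g \<in> \<Gamma> \<Longrightarrow> dist (ginv g x) y = dist x (g y)"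
  using dist_G[of g "ginv g x" y] by (simp add: inv_cancel)

lemma gromov_product_G: "g \<in> \<Gamma> \<Longrightarrow> gromov_product (g w) (g x) (g y) = gromov_product w x y"
  unfolding gromov_product_def by (simp add: dist_G)

lemma gp_G_ge: assumes "g \<in> \<Gamma>" shows "gp x y - dist x\<^sub>0 (g x\<^sub>0) \<le> gp (g x) (g y)"
  using gp_change_base[of "g x\<^sub>0" "g x" "g y" x\<^sub>0] gromov_product_G[OF assms, of x\<^sub>0 x y]
  by (simp add: dist_commute)

lemma bdry_equiv_G:
  assumes "g \<in> \<Gamma>" "(u, v) \<in> gromov_equiv x\<^sub>0"
  shows "(g \<circ> u, g \<circ> v) \<in> gromov_equiv x\<^sub>0"
proof -
  have seq: "gromov_sequence x\<^sub>0 (g \<circ> w)" if w: "gromov_sequence x\<^sub>0 w" for w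
  proof (rule gromov_sequenceI)
    fix T
    obtain N where N: "\<And>m n. m \<ge> N \<Longrightarrow> n \<ge> N \<Longrightarrow> T + dist x\<^sub>0 (g x\<^sub>0) \<le> gp (w m) (w n)"
      using gromov_sequenceD[OF w, of "T + dist x\<^sub>0 (g x\<^sub>0)"] by metis
    have "T \<le> gp ((g \<circ> w) m) ((g \<circ> w) n)" if "m \<ge> N" "n \<ge> N" for m n
      using N[OF that] gp_G_ge[OF assms(1), of "w m" "w n"] by simp
    then show "\<exists>N. \<forall>m\<ge>N. \<forall>n\<ge>N. T \<le> gp ((g \<circ> w) m) ((g \<circ> w) n)" by blast
  qed
  show ?thesis
  proof (rule gromov_equivI)
    show "gromov_sequence x\<^sub>0 (g \<circ> u)" "gromov_sequence x\<^sub>0 (g \<circ> v)"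
      using assms(2) seq by (auto simp: gromov_equiv_def)
    fix T
    obtain N where N: "\<And>m n. m \<ge> N \<Longrightarrow> n \<ge> N \<Longrightarrow> T + dist x\<^sub>0 (g x\<^sub>0) \<le> gp (u m) (v n)"
      using gromov_equivD[OF assms(2), of "T + dist x\<^sub>0 (g x\<^sub>0)"] by metis
    have "T \<le> gp ((g \<circ> u) n) ((g \<circ> v) n)" if "n \<ge> N" for n
      using N[OF that that] gp_G_ge[OF assms(1), of "u n" "v n"] by simp
    then show "\<exists>\<^sub>F n in sequentially. T \<le> gp ((g \<circ> u) n) ((g \<circ> v) n)"
      unfolding frequently_sequentially by (meson nat_le_linear)
  qed
qed

lemma act_mem: "u \<in> \<xi> \<Longrightarrow> g \<circ> u \<in> bdry_act g \<xi>"
  unfolding bdry_act_def by blast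

lemma act_comp: "bdry_act (g \<circ> h) \<xi> = bdry_act g (bdry_act h \<xi>)"
  unfolding bdry_act_def image_image by (simp add: comp_assoc)

lemma act_id: "bdry_act id \<xi> = \<xi>"
  unfolding bdry_act_def by simp

lemma act_inv: assumes "g \<in> \<Gamma>" shows "bdry_act (ginv g) (bdry_act g \<xi>) = \<xi>" "bdry_act g (bdry_act (ginv g) \<xi>) = \<xi>"
  by (simp_all only: act_comp[symmetric] inv_comp[OF assms] act_id)

lemma act_bdry: assumes "g \<in> \<Gamma>" "\<xi> \<in> bdry" shows "bdry_act g \<xi> \<in> bdry"
proof -
  obtain u where u: "u \<in> \<xi>" using bdry_nonempty[OF assms(2)] .
  have "bdry_act g \<xi> = gromov_equiv x\<^sub>0 `` {g \<circ> u}"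
  proof (intro equalityI subsetI)
    fix w assume "w \<in> bdry_act g \<xi>"
    then obtain v where "v \<in> \<xi>" "w = g \<circ> v" unfolding bdry_act_def by blast
    then show "w \<in> gromov_equiv x\<^sub>0 `` {g \<circ> u}"
      using bdry_equiv_G[OF assms(1) bdry_equiv[OF assms(2) u]] by simp
  next
    fix w assume "w \<in> gromov_equiv x\<^sub>0 `` {g \<circ> u}"
    then have "(ginv g \<circ> (g \<circ> u), ginv g \<circ> w) \<in> gromov_equiv x\<^sub>0"
      using bdry_equiv_G[OF inv_G[OF assms(1)]] by blast
    then have "ginv g \<circ> w \<in> \<xi>"
      using bdry_closed[OF assms(2) u] by (simp add: comp_assoc[symmetric] inv_comp[OF assms(1)])
    then have "g \<circ> (ginv g \<circ> w) \<in> bdry_act g \<xi>" by (rule act_mem)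
    then show "w \<in> bdry_act g \<xi>" by (simp add: comp_assoc[symmetric] inv_comp[OF assms(1)])
  qed
  moreover have "gromov_sequence x\<^sub>0 (g \<circ> u)"
    using bdry_equiv_G[OF assms(1) bdry_equiv[OF assms(2) u u]] by (auto simp: gromov_equiv_def)
  ultimately show ?thesis using gromov_class_in_bdry by metis
qed

abbreviation \<Lambda> :: "'a bdry set" where "\<Lambda> \<equiv> limit_set x\<^sub>0 \<Gamma>"
abbreviation orb :: "'a set" where "orb \<equiv> orbit_of \<Gamma> x\<^sub>0"

lemma limit_bdry: "\<xi> \<in> \<Lambda> \<Longrightarrow> \<xi> \<in> bdry" unfolding limit_set_def by blast

lemma act_limit: assumes "g \<in> \<Gamma>" "\<xi> \<in> \<Lambda>" shows "bdry_act g \<xi> \<in> \<Lambda>"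
proof -
  obtain u where u: "u \<in> \<xi>" "range u \<subseteq> orb" using assms(2) unfolding limit_set_def by blast
  have "range (g \<circ> u) \<subseteq> orb"
  proof clarify
    fix n
    obtain h where "h \<in> \<Gamma>" "u n = h x\<^sub>0" using u(2) unfolding orbit_of_def by blast
    then have "(g \<circ> u) n = (g \<circ> h) x\<^sub>0" "g \<circ> h \<in> \<Gamma>" using comp_G[OF assms(1)] by auto
    then show "(g \<circ> u) n \<in> orb" unfolding orbit_of_def by blast
  qed
  then show ?thesis using act_bdry[OF assms(1) limit_bdry[OF assms(2)]] act_mem[OF u(1)]
    unfolding limit_set_def by blast
qed

lemma bprod_act:
  assumes "g \<in> \<Gamma>" "\<xi> \<in> bdry" "\<eta> \<in> bdry" "ereal T \<le> bprod \<xi> \<eta>"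
  shows "ereal (T - dist x\<^sub>0 (g x\<^sub>0) - 3 * D) \<le> bprod (bdry_act g \<xi>) (bdry_act g \<eta>)"
proof -
  obtain u where u: "u \<in> \<xi>" using bdry_nonempty[OF assms(2)] .
  obtain v where v: "v \<in> \<eta>" using bdry_nonempty[OF assms(3)] .
  have "\<forall>\<^sub>F n in sequentially. T - dist x\<^sub>0 (g x\<^sub>0) - 3 * D + 2 * D \<le> gp ((g \<circ> u) n) ((g \<circ> v) n)"
    using bprod_ge_ev[OF assms(2,3,4) u v]
  proof eventually_elim
    case (elim n)
    then show ?case using gp_G_ge[OF assms(1), of "u n" "v n"] D_ge_1 by simp
  qed
  then show ?thesis
    using bprod_geI[OF act_bdry[OF assms(1,2)] act_bdry[OF assms(1,3)] act_mem[OF u] act_mem[OF v]]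
      eventually_frequently[OF sequentially_bot] by blast
qed

text \<open>Compared along \<open>u\<close> and \<open>g \<circ> u\<close>, where the distance
  differences agree exactly; each side contributes \<open>2 * D\<close>.\<close>

lemma busemann_act:
  assumes "g \<in> \<Gamma>" "\<xi> \<in> bdry"
  shows "\<bar>busemann (bdry_act g \<xi>) (g x) (g y) - busemann \<xi> x y\<bar> \<le> 4 * D"
proof -
  obtain u where u: "u \<in> \<xi>" using bdry_nonempty[OF assms(2)] .
  have "\<forall>\<^sub>F n in sequentially. \<bar>busemann (bdry_act g \<xi>) (g x) (g y) - busemann \<xi> x y\<bar> \<le> 4 * D"
    using busemann_approx[OF assms(2) u, of x y]
      busemann_approx[OF act_bdry[OF assms] act_mem[OF u], of "g x" "g y"]
    by eventually_elim (simp add: dist_G[OF assms(1)] abs_le_iff)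
  then show ?thesis by simp
qed

lemma busemann_cocycle:
  assumes "\<xi> \<in> bdry"
  shows "\<bar>busemann \<xi> x y - (bus \<xi> x - bus \<xi> y)\<bar> \<le> 6 * D"
proof -
  obtain u where u: "u \<in> \<xi>" using bdry_nonempty[OF assms] .
  have "\<forall>\<^sub>F n in sequentially. \<bar>busemann \<xi> x y - (bus \<xi> x - bus \<xi> y)\<bar> \<le> 6 * D"
    using busemann_approx[OF assms u, of x y] busemann_approx[OF assms u, of x x\<^sub>0]
      busemann_approx[OF assms u, of y x\<^sub>0]
    by eventually_elim linarith
  then show ?thesis by simp
qed

lemma act_measurable: assumes "g \<in> \<Gamma>" shows "bdry_act g \<in> measurable (bdry_borel x\<^sub>0) (bdry_borel x\<^sub>0)"
  unfolding bdry_borel_def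
proof (rule measurable_measure_of)
  show "{U. openin (bdry_topology x\<^sub>0) U} \<subseteq> Pow bdry" by (auto simp: openin_bdry_topology)
  show "bdry_act g \<in> space (sigma bdry {U. openin (bdry_topology x\<^sub>0) U}) \<rightarrow> bdry"
    using act_bdry[OF assms] space_bdry_borel unfolding bdry_borel_def by auto
  fix U assume "U \<in> {U. openin (bdry_topology x\<^sub>0) U}"
  then have U: "U \<subseteq> bdry" "\<And>\<xi>. \<xi> \<in> U \<Longrightarrow> \<exists>t. V \<xi> t \<subseteq> U" by (auto simp: openin_bdry_topology)
  have "openin (bdry_topology x\<^sub>0) (bdry_act g -` U \<inter> bdry)"
    unfolding openin_bdry_topology
  proof (intro conjI ballI)
    fix \<xi> assume "\<xi> \<in> bdry_act g -` U \<inter> bdry"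
    then have \<xi>: "\<xi> \<in> bdry" "bdry_act g \<xi> \<in> U" by auto
    then obtain t where t: "V (bdry_act g \<xi>) t \<subseteq> U" using U(2) by blast
    have "V \<xi> (t + dist x\<^sub>0 (g x\<^sub>0) + 3 * D) \<subseteq> bdry_act g -` U \<inter> bdry"
    proof
      fix \<eta> assume "\<eta> \<in> V \<xi> (t + dist x\<^sub>0 (g x\<^sub>0) + 3 * D)"
      then have \<eta>: "\<eta> \<in> bdry" "ereal (t + dist x\<^sub>0 (g x\<^sub>0) + 3 * D) \<le> bprod \<eta> \<xi>" by (auto simp: V_iff)
      have "bdry_act g \<eta> \<in> V (bdry_act g \<xi>) t"
        using bprod_act[OF assms \<eta>(1) \<xi>(1) \<eta>(2)] act_bdry[OF assms \<eta>(1)] by (simp add: V_iff)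
      then show "\<eta> \<in> bdry_act g -` U \<inter> bdry" using t \<eta> by auto
    qed
    then show "\<exists>t. V \<xi> t \<subseteq> bdry_act g -` U \<inter> bdry" by blast
  qed auto
  then show "bdry_act g -` U \<inter> space (sigma bdry {U. openin (bdry_topology x\<^sub>0) U})
      \<in> sets (sigma bdry {U. openin (bdry_topology x\<^sub>0) U})"
    using sets_bdry_borel space_bdry_borel unfolding bdry_borel_def by (auto intro: sigma_sets.Basic)
qed

lemma act_image_measurable:
  assumes "g \<in> \<Gamma>" "A \<in> sets (bdry_borel x\<^sub>0)" shows "bdry_act g ` A \<in> sets (bdry_borel x\<^sub>0)"
proof -
  have A: "A \<subseteq> bdry" using sets.sets_into_space[OF assms(2)] by (simp add: space_bdry_borel)
  have "bdry_act g ` A = bdry_act (ginv g) -` A \<inter> space (bdry_borel x\<^sub>0)"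
    unfolding space_bdry_borel
  proof (intro equalityI subsetI)
    fix \<eta> assume "\<eta> \<in> bdry_act g ` A"
    then show "\<eta> \<in> bdry_act (ginv g) -` A \<inter> bdry" using A act_inv[OF assms(1)] act_bdry[OF assms(1)] by auto
  next
    fix \<eta> assume "\<eta> \<in> bdry_act (ginv g) -` A \<inter> bdry"
    then show "\<eta> \<in> bdry_act g ` A" using act_inv(2)[OF assms(1), of \<eta>] by (metis IntD1 image_eqI vimageD)
  qed
  then show ?thesis using measurable_sets[OF act_measurable[OF inv_G[OF assms(1)]] assms(2)] by simp
qed

end

context hyp_space
begin

subsection \<open>Geodesics\<close>

lemma obtain_geodesic:
  fixes x y :: 'a
  obtains c where "geodesic_on {0..dist x y} c" "c 0 = x" "c (dist x y) = y"
  using geod unfolding geodesic_space_def by blast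

lemma geodesic_onD: "geodesic_on I c \<Longrightarrow> s \<in> I \<Longrightarrow> t \<in> I \<Longrightarrow> dist (c s) (c t) = \<bar>s - t\<bar>"
  unfolding geodesic_on_def by blast

text \<open>The point taken is at distance \<open>gromov_product y x z\<close> from
  \<open>y\<close>: in the comparison tripod this is the branch point, whose distance to
  \<open>x\<close> is the Gromov product.\<close>

lemma geodesic_near_point:
  fixes x y z :: 'a
  assumes c: "geodesic_on {0..dist y z} c" "c 0 = y" "c (dist y z) = z"
  obtains s where "0 \<le> s" "s \<le> dist y z" "dist x (c s) \<le> gromov_product x y z + 2 * D"
proof -
  define s where "s = gromov_product y x z"
  have s: "0 \<le> s" "s \<le> dist y z" unfolding s_def using gp_nonneg gp_le_dist(2) by auto
  have "dist (c 0) (c s) = \<bar>0 - s\<bar>" "dist (c s) (c (dist y z)) = \<bar>s - dist y z\<bar>"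
    by (intro geodesic_onD[OF c(1)]; use s in auto)+
  then have d: "dist y (c s) = s" "dist (c s) z = dist y z - s" using s c by auto
  have "gromov_product y z (c s) = s"
    unfolding gromov_product_def[of y z] using d by (simp add: dist_commute)
  then have "s - D \<le> gromov_product y x (c s)"
    using hyp[of y x z "c s"] by (simp add: s_def)
  then have "dist x (c s) \<le> gromov_product x y z + 2 * D"
    using d unfolding s_def gromov_product_def by (simp add: dist_commute field_simps)
  then show ?thesis using that s by blast
qed

text \<open>Limits of geodesics are taken at integer times only, to have countably many coordinates;
  the gaps are filled by arbitrary geodesic segments. For times in different unit intervals a
  shortcut would also shorten the distance between the enclosing integer points.\<close>

lemma fill_integer_geodesic:
  fixes l :: "int \<Rightarrow> 'a"
  assumes l: "\<And>i j. dist (l i) (l j) = \<bar>real_of_int i - real_of_int j\<bar>"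
  obtains c where "geodesic_on UNIV c" "\<And>i. c (of_int i) = l i"
proof -
  have "\<forall>i. \<exists>\<tau>. geodesic_on {0..1} \<tau> \<and> \<tau> 0 = l i \<and> \<tau> 1 = l (i + 1)"
    using l obtain_geodesic by (metis (no_types, opaque_lifting) abs_minus_commute abs_one add_diff_cancel_left' of_int_1 of_int_add)
  then obtain \<tau> where \<tau>: "\<And>i. geodesic_on {0..1::real} (\<tau> i)" "\<And>i. \<tau> i 0 = l i" "\<And>i. \<tau> i 1 = l (i + 1)"
    by metis
  define c where "c s = \<tau> \<lfloor>s\<rfloor> (s - of_int \<lfloor>s\<rfloor>)" for s :: real
  have frac: "0 \<le> s - of_int \<lfloor>s\<rfloor>" "s - of_int \<lfloor>s\<rfloor> \<le> 1" for s :: real by linarith+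
  have d0: "dist (l \<lfloor>s\<rfloor>) (c s) = s - of_int \<lfloor>s\<rfloor>" for s
    using geodesic_onD[OF \<tau>(1), of 0 "s - of_int \<lfloor>s\<rfloor>" "\<lfloor>s\<rfloor>"] frac[of s] by (simp add: c_def \<tau>)
  have d1: "dist (c s) (l (\<lfloor>s\<rfloor> + 1)) = of_int \<lfloor>s\<rfloor> + 1 - s" for s
    using geodesic_onD[OF \<tau>(1), of "s - of_int \<lfloor>s\<rfloor>" 1 "\<lfloor>s\<rfloor>"] frac[of s] by (simp add: c_def \<tau>)
  have le: "dist (c s) (c t) = t - s" if "s \<le> t" for s t
  proof (cases "\<lfloor>s\<rfloor> = \<lfloor>t\<rfloor>")
    case True
    then show ?thesis
      using geodesic_onD[OF \<tau>(1), of "s - of_int \<lfloor>s\<rfloor>" "t - of_int \<lfloor>s\<rfloor>" "\<lfloor>s\<rfloor>"] frac[of s] frac[of t] that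
      by (simp add: c_def)
  next
    case False
    then have f: "\<lfloor>s\<rfloor> + 1 \<le> \<lfloor>t\<rfloor>" using floor_mono[OF that] by linarith
    then have "real_of_int \<lfloor>s\<rfloor> + 1 \<le> real_of_int \<lfloor>t\<rfloor>" by linarith
    then have "dist (l (\<lfloor>s\<rfloor> + 1)) (l \<lfloor>t\<rfloor>) = of_int \<lfloor>t\<rfloor> - of_int \<lfloor>s\<rfloor> - 1"
      "dist (l \<lfloor>s\<rfloor>) (l (\<lfloor>t\<rfloor> + 1)) = of_int \<lfloor>t\<rfloor> + 1 - of_int \<lfloor>s\<rfloor>" by (simp_all add: l)
    moreover have "dist (c s) (c t) \<le> dist (c s) (l (\<lfloor>s\<rfloor> + 1)) + dist (l (\<lfloor>s\<rfloor> + 1)) (l \<lfloor>t\<rfloor>) + dist (l \<lfloor>t\<rfloor>) (c t)"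
      using dist_triangle[of "c s" "c t" "l (\<lfloor>s\<rfloor> + 1)"] dist_triangle[of "l (\<lfloor>s\<rfloor> + 1)" "c t" "l \<lfloor>t\<rfloor>"] by linarith
    moreover have "dist (l \<lfloor>s\<rfloor>) (l (\<lfloor>t\<rfloor> + 1)) \<le> dist (l \<lfloor>s\<rfloor>) (c s) + dist (c s) (c t) + dist (c t) (l (\<lfloor>t\<rfloor> + 1))"
      using dist_triangle[of "l \<lfloor>s\<rfloor>" "l (\<lfloor>t\<rfloor> + 1)" "c s"] dist_triangle[of "c s" "l (\<lfloor>t\<rfloor> + 1)" "c t"] by linarith
    ultimately show ?thesis using d0 d1 by simp
  qed
  have "geodesic_on UNIV c"
    unfolding geodesic_on_def
  proof (intro ballI)
    fix s t :: real
    show "dist (c s) (c t) = \<bar>s - t\<bar>"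
      using le[of s t] le[of t s] by (cases "s \<le> t") (auto simp: dist_commute)
  qed
  moreover have "c (of_int i) = l i" for i by (simp add: c_def \<tau>)
  ultimately show ?thesis using that by blast
qed

text \<open>A diagonal argument in the guise of sequential compactness of a countable product of
  closed balls, which are compact by properness.\<close>

lemma bounded_pointwise_subsequence:
  fixes F :: "nat \<Rightarrow> int \<Rightarrow> 'a"
  assumes "\<And>n i. dist a (F n i) \<le> B i"
  obtains r l where "strict_mono (r :: nat \<Rightarrow> nat)" "\<And>i. (\<lambda>n. F (r n) i) \<longlonglongrightarrow> l i"
proof -
  have "compactin (product_topology (\<lambda>i::int. euclidean) UNIV) (PiE UNIV (\<lambda>i. cball a (B i)))"
    unfolding compactin_PiE by simp
  then have "compact (PiE UNIV (\<lambda>i::int. cball a (B i)))"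
    by (simp add: euclidean_product_topology)
  then have "seq_compact (PiE UNIV (\<lambda>i::int. cball a (B i)))"
    by (simp add: compact_eq_seq_compact_metric)
  moreover have "\<forall>n. F n \<in> PiE UNIV (\<lambda>i::int. cball a (B i))" using assms by auto
  ultimately obtain l r where r: "strict_mono r" "(F \<circ> r) \<longlonglongrightarrow> l"
    unfolding seq_compact_def by blast
  have "(\<lambda>n. F (r n) i) \<longlonglongrightarrow> l i" for i
  proof -
    have "isCont (\<lambda>f::int \<Rightarrow> 'a. f i) l"
      using continuous_on_product_coordinates[of i, where 'b = 'a] by (simp add: continuous_on_eq_continuous_at del: continuous_on_product_coordinates)
    then have "((\<lambda>n. (\<lambda>f. f i) ((F \<circ> r) n)) \<longlongrightarrow> l i) sequentially"
      using isCont_tendsto_compose r(2) by blast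
    then show ?thesis by simp
  qed
  then show ?thesis using that r(1) by blast
qed

lemma exists_geodesic_line:
  assumes \<xi>: "\<xi> \<in> bdry" and \<eta>: "\<eta> \<in> bdry" and ne: "\<xi> \<noteq> \<eta>"
  obtains c where "geodesic_line_between \<xi> \<eta> c"
proof -
  obtain u where u: "u \<in> \<xi>" using bdry_nonempty[OF \<xi>] .
  obtain v where v: "v \<in> \<eta>" using bdry_nonempty[OF \<eta>] .
  obtain T where "\<not> ereal T \<le> bprod \<xi> \<eta>" using bprod_finite[OF \<xi> \<eta> ne] .
  \<comment> \<open>Distinct end points have bounded products, so by
    \<open>geodesic_near_point\<close> all late segments from \<open>u n\<close> to
    \<open>v n\<close> pass within \<open>k + 2 * D\<close> of the base point, at time
    \<open>s n\<close>.\<close>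
  then obtain N k where N: "\<And>n. n \<ge> N \<Longrightarrow> gp (u n) (v n) \<le> k"
    using bprod_less_ev[OF \<xi> \<eta> _ u v] unfolding eventually_sequentially by blast
  have "\<forall>n. \<exists>c s. geodesic_on {0..dist (u n) (v n)} c \<and> c 0 = u n \<and> c (dist (u n) (v n)) = v n \<and>
      0 \<le> s \<and> s \<le> dist (u n) (v n) \<and> (n \<ge> N \<longrightarrow> dist x\<^sub>0 (c s) \<le> k + 2 * D)"
  proof
    fix n
    obtain c where c: "geodesic_on {0..dist (u n) (v n)} c" "c 0 = u n" "c (dist (u n) (v n)) = v n"
      using obtain_geodesic by blast
    obtain s where "0 \<le> s" "s \<le> dist (u n) (v n)" "dist x\<^sub>0 (c s) \<le> gp (u n) (v n) + 2 * D"
      using geodesic_near_point[OF c] by blast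
    then show "\<exists>c s. geodesic_on {0..dist (u n) (v n)} c \<and> c 0 = u n \<and> c (dist (u n) (v n)) = v n \<and>
      0 \<le> s \<and> s \<le> dist (u n) (v n) \<and> (n \<ge> N \<longrightarrow> dist x\<^sub>0 (c s) \<le> k + 2 * D)"
      using c N[of n] by fastforce
  qed
  then obtain \<sigma> s where \<sigma>: "\<And>n. geodesic_on {0..dist (u n) (v n)} (\<sigma> n)" "\<And>n. \<sigma> n 0 = u n"
    "\<And>n. \<sigma> n (dist (u n) (v n)) = v n" and s: "\<And>n. 0 \<le> s n" "\<And>n. s n \<le> dist (u n) (v n)"
    "\<And>n. n \<ge> N \<Longrightarrow> dist x\<^sub>0 (\<sigma> n (s n)) \<le> k + 2 * D" by metis
  define L where "L n = dist (u n) (v n)" for n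
  \<comment> \<open>Time is counted from the passage near the base point and clamped to the segment,
    so that \<open>F n\<close> is defined on all integers; as the end points recede, the clamping
    disappears at each fixed time (\<open>pos\<close>).\<close>
  define F where "F n i = \<sigma> n (max 0 (min (L n) (s n + real_of_int i)))" for n and i :: int
  have dF: "dist (F n i) (F n j) \<le> \<bar>real_of_int i - real_of_int j\<bar>" for n i j
  proof -
    have "dist (F n i) (F n j) = \<bar>max 0 (min (L n) (s n + real_of_int i)) - max 0 (min (L n) (s n + real_of_int j))\<bar>"
      unfolding F_def by (rule geodesic_onD[OF \<sigma>(1)]) (auto simp: L_def)
    then show ?thesis by linarith
  qed
  have F0: "F n 0 = \<sigma> n (s n)" for n using s[of n] by (simp add: F_def L_def)
  have bF: "dist x\<^sub>0 (F (n + N) i) \<le> k + 2 * D + \<bar>real_of_int i\<bar>" for n i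
    using dist_triangle[of x\<^sub>0 "F (n + N) i" "F (n + N) 0"] dF[of "n + N" 0 i] s(3)[of "n + N"]
    by (simp add: F0)
  obtain r l where r: "strict_mono (r :: nat \<Rightarrow> nat)" "\<And>i. (\<lambda>n. F (r n + N) i) \<longlonglongrightarrow> l i"
    using bounded_pointwise_subsequence[of x\<^sub>0 "\<lambda>n. F (n + N)" "\<lambda>i. k + 2 * D + \<bar>real_of_int i\<bar>"] bF by metis
  define q where "q n = r n + N" for n
  have q: "strict_mono q" "\<And>n. q n \<ge> N" using r(1) by (auto simp: q_def strict_mono_def)
  have du: "\<forall>\<^sub>F n in sequentially. A \<le> s (q n)" for A
  proof -
    have "\<forall>\<^sub>F n in sequentially. A + k + 2 * D \<le> gp (u n) (u n)" by (rule bdry_ev_gp[OF \<xi> u u])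
    then have "\<forall>\<^sub>F n in sequentially. A + k + 2 * D \<le> gp (u (q n)) (u (q n))"
      by (rule eventually_subseq[OF q(1)])
    then show ?thesis
    proof eventually_elim
      case (elim n)
      have "dist (u (q n)) (\<sigma> (q n) (s (q n))) = s (q n)"
        using geodesic_onD[OF \<sigma>(1), of 0 "q n" "s (q n)"] s[of "q n"] by (simp add: \<sigma>)
      then show ?case using elim s(3)[OF q(2)[of n]] dist_triangle[of x\<^sub>0 "u (q n)" "\<sigma> (q n) (s (q n))"]
        by (simp add: gromov_product_def dist_commute)
    qed
  qed
  have dv: "\<forall>\<^sub>F n in sequentially. A \<le> L (q n) - s (q n)" for A
  proof -
    have "\<forall>\<^sub>F n in sequentially. A + k + 2 * D \<le> gp (v n) (v n)" by (rule bdry_ev_gp[OF \<eta> v v])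
    then have "\<forall>\<^sub>F n in sequentially. A + k + 2 * D \<le> gp (v (q n)) (v (q n))"
      by (rule eventually_subseq[OF q(1)])
    then show ?thesis
    proof eventually_elim
      case (elim n)
      have "dist (\<sigma> (q n) (s (q n))) (v (q n)) = L (q n) - s (q n)"
        using geodesic_onD[OF \<sigma>(1), of "s (q n)" "q n" "L (q n)"] s[of "q n"] by (simp add: \<sigma> L_def)
      then show ?case using elim s(3)[OF q(2)[of n]] dist_triangle[of x\<^sub>0 "v (q n)" "\<sigma> (q n) (s (q n))"]
        by (simp add: gromov_product_def)
    qed
  qed
  have pos: "\<forall>\<^sub>F n in sequentially. 0 \<le> s (q n) + real_of_int i \<and> s (q n) + real_of_int i \<le> L (q n) \<and>
       F (q n) i = \<sigma> (q n) (s (q n) + real_of_int i)" for i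
    using du[of "\<bar>real_of_int i\<bar>"] dv[of "\<bar>real_of_int i\<bar>"]
    by eventually_elim (auto simp: F_def)
  have lim: "(\<lambda>n. F (q n) i) \<longlonglongrightarrow> l i" for i using r(2) by (simp add: q_def)
  have dl: "dist (l i) (l j) = \<bar>real_of_int i - real_of_int j\<bar>" for i j
  proof (rule LIMSEQ_unique[OF tendsto_dist[OF lim lim]])
    have "\<forall>\<^sub>F n in sequentially. dist (F (q n) i) (F (q n) j) = \<bar>real_of_int i - real_of_int j\<bar>"
      using pos[of i] pos[of j]
    proof eventually_elim
      case (elim n)
      then show ?case
        using geodesic_onD[OF \<sigma>(1), of "s (q n) + real_of_int i" "q n" "s (q n) + real_of_int j"] by (simp add: L_def)
    qed
    then show "(\<lambda>n. dist (F (q n) i) (F (q n) j)) \<longlonglongrightarrow> \<bar>real_of_int i - real_of_int j\<bar>"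
      by (rule tendsto_eventually)
  qed
  obtain c where c: "geodesic_on UNIV c" "\<And>i. c (of_int i) = l i"
    using fill_integer_geodesic[OF dl] by blast
  have close: "\<forall>\<^sub>F n in sequentially. dist (l i) (F (q n) i) \<le> 1" for i
    using tendstoD[OF lim, of 1 i] by (auto simp: dist_commute elim!: eventually_mono)
  have freq: "\<exists>\<^sub>F m in sequentially. P m" if "\<forall>\<^sub>F n in sequentially. P (q n)" for P
    using that q(1) unfolding eventually_sequentially frequently_sequentially
    by (metis le_cases order_trans seq_suble)
  \<comment> \<open>Seen from the passage point, the product of the point at time \<open>i\<close>
    with \<open>v\<close> is exactly \<open>i\<close>; the base change costs
    \<open>k + 2 * D\<close>, the passage to the limit \<open>1\<close>, and \<open>nearI\<close>
    another \<open>D\<close>.\<close>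
  have nearv: "l (int i) \<in> near \<eta> (real i - k - 3 * D - 1)" for i
  proof (rule nearI[OF \<eta> v], rule freq)
    show "\<forall>\<^sub>F n in sequentially. real i - k - 3 * D - 1 + D \<le> gp (l (int i)) (v (q n))"
      using pos[of "int i"] close[of "int i"]
    proof eventually_elim
      case (elim n)
      let ?w = "\<sigma> (q n) (s (q n))" and ?f = "F (q n) (int i)"
      have "dist ?w (v (q n)) = L (q n) - s (q n)" "dist ?w ?f = real i" "dist ?f (v (q n)) = L (q n) - s (q n) - real i"
        using geodesic_onD[OF \<sigma>(1), of "s (q n)" "q n" "L (q n)"] s[of "q n"] elim
          geodesic_onD[OF \<sigma>(1), of "s (q n)" "q n" "s (q n) + real i"]
          geodesic_onD[OF \<sigma>(1), of "s (q n) + real i" "q n" "L (q n)"] by (auto simp: \<sigma> L_def)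
      then have "gromov_product ?w ?f (v (q n)) = real i" by (simp add: gromov_product_def)
      then have "real i - (k + 2 * D) \<le> gp ?f (v (q n))"
        using gp_change_base[of ?w ?f "v (q n)" x\<^sub>0] s(3)[OF q(2)[of n]] by (simp add: dist_commute)
      then show ?case using gp_change_point[of x\<^sub>0 ?f "v (q n)" "l (int i)"] elim by (simp add: dist_commute)
    qed
  qed
  have nearu: "l (- int i) \<in> near \<xi> (real i - k - 3 * D - 1)" for i
  proof (rule nearI[OF \<xi> u], rule freq)
    show "\<forall>\<^sub>F n in sequentially. real i - k - 3 * D - 1 + D \<le> gp (l (- int i)) (u (q n))"
      using pos[of "- int i"] close[of "- int i"]
    proof eventually_elim
      case (elim n)
      let ?w = "\<sigma> (q n) (s (q n))" and ?f = "F (q n) (- int i)"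
      have "dist ?w (u (q n)) = s (q n)" "dist ?w ?f = real i" "dist ?f (u (q n)) = s (q n) - real i"
        using geodesic_onD[OF \<sigma>(1), of "s (q n)" "q n" 0] s[of "q n"] elim
          geodesic_onD[OF \<sigma>(1), of "s (q n)" "q n" "s (q n) - real i"]
          geodesic_onD[OF \<sigma>(1), of "s (q n) - real i" "q n" 0] by (auto simp: \<sigma> L_def)
      then have "gromov_product ?w ?f (u (q n)) = real i" by (simp add: gromov_product_def)
      then have "real i - (k + 2 * D) \<le> gp ?f (u (q n))"
        using gp_change_base[of ?w ?f "u (q n)" x\<^sub>0] s(3)[OF q(2)[of n]] by (simp add: dist_commute)
      then show ?case using gp_change_point[of x\<^sub>0 ?f "u (q n)" "l (- int i)"] elim by (simp add: dist_commute)
    qed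
  qed
  have memI: "(\<lambda>n. w n) \<in> \<zeta>" if z: "\<zeta> \<in> bdry" and w: "\<And>i. w i \<in> near \<zeta> (real i - k - 3 * D - 1)" for w \<zeta>
  proof (rule near_seq_mem[OF z])
    fix T
    obtain M :: nat where M: "T + k + 3 * D + 1 \<le> real M" using real_arch_simple by blast
    show "\<forall>\<^sub>F n in sequentially. w n \<in> near \<zeta> T"
      using eventually_ge_at_top[of M]
    proof eventually_elim
      case (elim n)
      then have "T \<le> real n - k - 3 * D - 1" using M by linarith
      then show ?case using near_mono w by blast
    qed
  qed
  have "(\<lambda>n. c (real n)) \<in> \<eta>" using memI[OF \<eta> nearv] c(2)[of "int _"] by simp
  moreover have "(\<lambda>n. c (- real n)) \<in> \<xi>" using memI[OF \<xi> nearu] c(2)[of "- int _"] by simp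
  ultimately show ?thesis using that c(1) unfolding geodesic_line_between_def by blast
qed

lemma line_near_point:
  fixes x :: 'a
  assumes "geodesic_line_between \<xi> \<eta> c"
    and "\<exists>\<^sub>F n in sequentially. gromov_product x (c (- real n)) (c (real n)) \<le> k"
  obtains s where "dist x (c s) \<le> k + 2 * D"
proof -
  have c: "geodesic_on UNIV c" using assms(1) unfolding geodesic_line_between_def by blast
  obtain n where n: "gromov_product x (c (- real n)) (c (real n)) \<le> k"
    using frequently_ex[OF assms(2)] by blast
  have d: "dist (c (- real n)) (c (real n)) = 2 * real n" using geodesic_onD[OF c] by simp
  have g: "geodesic_on {0..dist (c (- real n)) (c (real n))} (\<lambda>s. c (s - real n))"
    using geodesic_onD[OF c] unfolding geodesic_on_def by simp
  obtain s where "dist x (c (s - real n)) \<le> gromov_product x (c (- real n)) (c (real n)) + 2 * D"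
    by (rule geodesic_near_point[OF g]) (auto simp: d)
  then show ?thesis using that[of "s - real n"] n by linarith
qed

section \<open>Busemann functions and products along lines and rays\<close>

lemma line_shift_busemann:
  assumes "\<xi> \<in> bdry" "geodesic_line_between \<xi> \<eta> c"
  shows "\<bar>bus \<xi> (c s) - bus \<xi> (c t) - (s - t)\<bar> \<le> 4 * D"
proof -
  have c: "geodesic_on UNIV c" "(\<lambda>n. c (- real n)) \<in> \<xi>"
    using assms(2) unfolding geodesic_line_between_def by auto
  obtain N :: nat where N: "\<bar>s\<bar> + \<bar>t\<bar> \<le> real N" using real_arch_simple by blast
  have "\<forall>\<^sub>F n in sequentially. \<bar>bus \<xi> (c s) - bus \<xi> (c t) - (s - t)\<bar> \<le> 4 * D"
    using busemann_approx[OF assms(1) c(2), of "c s" x\<^sub>0] busemann_approx[OF assms(1) c(2), of "c t" x\<^sub>0]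
      eventually_ge_at_top[of N]
  proof eventually_elim
    case (elim n)
    have "dist (c s) (c (- real n)) = s + real n" "dist (c t) (c (- real n)) = t + real n"
      using geodesic_onD[OF c(1)] elim N by auto
    then show ?case using elim by (simp add: abs_le_iff)
  qed
  then show ?thesis by simp
qed

text \<open>A substitute for following a ray from \<open>z\<close> to \<open>\<xi>\<close>: one
  walks along a segment to a far member of a sequence in \<open>\<xi>\<close>. Of the error,
  \<open>2 * D\<close> is hyperbolicity and \<open>4 * D\<close> the two Busemann
  approximations.\<close>

lemma move_towards:
  assumes "\<xi> \<in> bdry" "0 \<le> L"
  obtains z' where "dist z z' = L" "bus \<xi> z' \<le> bus \<xi> z - L + 6 * D"
proof -
  obtain u where u: "u \<in> \<xi>" using bdry_nonempty[OF assms(1)] .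
  obtain N where N: "\<And>m n. m \<ge> N \<Longrightarrow> n \<ge> N \<Longrightarrow> L + dist x\<^sub>0 z \<le> gp (u m) (u n)"
    using gromov_sequenceD[OF bdry_gromov_sequence[OF assms(1) u], of "L + dist x\<^sub>0 z"] by metis
  have zb: "L \<le> gromov_product z (u N) (u m)" if "m \<ge> N" for m
    using N[OF order_refl that] gp_change_base[of x\<^sub>0 "u N" "u m" z] by simp
  then have dN: "L \<le> dist z (u N)" using gp_le_dist(1)[of z "u N" "u N"] by force
  obtain c where c: "geodesic_on {0..dist z (u N)} c" "c 0 = z" "c (dist z (u N)) = u N"
    using obtain_geodesic by blast
  have d: "dist z (c L) = L" "dist (c L) (u N) = dist z (u N) - L"
    using geodesic_onD[OF c(1), of 0 L] geodesic_onD[OF c(1), of L "dist z (u N)"] dN assms(2) c by auto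
  have "\<forall>\<^sub>F m in sequentially. bus \<xi> (c L) \<le> bus \<xi> z - L + 6 * D"
    using busemann_approx[OF assms(1) u, of "c L" x\<^sub>0] busemann_approx[OF assms(1) u, of z x\<^sub>0]
      eventually_ge_at_top[of N]
  proof eventually_elim
    case (elim m)
    have "gromov_product z (c L) (u N) = L" unfolding gromov_product_def using d by simp
    then have "L - D \<le> gromov_product z (c L) (u m)"
      using hyp[of z "c L" "u N" "u m"] zb[of m] elim by simp
    then have "dist (c L) (u m) \<le> dist z (u m) - L + 2 * D"
      unfolding gromov_product_def using d by (simp add: field_simps)
    then show ?case using elim by (simp add: abs_le_iff)
  qed
  then show ?thesis using that d by simp
qed

lemma pp_bounds: assumes "\<xi> \<in> bdry" shows "- D \<le> pp x \<xi>" "pp x \<xi> \<le> dist x\<^sub>0 x + D"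
proof -
  obtain u where u: "u \<in> \<xi>" using bdry_nonempty[OF assms] .
  obtain n where "\<bar>gp x (u n) - pp x \<xi>\<bar> \<le> D"
    using eventually_happens'[OF sequentially_bot pp_approx[OF assms u]] by blast
  then show "- D \<le> pp x \<xi>" "pp x \<xi> \<le> dist x\<^sub>0 x + D"
    using gp_nonneg[of x\<^sub>0 x "u n"] gp_le_dist(1)[of x\<^sub>0 x "u n"] by linarith+
qed

lemma ray_dist:
  assumes "geodesic_ray_to x\<^sub>0 \<xi> c" "0 \<le> t" shows "dist x\<^sub>0 (c t) = t"
  using assms geodesic_onD[of "{0..}" c 0 t] unfolding geodesic_ray_to_def by auto

lemma ray_dist2:
  assumes "geodesic_ray_to x\<^sub>0 \<xi> c" "0 \<le> s" "0 \<le> t" shows "dist (c s) (c t) = \<bar>s - t\<bar>"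
  using assms geodesic_onD[of "{0..}" c s t] unfolding geodesic_ray_to_def by auto

lemma ray_gp_ev:
  assumes "geodesic_ray_to x\<^sub>0 \<xi> c" "0 \<le> t"
  shows "\<forall>\<^sub>F n in sequentially. gp (c t) (c (real n)) = t"
proof -
  obtain N :: nat where N: "t \<le> real N" using real_arch_simple by blast
  show ?thesis using eventually_ge_at_top[of N]
  proof eventually_elim
    case (elim n)
    then show ?case using N assms ray_dist[OF assms(1)] ray_dist2[OF assms(1), of t "real n"]
      by (simp add: gromov_product_def)
  qed
qed

end

subsection \<open>Parabolic points and horoballs\<close>

context hyp_group
begin

abbreviation P :: "'a bdry set" where "P \<equiv> parabolic_points x\<^sub>0 \<Gamma>"
abbreviation stab :: "'a bdry \<Rightarrow> ('a \<Rightarrow> 'a) set" where "stab \<equiv> bdry_stab \<Gamma>"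

lemma stabD: "g \<in> stab p \<Longrightarrow> g \<in> \<Gamma>" "g \<in> stab p \<Longrightarrow> bdry_act g p = p"
  unfolding bdry_stab_def by auto

lemma stabI: "g \<in> \<Gamma> \<Longrightarrow> bdry_act g p = p \<Longrightarrow> g \<in> stab p"
  unfolding bdry_stab_def by auto

lemma subgroup_stab: "subgroup (stab p) (BijGroup UNIV)"
proof (rule subgroup_BijGroup_UNIV_I)
  show "id \<in> stab p" by (rule stabI) (auto simp: id_G act_id)
  show "bij g" if "g \<in> stab p" for g using that bij_G stabD by blast
  show "g \<circ> h \<in> stab p" if "g \<in> stab p" "h \<in> stab p" for g h
    using that by (intro stabI) (auto simp: comp_G act_comp stabD)
  show "ginv g \<in> stab p" if "g \<in> stab p" for g
    using that inv_G act_inv(1)[OF stabD(1)[OF that], of p] by (intro stabI) (auto simp: stabD)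
qed

lemma ginv_ginv: "g \<in> \<Gamma> \<Longrightarrow> ginv (ginv g) = g"
  using bij_G inv_inv_eq by blast

lemma stab_conj:
  assumes "g \<in> \<Gamma>" "h \<in> stab p" shows "g \<circ> h \<circ> ginv g \<in> stab (bdry_act g p)"
  using assms by (intro stabI) (auto simp: comp_G inv_G act_comp act_inv stabD)

lemma stab_conj':
  assumes "g \<in> \<Gamma>" "k \<in> stab (bdry_act g p)" shows "ginv g \<circ> k \<circ> g \<in> stab p"
  using stab_conj[OF inv_G[OF assms(1)] assms(2)] assms by (simp add: act_inv ginv_ginv)

lemma funpow_conj: "g \<in> \<Gamma> \<Longrightarrow> ((g \<circ> h \<circ> ginv g) ^^ n) x = g ((h ^^ n) (ginv g x))"
  by (induction n) (auto simp: inv_cancel)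

lemma funpow_G: "h \<in> \<Gamma> \<Longrightarrow> h ^^ n \<in> \<Gamma>"
  by (induction n) (auto simp: id_G[unfolded id_def] id_def comp_G id_G)

lemma loxodromic_conj:
  assumes "g \<in> \<Gamma>" "h \<in> \<Gamma>" shows "loxodromic x\<^sub>0 (g \<circ> h \<circ> ginv g) \<longleftrightarrow> loxodromic x\<^sub>0 h"
proof -
  define a where "a n = dist x\<^sub>0 ((h ^^ n) x\<^sub>0)" for n
  define b where "b n = dist x\<^sub>0 (((g \<circ> h \<circ> ginv g) ^^ n) x\<^sub>0)" for n
  have "\<bar>a n - b n\<bar> \<le> 2 * dist x\<^sub>0 (g x\<^sub>0)" for n
  proof -
    let ?y = "ginv g x\<^sub>0"
    have b: "b n = dist ?y ((h ^^ n) ?y)"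
      unfolding b_def funpow_conj[OF assms(1)] using dist_inv[OF assms(1), of x\<^sub>0] by simp
    have "dist ?y x\<^sub>0 = dist x\<^sub>0 (g x\<^sub>0)" using dist_inv[OF assms(1)] by simp
    moreover have "dist ((h ^^ n) ?y) ((h ^^ n) x\<^sub>0) = dist ?y x\<^sub>0"
      by (rule dist_G[OF funpow_G[OF assms(2)]])
    ultimately show ?thesis
      unfolding a_def b using dist_triangle[of ?y "(h ^^ n) ?y" x\<^sub>0] dist_triangle[of x\<^sub>0 "(h ^^ n) ?y" "(h ^^ n) x\<^sub>0"]
        dist_triangle[of x\<^sub>0 "(h ^^ n) x\<^sub>0" ?y] dist_triangle[of ?y "(h ^^ n) x\<^sub>0" "(h ^^ n) ?y"]
      by (simp add: dist_commute abs_le_iff)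
  qed
  then have bd: "norm (a n / real n - b n / real n) \<le> 2 * dist x\<^sub>0 (g x\<^sub>0) / real n" for n
    by (simp add: diff_divide_distrib[symmetric] abs_divide divide_right_mono)
  have "(\<lambda>n. 2 * dist x\<^sub>0 (g x\<^sub>0) / real n) \<longlonglongrightarrow> 0" by (rule lim_const_over_n)
  then have z: "(\<lambda>n. a n / real n - b n / real n) \<longlonglongrightarrow> 0"
    by (rule Lim_null_comparison[rotated]) (use bd in auto)
  \<comment> \<open>\<open>lim\<close> is a definite description; as the two sequences have exactly
    the same limits, the values agree without any knowledge of convergence.\<close>
  have "(\<lambda>n. a n / real n) \<longlonglongrightarrow> l \<longleftrightarrow> (\<lambda>n. b n / real n) \<longlonglongrightarrow> l" for l
    using Lim_transform[OF _ z, of l] Lim_transform2[OF _ z, of l] by blast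
  then have "lim (\<lambda>n. a n / real n) = lim (\<lambda>n. b n / real n)" unfolding lim_def by simp
  then show ?thesis unfolding loxodromic_def a_def b_def by simp
qed

lemma P_limit: "p \<in> P \<Longrightarrow> p \<in> \<Lambda>" unfolding parabolic_points_def by blast
lemma P_bdry: "p \<in> P \<Longrightarrow> p \<in> bdry" using P_limit limit_bdry by blast

text \<open>Conjugation by \<open>g\<close> carries \<open>stab p\<close> to the stabilizer of the
  image point; it preserves infiniteness, moves the unique fixed point along and, by
  \<open>loxodromic_conj\<close>, creates no loxodromic element.\<close>

lemma act_P: assumes g: "g \<in> \<Gamma>" and p: "p \<in> P" shows "bdry_act g p \<in> P"
proof -
  have par: "parabolic_subgroup x\<^sub>0 \<Gamma> (stab p)" using p unfolding parabolic_points_def by blast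
  let ?q = "bdry_act g p"
  have uniq: "\<zeta> = p" if "\<zeta> \<in> bdry" "\<forall>h\<in>stab p. bdry_act h \<zeta> = \<zeta>" for \<zeta>
  proof -
    have "\<exists>!\<xi>. \<xi> \<in> bdry \<and> (\<forall>h\<in>stab p. bdry_act h \<xi> = \<xi>)"
      using par unfolding parabolic_subgroup_def by blast
    moreover have "p \<in> bdry \<and> (\<forall>h\<in>stab p. bdry_act h p = p)" using P_bdry[OF p] stabD by blast
    ultimately show ?thesis using that by blast
  qed
  have "parabolic_subgroup x\<^sub>0 \<Gamma> (stab ?q)"
    unfolding parabolic_subgroup_def
  proof (intro conjI)
    show "subgroup (stab ?q) (BijGroup UNIV)" by (rule subgroup_stab)
    show "stab ?q \<subseteq> \<Gamma>" using stabD by blast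
    show "infinite (stab ?q)"
    proof
      assume fin: "finite (stab ?q)"
      have "(\<lambda>h. g \<circ> h \<circ> ginv g) ` stab p \<subseteq> stab ?q" using stab_conj[OF g] by blast
      moreover have "inj_on (\<lambda>h. g \<circ> h \<circ> ginv g) (stab p)"
      proof (rule inj_onI)
        fix h h' assume "g \<circ> h \<circ> ginv g = g \<circ> h' \<circ> ginv g"
        then have "ginv g \<circ> (g \<circ> h \<circ> ginv g) \<circ> g = ginv g \<circ> (g \<circ> h' \<circ> ginv g) \<circ> g" by simp
        then show "h = h'" by (simp add: fun_eq_iff inv_cancel[OF g])
      qed
      ultimately have "finite (stab p)" using fin by (meson finite_imageD finite_subset)
      then show False using par unfolding parabolic_subgroup_def by blast
    qed
    show "\<exists>!\<xi>. \<xi> \<in> bdry \<and> (\<forall>k\<in>stab ?q. bdry_act k \<xi> = \<xi>)"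
    proof (rule ex1I)
      show "?q \<in> bdry \<and> (\<forall>k\<in>stab ?q. bdry_act k ?q = ?q)" using act_bdry[OF g P_bdry[OF p]] stabD by blast
      fix \<zeta> assume \<zeta>: "\<zeta> \<in> bdry \<and> (\<forall>k\<in>stab ?q. bdry_act k \<zeta> = \<zeta>)"
      have "bdry_act (ginv g) \<zeta> = p"
      proof (rule uniq)
        show "bdry_act (ginv g) \<zeta> \<in> bdry" using act_bdry inv_G g \<zeta> by blast
        show "\<forall>h\<in>stab p. bdry_act h (bdry_act (ginv g) \<zeta>) = bdry_act (ginv g) \<zeta>"
        proof
          fix h assume "h \<in> stab p"
          then have "bdry_act (g \<circ> h \<circ> ginv g) \<zeta> = \<zeta>" using stab_conj[OF g] \<zeta> by blast
          then have "bdry_act (ginv g) (bdry_act g (bdry_act h (bdry_act (ginv g) \<zeta>))) = bdry_act (ginv g) \<zeta>"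
            by (simp add: act_comp)
          then show "bdry_act h (bdry_act (ginv g) \<zeta>) = bdry_act (ginv g) \<zeta>" by (simp add: act_inv[OF g])
        qed
      qed
      then show "\<zeta> = ?q" using act_inv(2)[OF g, of \<zeta>] by simp
    qed
    show "\<forall>k\<in>stab ?q. \<not> loxodromic x\<^sub>0 k"
    proof
      fix k assume k: "k \<in> stab ?q"
      define h where "h = ginv g \<circ> k \<circ> g"
      have h: "h \<in> stab p" unfolding h_def by (rule stab_conj'[OF g k])
      have "k = g \<circ> h \<circ> ginv g" by (simp add: h_def fun_eq_iff inv_cancel[OF g])
      moreover have "\<not> loxodromic x\<^sub>0 h" using par h unfolding parabolic_subgroup_def by blast
      ultimately show "\<not> loxodromic x\<^sub>0 k" using loxodromic_conj[OF g stabD(1)[OF h]] by simp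
    qed
  qed
  then show ?thesis using act_limit[OF g P_limit[OF p]] unfolding parabolic_points_def by blast
qed

end

section \<open>Horoballs: depth, local finiteness, distance to the orbit\<close>

locale cusped = hyp_group x\<^sub>0 D \<Gamma> for x\<^sub>0 :: "'a::heine_borel" and D \<Gamma> +
  fixes H :: "'a bdry \<Rightarrow> 'a set"
  assumes two_limit_points: "\<exists>a\<in>\<Lambda>. \<exists>b\<in>\<Lambda>. a \<noteq> b"
    and horo: "horoball_decomposition x\<^sub>0 \<Gamma> H"
begin

definition lr :: "'a bdry \<Rightarrow> real" where "lr p = ln (SOME r. r > 0 \<and> H p = horoball x\<^sub>0 p r)"

text \<open>The signed depth of a point in the horoball at \<open>p\<close>.\<close>

definition dep :: "'a bdry \<Rightarrow> 'a \<Rightarrow> real" where "dep p x = lr p - bus p x"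

lemma H_iff: assumes "p \<in> P" shows "x \<in> H p \<longleftrightarrow> 0 \<le> dep p x"
proof -
  have "\<exists>r. r > 0 \<and> H p = horoball x\<^sub>0 p r" using horo assms unfolding horoball_decomposition_def by blast
  from someI_ex[OF this] show ?thesis by (auto simp: horoball_def dep_def lr_def)
qed

lemma dep_disjoint: assumes "p \<in> P" "q \<in> P" "0 \<le> dep p x" "0 \<le> dep q x" shows "p = q"
proof (rule ccontr)
  assume "p \<noteq> q"
  moreover have "disjoint_family_on H P" using horo unfolding horoball_decomposition_def by blast
  ultimately have "H p \<inter> H q = {}" using assms(1,2) unfolding disjoint_family_on_def by blast
  moreover have "x \<in> H p \<inter> H q" using assms H_iff by blast
  ultimately show False by blast
qed

lemma dep_lip: assumes "p \<in> P" shows "dep p x \<le> dep p y + dist x y"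
  using busemann_lipschitz[OF P_bdry[OF assms], of y x\<^sub>0 x] by (simp add: dep_def dist_commute)

lemma continuous_dep: assumes "p \<in> P" shows "continuous_on S (dep p)"
  unfolding dep_def by (intro continuous_intros continuous_on_bus P_bdry assms)

abbreviation ghull :: "'a set" where "ghull \<equiv> geodesic_hull x\<^sub>0 \<Gamma>"

lemma line_in_hull: "\<xi> \<in> \<Lambda> \<Longrightarrow> \<eta> \<in> \<Lambda> \<Longrightarrow> geodesic_line_between \<xi> \<eta> c \<Longrightarrow> c s \<in> ghull"
  unfolding geodesic_hull_def by blast

lemma orbit_of_eq_iff: "orbit_of \<Gamma> x = orbit_of \<Gamma> y \<Longrightarrow> \<exists>g\<in>\<Gamma>. x = g y"
proof -
  assume "orbit_of \<Gamma> x = orbit_of \<Gamma> y"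
  moreover have "x \<in> orbit_of \<Gamma> x" unfolding orbit_of_def by (rule image_eqI[OF _ id_G]) simp
  ultimately show ?thesis unfolding orbit_of_def by blast
qed

text \<open>The points of the hull within \<open>n\<close> of the orbit form open invariant sets
  that exhaust the hull. Their images are therefore open in the quotient, and finitely many of them
  cover the compact closure of the image of the part outside the horoballs.\<close>

lemma hull_outside_horoballs:
  obtains K where "\<And>y. y \<in> ghull \<Longrightarrow> (\<And>p. p \<in> P \<Longrightarrow> y \<notin> H p) \<Longrightarrow> \<exists>g\<in>\<Gamma>. dist y (g x\<^sub>0) \<le> K"
proof -
  define Q where "Q = quotient_topology (top_of_set ghull) (orbit_of \<Gamma>)"
  define Y where "Y = ghull - (\<Union>p\<in>P. H p)"
  have cp: "compactin Q (Q closure_of (orbit_of \<Gamma> ` Y))"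
    using horo unfolding horoball_decomposition_def Q_def Y_def Let_def by blast
  define A where "A n = {x \<in> ghull. \<exists>h\<in>\<Gamma>. dist x (h x\<^sub>0) < real n}" for n
  have inv: "y \<in> A n" if xA: "x \<in> A n" and yh: "y \<in> ghull" and xy: "orbit_of \<Gamma> y = orbit_of \<Gamma> x" for x y n
  proof -
    obtain g where g: "g \<in> \<Gamma>" "y = g x" using orbit_of_eq_iff[OF xy] by blast
    obtain h where h: "h \<in> \<Gamma>" "dist x (h x\<^sub>0) < real n" using xA unfolding A_def by blast
    have "dist y ((g \<circ> h) x\<^sub>0) < real n" using h dist_G[OF g(1)] g(2) by simp
    then show ?thesis using comp_G[OF g(1) h(1)] yh unfolding A_def by blast
  qed
  have op: "openin Q (orbit_of \<Gamma> ` A n)" for n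
    unfolding Q_def openin_quotient_topology
  proof
    show "orbit_of \<Gamma> ` A n \<subseteq> orbit_of \<Gamma> ` topspace (top_of_set ghull)" by (auto simp: A_def)
    have "{x \<in> topspace (top_of_set ghull). orbit_of \<Gamma> x \<in> orbit_of \<Gamma> ` A n} = ghull \<inter> (\<Union>h\<in>\<Gamma>. ball (h x\<^sub>0) (real n))"
    proof (intro equalityI subsetI)
      fix x assume "x \<in> {x \<in> topspace (top_of_set ghull). orbit_of \<Gamma> x \<in> orbit_of \<Gamma> ` A n}"
      then have "x \<in> A n" using inv by auto
      then show "x \<in> ghull \<inter> (\<Union>h\<in>\<Gamma>. ball (h x\<^sub>0) (real n))" by (auto simp: A_def dist_commute)
    next
      fix x assume "x \<in> ghull \<inter> (\<Union>h\<in>\<Gamma>. ball (h x\<^sub>0) (real n))"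
      then show "x \<in> {x \<in> topspace (top_of_set ghull). orbit_of \<Gamma> x \<in> orbit_of \<Gamma> ` A n}"
        by (auto simp: A_def dist_commute)
    qed
    then show "openin (top_of_set ghull) {x \<in> topspace (top_of_set ghull). orbit_of \<Gamma> x \<in> orbit_of \<Gamma> ` A n}"
      by (simp only:) (intro openin_open_Int open_UN ballI open_ball)
  qed
  have tsq: "topspace Q = orbit_of \<Gamma> ` ghull"
  proof
    have "openin Q (topspace Q)" by (rule openin_topspace)
    then show "topspace Q \<subseteq> orbit_of \<Gamma> ` ghull" unfolding Q_def openin_quotient_topology by simp
    have "{x \<in> topspace (top_of_set ghull). orbit_of \<Gamma> x \<in> orbit_of \<Gamma> ` ghull} = ghull" by auto
    then have "openin Q (orbit_of \<Gamma> ` ghull)" unfolding Q_def openin_quotient_topology by simp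
    then show "orbit_of \<Gamma> ` ghull \<subseteq> topspace Q" by (rule openin_subset)
  qed
  have ts: "topspace Q \<subseteq> (\<Union>n. orbit_of \<Gamma> ` A n)"
    unfolding tsq
  proof (rule image_subsetI)
    fix x assume x: "x \<in> ghull"
    obtain n :: nat where "dist x x\<^sub>0 < real n" using reals_Archimedean2 by blast
    then have "x \<in> A n" using x id_G unfolding A_def by (auto intro!: bexI[of _ id])
    then show "orbit_of \<Gamma> x \<in> (\<Union>n. orbit_of \<Gamma> ` A n)" by blast
  qed
  have "Q closure_of (orbit_of \<Gamma> ` Y) \<subseteq> \<Union> (range (\<lambda>n. orbit_of \<Gamma> ` A n))"
    using ts closure_of_subset_topspace[of Q "orbit_of \<Gamma> ` Y"] by blast
  then obtain \<F> where \<F>: "finite \<F>" "\<F> \<subseteq> range (\<lambda>n. orbit_of \<Gamma> ` A n)" "Q closure_of (orbit_of \<Gamma> ` Y) \<subseteq> \<Union>\<F>"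
    using compactinD[OF cp, of "range (\<lambda>n. orbit_of \<Gamma> ` A n)"] op by blast
  obtain I where I: "finite I" "\<F> = (\<lambda>n. orbit_of \<Gamma> ` A n) ` I" using finite_subset_image[OF \<F>(1,2)] by blast
  show ?thesis
  proof (rule that)
    fix y assume y: "y \<in> ghull" "\<And>p. p \<in> P \<Longrightarrow> y \<notin> H p"
    then have "y \<in> Y" unfolding Y_def by blast
    moreover have "orbit_of \<Gamma> ` Y \<subseteq> Q closure_of (orbit_of \<Gamma> ` Y)"
      by (rule closure_of_subset) (auto simp: tsq Y_def)
    ultimately obtain n where n: "n \<in> I" "orbit_of \<Gamma> y \<in> orbit_of \<Gamma> ` A n" using \<F>(3) I(2) by blast
    then have "y \<in> A n" using inv y(1) by auto
    then obtain h where "h \<in> \<Gamma>" "dist y (h x\<^sub>0) < real n" unfolding A_def by blast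
    moreover have "real n \<le> real (Max I)" using n I(1) by simp
    ultimately show "\<exists>g\<in>\<Gamma>. dist y (g x\<^sub>0) \<le> real (Max I)" by force
  qed
qed

text \<open>In each horoball that meets the ball, a point of depth at least \<open>1\<close> is
  found at bounded distance. Unit balls around such points lie in distinct, disjoint horoballs, so
  infinitely many of them would contradict the compactness of closed balls.\<close>

lemma horoballs_locally_finite: "finite {p \<in> P. \<exists>z. dist y z \<le> \<rho> \<and> 0 \<le> dep p z}"
proof (rule ccontr)
  assume inf: "infinite {p \<in> P. \<exists>z. dist y z \<le> \<rho> \<and> 0 \<le> dep p z}"
  then obtain f :: "nat \<Rightarrow> 'a bdry" where f: "inj f" "range f \<subseteq> {p \<in> P. \<exists>z. dist y z \<le> \<rho> \<and> 0 \<le> dep p z}"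
    using infinite_countable_subset by blast
  have fP: "f n \<in> P" for n using f(2) by blast
  have "\<exists>z'. dist y z' \<le> \<rho> + (1 + 6 * D) \<and> 1 \<le> dep (f n) z'" for n
  proof -
    obtain z where z: "dist y z \<le> \<rho>" "0 \<le> dep (f n) z" using f(2) by blast
    obtain z' where z': "dist z z' = 1 + 6 * D" "bus (f n) z' \<le> bus (f n) z - (1 + 6 * D) + 6 * D"
      using move_towards[OF P_bdry[OF fP], of "1 + 6 * D"] D_ge_1 by auto
    then show ?thesis using z dist_triangle[of y z' z] by (intro exI[of _ z']) (auto simp: dep_def)
  qed
  then obtain w where w: "\<And>n. dist y (w n) \<le> \<rho> + (1 + 6 * D)" "\<And>n. 1 \<le> dep (f n) (w n)" by metis
  have "bounded (range w)" unfolding bounded_def using w(1) by blast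
  then obtain l r where r: "strict_mono (r :: nat \<Rightarrow> nat)" "(w \<circ> r) \<longlonglongrightarrow> l"
    using bounded_imp_convergent_subsequence by blast
  then have "Cauchy (w \<circ> r)" using LIMSEQ_imp_Cauchy by blast
  then obtain M where M: "\<And>m n. m \<ge> M \<Longrightarrow> n \<ge> M \<Longrightarrow> dist ((w \<circ> r) m) ((w \<circ> r) n) < 1"
    unfolding Cauchy_def using zero_less_one by metis
  have d: "dist (w (r M)) (w (r (Suc M))) < 1" using M[of M "Suc M"] by simp
  have "f (r M) = f (r (Suc M))"
  proof (rule dep_disjoint[OF fP fP])
    show "0 \<le> dep (f (r M)) (w (r (Suc M)))"
      using dep_lip[OF fP[of "r M"], of "w (r M)" "w (r (Suc M))"] w(2)[of "r M"] d by linarith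
    show "0 \<le> dep (f (r (Suc M))) (w (r (Suc M)))" using w(2)[of "r (Suc M)"] by linarith
  qed
  then have "r M = r (Suc M)" using f(1) by (simp add: inj_eq)
  then show False using r(1) by (simp add: strict_mono_eq)
qed

text \<open>Walking the distance \<open>\<bar>k\<bar> + 6 * D\<close> from the base point towards
  \<open>p\<close> reaches the horoball, so local finiteness applies.\<close>

lemma finite_depth_ge: "finite {p \<in> P. - k \<le> dep p x\<^sub>0}"
proof (rule finite_subset[OF _ horoballs_locally_finite[of x\<^sub>0 "\<bar>k\<bar> + 6 * D"]], clarify)
  fix p assume p: "p \<in> P" "- k \<le> dep p x\<^sub>0"
  obtain z' where z': "dist x\<^sub>0 z' = \<bar>k\<bar> + 6 * D" "bus p z' \<le> bus p x\<^sub>0 - (\<bar>k\<bar> + 6 * D) + 6 * D"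
    using move_towards[OF P_bdry[OF p(1)], of "\<bar>k\<bar> + 6 * D" x\<^sub>0] D_ge_1 by auto
  then show "\<exists>z. dist x\<^sub>0 z \<le> \<bar>k\<bar> + 6 * D \<and> 0 \<le> dep p z" using p by (intro exI[of _ z']) (auto simp: dep_def)
qed

lemma line_meets_horosphere:
  assumes "p \<in> P" "geodesic_line_between p \<eta> c"
  obtains s where "dep p (c s) = 0"
proof -
  \<comment> \<open>Along the line the depth is affine of slope -1 up to \<open>4 * D\<close>;
    \<open>a\<close> is large enough for it to be at most 0 at time \<open>a\<close> and at least 0
    at time \<open>- a\<close>.\<close>
  define a where "a = \<bar>dep p (c 0)\<bar> + 4 * D"
  have sh: "\<bar>bus p (c s) - bus p (c 0) - (s - 0)\<bar> \<le> 4 * D" for s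
    by (rule line_shift_busemann[OF P_bdry[OF assms(1)] assms(2)])
  have "continuous_on {-a..a} c"
  proof -
    have "geodesic_on UNIV c" using assms(2) unfolding geodesic_line_between_def by blast
    then show ?thesis unfolding continuous_on_iff geodesic_on_def by (metis UNIV_I dist_real_def)
  qed
  then have "continuous_on {-a..a} (\<lambda>s. dep p (c s))"
    using continuous_on_compose[OF _ continuous_dep[OF assms(1)]] by (simp add: o_def)
  moreover have "dep p (c a) \<le> 0" "0 \<le> dep p (c (- a))" "- a \<le> a"
    using sh[of a] sh[of "- a"] D_ge_1 unfolding dep_def a_def by linarith+
  ultimately show ?thesis using IVT2'[of "\<lambda>s. dep p (c s)" a 0 "- a"] that by blast
qed

lemma obtain_other_limit_point: obtains \<eta> where "\<eta> \<in> \<Lambda>" "\<eta> \<noteq> \<xi>"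
  using two_limit_points by metis

text \<open>The Hausdorff bound compares depths at one point \<open>y\<close> of the horosphere at
  \<open>p\<close>; depth differences are Busemann cocycles, invariant up to \<open>16 * D\<close>,
  and carry the comparison to every \<open>x\<close>. The upper bound is the lower bound for the
  inverse of \<open>g\<close>.\<close>

lemma depth_quasi_invariant:
  obtains C where "\<And>g p x. g \<in> \<Gamma> \<Longrightarrow> p \<in> P \<Longrightarrow> \<bar>dep (bdry_act g p) (g x) - dep p x\<bar> \<le> C"
proof -
  obtain E :: real where E: "\<And>g p. g \<in> \<Gamma> \<Longrightarrow> p \<in> P \<Longrightarrow> hausdorff_distance (H (bdry_act g p)) (g ` H p) \<le> ennreal E"
    using horo unfolding horoball_decomposition_def by blast
  have ge: "dep p x - (\<bar>E\<bar> + 1 + 16 * D) \<le> dep (bdry_act g p) (g x)" if g: "g \<in> \<Gamma>" and p: "p \<in> P" for g p x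
  proof -
    let ?q = "bdry_act g p"
    have q: "?q \<in> P" by (rule act_P[OF g p])
    \<comment> \<open>A point of depth exactly 0 is found on a line from \<open>p\<close> to a
      second limit point.\<close>
    obtain \<eta> where \<eta>: "\<eta> \<in> \<Lambda>" "\<eta> \<noteq> p" using obtain_other_limit_point .
    obtain c where c: "geodesic_line_between p \<eta> c"
      using exists_geodesic_line[OF P_bdry[OF p] limit_bdry[OF \<eta>(1)]] \<eta>(2) by blast
    obtain s where s: "dep p (c s) = 0" using line_meets_horosphere[OF p c] .
    define y where "y = c s"
    have "(SUP b\<in>g ` H p. INF a\<in>H ?q. ennreal (dist a b)) \<le> ennreal E"
      using E[OF g p] unfolding hausdorff_distance_def by simp
    moreover have "g y \<in> g ` H p" using s H_iff[OF p] by (simp add: y_def)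
    ultimately have "(INF a\<in>H ?q. ennreal (dist a (g y))) \<le> ennreal E" by (meson SUP_le_iff)
    also have "\<dots> < ennreal (\<bar>E\<bar> + 1)" by (rule ennreal_lessI) auto
    finally obtain a where a: "a \<in> H ?q" "ennreal (dist a (g y)) < ennreal (\<bar>E\<bar> + 1)"
      unfolding INF_less_iff by blast
    then have "dist a (g y) < \<bar>E\<bar> + 1" by (simp add: ennreal_less_iff del: ennreal_plus)
    then have "- (\<bar>E\<bar> + 1) \<le> dep ?q (g y)" using a(1) H_iff[OF q] dep_lip[OF q, of a "g y"] by auto
    moreover have "dep p x - dep p y \<le> dep ?q (g x) - dep ?q (g y) + 16 * D"
      using busemann_act[OF g P_bdry[OF p], of y x] busemann_cocycle[OF P_bdry[OF p], of y x]
        busemann_cocycle[OF P_bdry[OF q], of "g y" "g x"] unfolding dep_def by linarith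
    ultimately show ?thesis using s unfolding y_def by linarith
  qed
  have "\<bar>dep (bdry_act g p) (g x) - dep p x\<bar> \<le> \<bar>E\<bar> + 1 + 16 * D" if "g \<in> \<Gamma>" "p \<in> P" for g p x
    using ge[OF that, of x] ge[OF inv_G[OF that(1)] act_P[OF that], of "g x"] that
    by (simp add: act_inv inv_cancel abs_le_iff)
  then show ?thesis using that by blast
qed

text \<open>Pulled back by \<open>g\<close>, the depth of \<open>g x\<^sub>0\<close> becomes, up to
  a constant, a depth of the base point, of which only finitely many are nonnegative.\<close>

lemma orbit_depth_bounded:
  obtains C where "\<And>g p. g \<in> \<Gamma> \<Longrightarrow> p \<in> P \<Longrightarrow> dep p (g x\<^sub>0) \<le> C"
proof -
  obtain C where C: "\<And>g p x. g \<in> \<Gamma> \<Longrightarrow> p \<in> P \<Longrightarrow> \<bar>dep (bdry_act g p) (g x) - dep p x\<bar> \<le> C"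
    using depth_quasi_invariant by blast
  have "finite {p \<in> P. 0 \<le> dep p x\<^sub>0}" using finite_depth_ge[of 0] by simp
  then have "bdd_above ((\<lambda>p. dep p x\<^sub>0) ` {p \<in> P. 0 \<le> dep p x\<^sub>0})" by (intro bdd_above_finite) simp
  then obtain M where M: "\<And>p. p \<in> P \<Longrightarrow> 0 \<le> dep p x\<^sub>0 \<Longrightarrow> dep p x\<^sub>0 \<le> M"
    unfolding bdd_above_def by auto
  show ?thesis
  proof (rule that)
    fix g p assume g: "g \<in> \<Gamma>" and p: "p \<in> P"
    define q where "q = bdry_act (ginv g) p"
    have q: "q \<in> P" "bdry_act g q = p" using act_P[OF inv_G[OF g] p] by (auto simp: q_def act_inv[OF g])
    have "dep p (g x\<^sub>0) \<le> dep q x\<^sub>0 + C" using C[OF g q(1), of x\<^sub>0] q(2) by (simp add: abs_le_iff)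
    then show "dep p (g x\<^sub>0) \<le> max 0 M + C" using M[OF q(1)] by linarith
  qed
qed

text \<open>At the last time in \<open>H p\<close> the path is outside all other horoballs by
  disjointness. Only finitely many of them come near, and their depths are continuous, so right
  afterwards the path is outside every horoball.\<close>

lemma exit_horoballs:
  assumes p: "p \<in> P" and c: "geodesic_on {0..a} c" and a: "0 \<le> a"
    and in0: "0 \<le> dep p (c 0)" and out: "dep p (c a) < 0"
  obtains s where "0 \<le> s" "s \<le> a" "\<And>q. q \<in> P \<Longrightarrow> dep q (c s) < 0"
proof (rule ccontr)
  assume "\<not> thesis"
  then have cov: "\<And>s. 0 \<le> s \<Longrightarrow> s \<le> a \<Longrightarrow> \<exists>q\<in>P. 0 \<le> dep q (c s)" using that by (meson not_le)
  have cc: "continuous_on {0..a} c"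
    using c unfolding continuous_on_iff geodesic_on_def by (metis dist_real_def)
  then have cd: "continuous_on {0..a} (\<lambda>s. dep q (c s))" if "q \<in> P" for q
    using continuous_on_compose[OF _ continuous_dep[OF that]] by (simp add: o_def)
  define S where "S = {s \<in> {0..a}. 0 \<le> dep p (c s)}"
  have "S = {0..a} \<inter> (\<lambda>s. dep p (c s)) -` {0..}" by (auto simp: S_def)
  then have "closed S" using continuous_closed_preimage[OF cd[OF p], of "{0..}"] by simp
  moreover have "0 \<in> S" "bdd_above S" using in0 a by (auto simp: S_def bdd_above_def)
  ultimately have S1: "Sup S \<in> S" using closed_contains_Sup by blast
  define s1 where "s1 = Sup S"
  have s1: "0 \<le> s1" "s1 \<le> a" "0 \<le> dep p (c s1)" using S1 by (auto simp: S_def s1_def)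
  have gt: "dep p (c s) < 0" if "s1 < s" "s \<le> a" for s
  proof (rule ccontr)
    assume "\<not> dep p (c s) < 0"
    then have "s \<in> S" using that s1 by (simp add: S_def)
    then have "s \<le> s1" unfolding s1_def using \<open>bdd_above S\<close> by (rule cSup_upper)
    then show False using that by simp
  qed
  have "s1 < a" using out s1 by (cases "s1 = a") auto
  define F where "F = {q \<in> P. \<exists>z. dist (c s1) z \<le> 1 \<and> 0 \<le> dep q z} - {p}"
  have F: "finite F" unfolding F_def using horoballs_locally_finite by blast
  have "\<forall>q\<in>F. eventually (\<lambda>s. dep q (c s) < 0) (at s1 within {0..a})"
  proof
    fix q assume q: "q \<in> F"
    then have qP: "q \<in> P" "q \<noteq> p" by (auto simp: F_def)
    then have "dep q (c s1) < 0" using dep_disjoint[OF p qP(1) s1(3)] by (cases "0 \<le> dep q (c s1)") auto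
    moreover have "((\<lambda>s. dep q (c s)) \<longlongrightarrow> dep q (c s1)) (at s1 within {0..a})"
      using cd[OF qP(1)] s1 by (simp add: continuous_on_def)
    ultimately show "eventually (\<lambda>s. dep q (c s) < 0) (at s1 within {0..a})" by (rule order_tendstoD(2)[rotated])
  qed
  then have "eventually (\<lambda>s. \<forall>q\<in>F. dep q (c s) < 0) (at s1 within {0..a})"
    using F by (simp add: eventually_ball_finite)
  from this[unfolded eventually_at] obtain e
    where "e > 0 \<and> (\<forall>s\<in>{0..a}. s \<noteq> s1 \<and> dist s s1 < e \<longrightarrow> (\<forall>q\<in>F. dep q (c s) < 0))"
    by (rule exE)
  then have e: "e > 0" "\<forall>s\<in>{0..a}. s \<noteq> s1 \<and> dist s s1 < e \<longrightarrow> (\<forall>q\<in>F. dep q (c s) < 0)"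
    by (rule conjunct1, rule conjunct2)
  define s where "s = min a (s1 + min (e / 2) 1)"
  have s: "s1 < s" "s \<le> a" "s - s1 < e" "s - s1 \<le> 1" using \<open>s1 < a\<close> e(1) by (auto simp: s_def min_def)
  obtain q where q: "q \<in> P" "0 \<le> dep q (c s)" using cov[of s] s s1 by auto
  have "dist (c s1) (c s) \<le> 1" using geodesic_onD[OF c, of s1 s] s s1 by auto
  then have "q \<in> F" using q gt[OF s(1,2)] by (auto simp: F_def)
  then have "dep q (c s) < 0" using bspec[OF e(2), of s] s s1 by (auto simp: dist_real_def)
  then show False using q by simp
qed

text \<open>A point of a horoball at depth at most \<open>m\<close> leaves it along the line, in one
  of the two directions, within time about \<open>m\<close>; \<open>exit_horoballs\<close> then
  provides a point outside all horoballs, where the cocompactness bound holds.\<close>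

lemma hull_near_orbit:
  obtains K where "\<And>\<xi> \<eta> c s m. \<xi> \<in> \<Lambda> \<Longrightarrow> \<eta> \<in> \<Lambda> \<Longrightarrow> geodesic_line_between \<xi> \<eta> c \<Longrightarrow> 0 \<le> m \<Longrightarrow>
    (\<And>p. p \<in> P \<Longrightarrow> dep p (c s) \<le> m) \<Longrightarrow> \<exists>g\<in>\<Gamma>. dist (c s) (g x\<^sub>0) \<le> m + K"
proof -
  obtain K where K: "\<And>y. y \<in> ghull \<Longrightarrow> (\<And>p. p \<in> P \<Longrightarrow> y \<notin> H p) \<Longrightarrow> \<exists>g\<in>\<Gamma>. dist y (g x\<^sub>0) \<le> K"
    using hull_outside_horoballs by blast
  show ?thesis
  proof (rule that)
    fix \<xi> \<eta> c s m
    assume \<xi>: "\<xi> \<in> \<Lambda>" and \<eta>: "\<eta> \<in> \<Lambda>" and l: "geodesic_line_between \<xi> \<eta> c" and m: "0 \<le> (m::real)"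
      and dm: "\<And>p. p \<in> P \<Longrightarrow> dep p (c s) \<le> m"
    have c: "geodesic_on UNIV c" using l unfolding geodesic_line_between_def by blast
    show "\<exists>g\<in>\<Gamma>. dist (c s) (g x\<^sub>0) \<le> m + (6 * D + 1 + K)"
    proof (cases "\<exists>p\<in>P. 0 \<le> dep p (c s)")
      case False
      then have "\<exists>g\<in>\<Gamma>. dist (c s) (g x\<^sub>0) \<le> K"
        using K[OF line_in_hull[OF \<xi> \<eta> l]] H_iff by blast
      then show ?thesis using m D_ge_1 by force
    next
      case True
      then obtain p where p: "p \<in> P" "0 \<le> dep p (c s)" by blast
      \<comment> \<open>The two directions along the line have product 0 at \<open>c s\<close>, so
        by hyperbolicity one of them leads away from \<open>p\<close>: the distance to
        \<open>p\<close> grows by at least \<open>a - 2 * D\<close>. With \<open>4 * D\<close> for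
        the Busemann approximations, \<open>6 * D + 1\<close> suffices to beat the depth
        \<open>m\<close>.\<close>
      define a where "a = m + 6 * D + 1"
      have a: "0 < a" using m D_ge_1 by (simp add: a_def)
      obtain u where u: "u \<in> p" using bdry_nonempty[OF P_bdry[OF p(1)]] .
      have "\<forall>\<^sub>F n in sequentially. dep p (c (s + a)) < 0 \<or> dep p (c (s - a)) < 0"
        using busemann_approx[OF P_bdry[OF p(1)] u, of "c s" x\<^sub>0]
          busemann_approx[OF P_bdry[OF p(1)] u, of "c (s + a)" x\<^sub>0]
          busemann_approx[OF P_bdry[OF p(1)] u, of "c (s - a)" x\<^sub>0]
      proof eventually_elim
        case (elim n)
        have d: "dist (c s) (c (s + a)) = a" "dist (c s) (c (s - a)) = a" "dist (c (s + a)) (c (s - a)) = 2 * a"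
          using geodesic_onD[OF c] a by auto
        have "gromov_product (c s) (c (s + a)) (c (s - a)) = 0"
          unfolding gromov_product_def using d by simp
        then have "gromov_product (c s) (c (s + a)) (u n) \<le> D \<or> gromov_product (c s) (u n) (c (s - a)) \<le> D"
          using hyp[of "c s" "c (s + a)" "u n" "c (s - a)"] by linarith
        then have "dist (c s) (u n) + a - 2 * D \<le> dist (c (s + a)) (u n) \<or>
            dist (c s) (u n) + a - 2 * D \<le> dist (c (s - a)) (u n)"
          unfolding gromov_product_def using d by (auto simp: dist_commute field_simps)
        then show ?case using elim dm[OF p(1)] unfolding dep_def a_def by (auto simp: abs_le_iff)
      qed
      then have "dep p (c (s + a)) < 0 \<or> dep p (c (s - a)) < 0" by simp
      then obtain \<sigma> :: real where \<sigma>: "\<bar>\<sigma>\<bar> = 1" "dep p (c (s + \<sigma> * a)) < 0"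
        by (metis abs_minus_cancel abs_one add.right_neutral add_uminus_conv_diff mult_1 mult_minus_left)
      have sub: "geodesic_on {0..a} (\<lambda>t. c (s + \<sigma> * t))"
        using c \<sigma>(1) unfolding geodesic_on_def
        by (auto simp: right_diff_distrib[symmetric] abs_mult)
      obtain t where t: "0 \<le> t" "t \<le> a" "\<And>q. q \<in> P \<Longrightarrow> dep q (c (s + \<sigma> * t)) < 0"
        using exit_horoballs[OF p(1) sub] a p(2) \<sigma>(2) by auto
      then obtain g where g: "g \<in> \<Gamma>" "dist (c (s + \<sigma> * t)) (g x\<^sub>0) \<le> K"
        using K[OF line_in_hull[OF \<xi> \<eta> l], of "s + \<sigma> * t"] H_iff by (meson not_le)
      have "dist (c s) (c (s + \<sigma> * t)) = t" using geodesic_onD[OF c] \<sigma>(1) t(1) by (simp add: abs_mult)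
      then show ?thesis using g t(2) dist_triangle[of "c s" "g x\<^sub>0" "c (s + \<sigma> * t)"]
        by (intro bexI[of _ g]) (auto simp: a_def)
    qed
  qed
qed

text \<open>Rays from the base point need not lie in the hull. Of two fixed limit points at least
  one has bounded product with \<open>\<xi>\<close>; the line from it to \<open>\<xi>\<close> lies
  in the hull and passes within bounded distance of every point of the ray.\<close>

lemma ray_near_orbit:
  obtains K where "\<And>\<xi> c t m. \<xi> \<in> \<Lambda> \<Longrightarrow> geodesic_ray_to x\<^sub>0 \<xi> c \<Longrightarrow> 0 \<le> t \<Longrightarrow> 0 \<le> m \<Longrightarrow>
    (\<And>p. p \<in> P \<Longrightarrow> dep p (c t) \<le> m) \<Longrightarrow> \<exists>g\<in>\<Gamma>. dist (c t) (g x\<^sub>0) \<le> m + K"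
proof -
  obtain K where K: "\<And>\<xi> \<eta> c s m. \<xi> \<in> \<Lambda> \<Longrightarrow> \<eta> \<in> \<Lambda> \<Longrightarrow> geodesic_line_between \<xi> \<eta> c \<Longrightarrow> 0 \<le> m \<Longrightarrow>
    (\<And>p. p \<in> P \<Longrightarrow> dep p (c s) \<le> m) \<Longrightarrow> \<exists>g\<in>\<Gamma>. dist (c s) (g x\<^sub>0) \<le> m + K"
    using hull_near_orbit by blast
  obtain a b where ab: "a \<in> \<Lambda>" "b \<in> \<Lambda>" "a \<noteq> b" using two_limit_points by blast
  obtain k0 where k0: "\<not> ereal k0 \<le> bprod a b"
    using bprod_finite[OF limit_bdry[OF ab(1)] limit_bdry[OF ab(2)] ab(3)] .
  define E where "E = \<bar>k0\<bar> + 9 * D"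
  show ?thesis
  proof (rule that)
    fix \<xi> c t m
    assume \<xi>: "\<xi> \<in> \<Lambda>" and c: "geodesic_ray_to x\<^sub>0 \<xi> c" and t: "0 \<le> t" and m: "0 \<le> (m::real)"
      and dm: "\<And>p. p \<in> P \<Longrightarrow> dep p (c t) \<le> m"
    have "\<exists>\<eta>\<in>\<Lambda>. \<not> ereal (k0 + 4 * D) \<le> bprod \<eta> \<xi>"
    proof (rule ccontr)
      assume "\<not> ?thesis"
      then have "ereal (k0 + 4 * D) \<le> bprod a \<xi>" "ereal (k0 + 4 * D) \<le> bprod \<xi> b"
        using ab bprod_commute[of b] by auto
      then have "ereal (k0 + 4 * D - 4 * D) \<le> bprod a b"
        using bprod_hyp[of a \<xi> b] ab \<xi> limit_bdry by blast
      then show False using k0 by simp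
    qed
    then obtain \<eta> where \<eta>: "\<eta> \<in> \<Lambda>" "\<not> ereal (k0 + 4 * D) \<le> bprod \<eta> \<xi>" by blast
    then have ne: "\<eta> \<noteq> \<xi>" using bprod_self limit_bdry[OF \<xi>] by auto
    obtain l where l: "geodesic_line_between \<eta> \<xi> l"
      using exists_geodesic_line[OF limit_bdry[OF \<eta>(1)] limit_bdry[OF \<xi>] ne] .
    have mem: "(\<lambda>n. l (- real n)) \<in> \<eta>" "(\<lambda>n. l (real n)) \<in> \<xi>" "(\<lambda>n. c (real n)) \<in> \<xi>"
      using l c unfolding geodesic_line_between_def geodesic_ray_to_def by auto
    have "\<forall>\<^sub>F n in sequentially. gromov_product (c t) (l (- real n)) (l (real n)) \<le> k0 + 7 * D"
      using bprod_less_ev[OF limit_bdry[OF \<eta>(1)] limit_bdry[OF \<xi>] \<eta>(2) mem(1,2)]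
        ray_gp_ev[OF c t] bdry_ev_gp[OF limit_bdry[OF \<xi>] mem(3,2), of t]
    proof eventually_elim
      case (elim n)
      have "t - D \<le> gp (c t) (l (real n))" using gp_hyp[of "c t" "c (real n)" "l (real n)"] elim by simp
      moreover have "gromov_product (c t) (l (- real n)) (l (real n)) =
        gp (l (- real n)) (l (real n)) + dist (c t) x\<^sub>0 - gp (c t) (l (- real n)) - gp (c t) (l (real n))"
        by (rule gp_base_formula)
      ultimately show ?case using elim ray_dist[OF c t] gp_nonneg[of x\<^sub>0 "c t" "l (- real n)"]
        by (simp add: dist_commute)
    qed
    then have "\<exists>\<^sub>F n in sequentially. gromov_product (c t) (l (- real n)) (l (real n)) \<le> k0 + 7 * D"
      by (rule eventually_frequently[OF sequentially_bot])
    from line_near_point[OF l this] obtain s where s: "dist (c t) (l s) \<le> k0 + 9 * D" by (auto simp: add.assoc)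
    then have sE: "dist (c t) (l s) \<le> E" by (simp add: E_def)
    then have "0 \<le> E" using zero_le_dist order_trans by blast
    have "dep p (l s) \<le> m + E" if "p \<in> P" for p
      using dep_lip[OF that, of "l s" "c t"] dm[OF that] sE by (simp add: dist_commute)
    then obtain g where "g \<in> \<Gamma>" "dist (l s) (g x\<^sub>0) \<le> m + E + K"
      using K[OF \<eta>(1) \<xi> l, of "m + E" s] m \<open>0 \<le> E\<close> by auto
    then show "\<exists>g\<in>\<Gamma>. dist (c t) (g x\<^sub>0) \<le> m + (2 * E + K)"
      using sE dist_triangle[of "c t" _ "l s"] by (intro bexI[of _ g]) (smt (verit))+
  qed
qed

end

subsection \<open>Rays, horoballs and translates of fundamental domains\<close>

text \<open>One constant dominates \<open>D\<close> and all geometric bounds found so far, so that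
  later errors are multiples of \<open>K\<close>.\<close>

locale cusp_const = cusped x\<^sub>0 D \<Gamma> H for x\<^sub>0 :: "'a::heine_borel" and D \<Gamma> H +
  fixes K :: real
  assumes D_le_K: "D \<le> K"
    and quasi_inv: "\<And>g p x. g \<in> \<Gamma> \<Longrightarrow> p \<in> P \<Longrightarrow> \<bar>dep (bdry_act g p) (g x) - dep p x\<bar> \<le> K"
    and orbit_dep: "\<And>g p. g \<in> \<Gamma> \<Longrightarrow> p \<in> P \<Longrightarrow> dep p (g x\<^sub>0) \<le> K"
    and hull_orbit: "\<And>\<xi> \<eta> c s m. \<xi> \<in> \<Lambda> \<Longrightarrow> \<eta> \<in> \<Lambda> \<Longrightarrow> geodesic_line_between \<xi> \<eta> c \<Longrightarrow> 0 \<le> m \<Longrightarrow>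
      (\<And>p. p \<in> P \<Longrightarrow> dep p (c s) \<le> m) \<Longrightarrow> \<exists>g\<in>\<Gamma>. dist (c s) (g x\<^sub>0) \<le> m + K"
    and ray_orbit: "\<And>\<xi> c t m. \<xi> \<in> \<Lambda> \<Longrightarrow> geodesic_ray_to x\<^sub>0 \<xi> c \<Longrightarrow> 0 \<le> t \<Longrightarrow> 0 \<le> m \<Longrightarrow>
      (\<And>p. p \<in> P \<Longrightarrow> dep p (c t) \<le> m) \<Longrightarrow> \<exists>g\<in>\<Gamma>. dist (c t) (g x\<^sub>0) \<le> m + K"

lemma (in cusped) cusp_const_exists: "\<exists>K. cusp_const x\<^sub>0 D \<Gamma> H K"
proof -
  obtain K1 where K1: "\<And>g p x. g \<in> \<Gamma> \<Longrightarrow> p \<in> P \<Longrightarrow> \<bar>dep (bdry_act g p) (g x) - dep p x\<bar> \<le> K1"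
    using depth_quasi_invariant by blast
  obtain K2 where K2: "\<And>g p. g \<in> \<Gamma> \<Longrightarrow> p \<in> P \<Longrightarrow> dep p (g x\<^sub>0) \<le> K2"
    using orbit_depth_bounded by blast
  obtain K3 where K3: "\<And>\<xi> \<eta> c s m. \<xi> \<in> \<Lambda> \<Longrightarrow> \<eta> \<in> \<Lambda> \<Longrightarrow> geodesic_line_between \<xi> \<eta> c \<Longrightarrow> 0 \<le> m \<Longrightarrow>
      (\<And>p. p \<in> P \<Longrightarrow> dep p (c s) \<le> m) \<Longrightarrow> \<exists>g\<in>\<Gamma>. dist (c s) (g x\<^sub>0) \<le> m + K3"
    using hull_near_orbit by blast
  obtain K4 where K4: "\<And>\<xi> c t m. \<xi> \<in> \<Lambda> \<Longrightarrow> geodesic_ray_to x\<^sub>0 \<xi> c \<Longrightarrow> 0 \<le> t \<Longrightarrow> 0 \<le> m \<Longrightarrow>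
      (\<And>p. p \<in> P \<Longrightarrow> dep p (c t) \<le> m) \<Longrightarrow> \<exists>g\<in>\<Gamma>. dist (c t) (g x\<^sub>0) \<le> m + K4"
    using ray_near_orbit by blast
  define K where "K = D + \<bar>K1\<bar> + \<bar>K2\<bar> + \<bar>K3\<bar> + \<bar>K4\<bar>"
  have le: "D \<le> K" "K1 \<le> K" "K2 \<le> K" "K3 \<le> K" "K4 \<le> K" using D_ge_1 by (auto simp: K_def)
  have "cusp_const x\<^sub>0 D \<Gamma> H K"
  proof
    show "D \<le> K" by (rule le)
    show "\<bar>dep (bdry_act g p) (g x) - dep p x\<bar> \<le> K" if "g \<in> \<Gamma>" "p \<in> P" for g p x
      using K1[OF that, of x] le by linarith
    show "dep p (g x\<^sub>0) \<le> K" if "g \<in> \<Gamma>" "p \<in> P" for g p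
      using K2[OF that] le by linarith
    show "\<exists>g\<in>\<Gamma>. dist (c s) (g x\<^sub>0) \<le> m + K" if "\<xi> \<in> \<Lambda>" "\<eta> \<in> \<Lambda>" "geodesic_line_between \<xi> \<eta> c" "0 \<le> m"
      "\<And>p. p \<in> P \<Longrightarrow> dep p (c s) \<le> m" for \<xi> \<eta> c s m
    proof -
      from K3[OF that] obtain g where "g \<in> \<Gamma>" "dist (c s) (g x\<^sub>0) \<le> m + K3" by blast
      then show ?thesis using le by (intro bexI[of _ g]) auto
    qed
    show "\<exists>g\<in>\<Gamma>. dist (c t) (g x\<^sub>0) \<le> m + K" if "\<xi> \<in> \<Lambda>" "geodesic_ray_to x\<^sub>0 \<xi> c" "0 \<le> t" "0 \<le> m"
      "\<And>p. p \<in> P \<Longrightarrow> dep p (c t) \<le> m" for \<xi> c t m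
    proof -
      from K4[OF that] obtain g where "g \<in> \<Gamma>" "dist (c t) (g x\<^sub>0) \<le> m + K4" by blast
      then show ?thesis using le by (intro bexI[of _ g]) auto
    qed
  qed
  then show ?thesis by blast
qed

context hyp_space
begin

text \<open>For \<open>p\<close> parabolic, translates of \<open>dom p c\<close> by the stabilizer of \<open>p\<close> will cover the limit
  set without \<open>p\<close>.\<close>

definition dom :: "'a bdry \<Rightarrow> real \<Rightarrow> 'a bdry set" where "dom p c = bdry - V p c"

lemma dom_iff: "\<eta> \<in> dom p c \<longleftrightarrow> \<eta> \<in> bdry \<and> \<not> ereal c \<le> bprod \<eta> p"
  unfolding dom_def by (auto simp: V_iff)

lemma dom_measurable: "p \<in> bdry \<Longrightarrow> dom p c \<in> sets (bdry_borel x\<^sub>0)"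
  unfolding dom_def using shadow_measurable sets.compl_sets[of "V p c" "bdry_borel x\<^sub>0"]
  by (simp add: space_bdry_borel)

text \<open>\<open>c t\<close> lies on the geodesic from the base point to \<open>c s\<close>. A
  point \<open>y\<close> in the direction of \<open>c s\<close>, seen from \<open>c t\<close>, is
  therefore opposite to the base point, and the base change formula adds the full length
  \<open>t\<close>.\<close>

lemma shadow_ray_step:
  assumes c: "geodesic_ray_to x\<^sub>0 \<xi> c" and t: "0 \<le> t" "t \<le> s"
    and y: "2 * D \<le> gromov_product (c t) y (c s)"
  shows "t + gromov_product (c t) y (c s) - D \<le> gp y (c s)"
proof -
  have d: "dist x\<^sub>0 (c t) = t" "dist (c t) (c s) = s - t" "dist x\<^sub>0 (c s) = s"
    using ray_dist[OF c] ray_dist2[OF c, of t s] t by auto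
  have "gromov_product (c t) x\<^sub>0 (c s) = 0" unfolding gromov_product_def using d by (simp add: dist_commute)
  moreover have "gromov_product (c t) x\<^sub>0 y \<le> D"
    using hyp[of "c t" x\<^sub>0 y "c s"] y D_ge_1 calculation by linarith
  ultimately show ?thesis using gp_base_formula[of x\<^sub>0 y "c s" "c t"] d by simp
qed

text \<open>This makes the conformal factor between \<open>x\<^sub>0\<close> and \<open>c t\<close>
  constant on the shadow: a point of the shadow has product about \<open>t\<close> with the ray,
  hence with \<open>c t\<close>, which is the largest possible value.\<close>

lemma shadow_busemann:
  assumes c: "geodesic_ray_to x\<^sub>0 \<xi> c" and t: "0 \<le> t" and \<xi>: "\<xi> \<in> bdry" and \<eta>: "\<eta> \<in> V \<xi> t"
  shows "\<bar>bus \<eta> (c t) + t\<bar> \<le> 6 * D"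
proof -
  have e: "\<eta> \<in> bdry" "ereal t \<le> bprod \<eta> \<xi>" using \<eta> by (auto simp: V_iff)
  obtain v where v: "v \<in> \<eta>" using bdry_nonempty[OF e(1)] .
  have w: "(\<lambda>n. c (real n)) \<in> \<xi>" using c unfolding geodesic_ray_to_def by blast
  have "\<forall>\<^sub>F n in sequentially. t - 3 * D \<le> pp (c t) \<eta>"
    using bprod_ge_ev[OF e(1) \<xi> e(2) v w] ray_gp_ev[OF c t] pp_approx[OF e(1) v, of "c t"]
  proof eventually_elim
    case (elim n)
    then show ?case using gp_hyp[of "c t" "c (real n)" "v n"] gp_commute[of x\<^sub>0 "v n"] D_ge_1 by auto
  qed
  then have "t - 3 * D \<le> pp (c t) \<eta>" by simp
  then show ?thesis using pp_bounds(2)[OF e(1), of "c t"] ray_dist[OF c t] D_ge_1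
    unfolding bus_pp by (simp add: abs_le_iff)
qed

end

context hyp_group
begin

text \<open>A shadow of bounded size, seen from an orbit point near \<open>c t\<close>, becomes part
  of the shadow seen from the base point. The margin \<open>6 * D\<close> covers the losses in
  \<open>bprod_ge_ev\<close>, \<open>shadow_ray_step\<close> and \<open>bprod_geI\<close>.\<close>

lemma shadow_translate_subset:
  assumes c: "geodesic_ray_to x\<^sub>0 \<xi> c" and t: "0 \<le> t" and \<xi>: "\<xi> \<in> bdry" and g: "g \<in> \<Gamma>"
    and m: "dist (c t) (g x\<^sub>0) \<le> m"
  shows "bdry_act g ` V (bdry_act (ginv g) \<xi>) (m + 6 * D) \<subseteq> V \<xi> t"
proof clarify
  fix \<eta> assume "\<eta> \<in> V (bdry_act (ginv g) \<xi>) (m + 6 * D)"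
  then have \<eta>: "\<eta> \<in> bdry" "ereal (m + 6 * D) \<le> bprod \<eta> (bdry_act (ginv g) \<xi>)" by (auto simp: V_iff)
  obtain v where v: "v \<in> \<eta>" using bdry_nonempty[OF \<eta>(1)] .
  have w: "(\<lambda>n. c (real n)) \<in> \<xi>" using c unfolding geodesic_ray_to_def by blast
  have w': "ginv g \<circ> (\<lambda>n. c (real n)) \<in> bdry_act (ginv g) \<xi>" by (rule act_mem[OF w])
  obtain N :: nat where N: "t \<le> real N" using real_arch_simple by blast
  have "\<forall>\<^sub>F n in sequentially. t + 2 * D \<le> gp ((g \<circ> v) n) (c (real n))"
    using bprod_ge_ev[OF \<eta>(1) act_bdry[OF inv_G[OF g] \<xi>] \<eta>(2) v w'] eventually_ge_at_top[of N]
  proof eventually_elim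
    case (elim n)
    have "gromov_product (g x\<^sub>0) (g (v n)) (c (real n)) = gp (v n) (ginv g (c (real n)))"
      using gromov_product_G[OF g, of x\<^sub>0 "v n" "ginv g (c (real n))"] by (simp add: inv_cancel[OF g])
    then have "m + 6 * D - 1 \<le> gromov_product (g x\<^sub>0) (g (v n)) (c (real n))" using elim by simp
    then have "6 * D - 1 \<le> gromov_product (c t) (g (v n)) (c (real n))"
      using gp_change_base[of "g x\<^sub>0" "g (v n)" "c (real n)" "c t"] m by (simp add: dist_commute)
    then show ?case using shadow_ray_step[OF c t, of "real n" "g (v n)"] elim N D_ge_1 by simp
  qed
  then have "ereal t \<le> bprod (bdry_act g \<eta>) \<xi>"
    using bprod_geI[OF act_bdry[OF g \<eta>(1)] \<xi> act_mem[OF v] w] eventually_frequently[OF sequentially_bot] by blast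
  then show "bdry_act g \<eta> \<in> V \<xi> t" using act_bdry[OF g \<eta>(1)] by (simp add: V_iff)
qed

end

section \<open>Parabolic points near the base point and their fundamental sets\<close>

context cusp_const
begin

lemma K_ge_1: "1 \<le> K" using D_ge_1 D_le_K by linarith

text \<open>The finitely many parabolic points to which the others are moved. The threshold is the
  one of \<open>anchor_P0\<close>: \<open>2 * K\<close> for the distance between horoball and orbit
  point, \<open>K\<close> for quasi-invariance.\<close>

definition P0 :: "'a bdry set" where "P0 = {p \<in> P. - (3 * K) \<le> dep p x\<^sub>0}"

lemma finite_P0: "finite P0" unfolding P0_def by (rule finite_depth_ge)

lemma P0_D:
  assumes "p \<in> P0" shows "p \<in> P" "p \<in> bdry" "- (3 * K) \<le> dep p x\<^sub>0" "dep p x\<^sub>0 \<le> K" "dep p x\<^sub>0 = lr p"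
  using assms orbit_dep[OF id_G, of p] P_bdry bus_base[of p] unfolding P0_def dep_def by auto

lemma anchor_P0:
  assumes h: "h \<in> \<Gamma>" and p: "p \<in> P" and y: "0 \<le> dep p y" "dist y (h x\<^sub>0) \<le> 2 * K"
  shows "bdry_act (ginv h) p \<in> P0"
proof -
  have "- (2 * K) \<le> dep p (h x\<^sub>0)" using dep_lip[OF p, of y "h x\<^sub>0"] y by linarith
  moreover have "\<bar>dep (bdry_act (ginv h) p) (ginv h (h x\<^sub>0)) - dep p (h x\<^sub>0)\<bar> \<le> K"
    by (rule quasi_inv[OF inv_G[OF h] p])
  ultimately show ?thesis using act_P[OF inv_G[OF h] p] by (simp add: P0_def inv_cancel[OF h])
qed

text \<open>The line from \<open>p\<close> to \<open>\<eta>\<close> crosses the horosphere at a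
  point near some \<open>h x\<^sub>0\<close>. Pulling back by \<open>h\<close> moves
  \<open>p\<close> within the finite set \<open>P0\<close>, and a fixed element returns it to
  \<open>p\<close>; this corrects \<open>h\<close> to an element \<open>g\<close> of the stabilizer
  at bounded distance. Seen from \<open>g x\<^sub>0\<close>, which is near the line, the two ends
  have bounded product.\<close>

lemma dom_translates_cover:
  obtains c where "0 \<le> c" "\<And>p \<eta>. p \<in> P0 \<Longrightarrow> \<eta> \<in> \<Lambda> \<Longrightarrow> \<eta> \<noteq> p \<Longrightarrow> \<exists>g\<in>stab p. \<eta> \<in> bdry_act g ` dom p c"
proof -
  \<comment> \<open>One connecting element for each pair of equivalent points of \<open>P0\<close>;
    by finiteness their displacements have a common bound \<open>M\<close>.\<close>
  have "\<exists>f. \<forall>a\<in>P0\<times>P0. (\<exists>w\<in>\<Gamma>. bdry_act w (fst a) = snd a) \<longrightarrow> f a \<in> \<Gamma> \<and> bdry_act (f a) (fst a) = snd a"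
    by (rule bchoice) blast
  then obtain f where f: "\<And>p q w. p \<in> P0 \<Longrightarrow> q \<in> P0 \<Longrightarrow> w \<in> \<Gamma> \<Longrightarrow> bdry_act w p = q \<Longrightarrow>
      f (p, q) \<in> \<Gamma> \<and> bdry_act (f (p, q)) p = q" by fastforce
  have "bdd_above ((\<lambda>a. dist x\<^sub>0 (f a x\<^sub>0)) ` (P0 \<times> P0))" using finite_P0 by (intro bdd_above_finite) simp
  then obtain M where M: "\<And>p q. p \<in> P0 \<Longrightarrow> q \<in> P0 \<Longrightarrow> dist x\<^sub>0 (f (p, q) x\<^sub>0) \<le> M"
    unfolding bdd_above_def by auto
  \<comment> \<open>\<open>\<bar>M\<bar> + K\<close> bounds the distance from
    \<open>g x\<^sub>0\<close> to the line; of the additional \<open>2\<close>, one unit goes to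
    \<open>bprod_ge_ev\<close>, the other makes the contradiction strict.\<close>
  show ?thesis
  proof (rule that[of "\<bar>M\<bar> + K + 2"])
    show "0 \<le> \<bar>M\<bar> + K + 2" using K_ge_1 by linarith
    fix p \<eta> assume p: "p \<in> P0" and \<eta>: "\<eta> \<in> \<Lambda>" "\<eta> \<noteq> p"
    note pP = P0_D(1,2)[OF p]
    obtain l where l: "geodesic_line_between p \<eta> l"
      using exists_geodesic_line[OF pP(2) limit_bdry[OF \<eta>(1)]] \<eta>(2) by blast
    obtain s where s: "dep p (l s) = 0" using line_meets_horosphere[OF pP(1) l] .
    have "dep q (l s) \<le> 0" if "q \<in> P" for q
      using dep_disjoint[OF pP(1) that, of "l s"] s by (cases "0 \<le> dep q (l s)") auto
    then obtain h where h: "h \<in> \<Gamma>" "dist (l s) (h x\<^sub>0) \<le> 0 + K"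
      using hull_orbit[OF P_limit[OF pP(1)] \<eta>(1) l order_refl] by blast
    define q where "q = bdry_act (ginv h) p"
    have q: "q \<in> P0" "bdry_act h q = p" unfolding q_def
      using anchor_P0[OF h(1) pP(1), of "l s"] s h K_ge_1 by (auto simp: act_inv)
    define w where "w = f (q, p)"
    have w: "w \<in> \<Gamma>" "bdry_act w q = p" using f[OF q(1) p h(1) q(2)] by (auto simp: w_def)
    define g where "g = h \<circ> ginv w"
    have "bdry_act (ginv w) p = q" using act_inv(1)[OF w(1), of q] w(2) by simp
    then have g: "g \<in> stab p" unfolding g_def using h(1) w(1) q(2)
      by (intro stabI) (auto simp: comp_G inv_G act_comp)
    have gG: "g \<in> \<Gamma>" by (rule stabD(1)[OF g])
    have "dist (g x\<^sub>0) (h x\<^sub>0) = dist x\<^sub>0 (w x\<^sub>0)"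
      unfolding g_def using dist_G[OF h(1), of "ginv w x\<^sub>0" x\<^sub>0] dist_inv[OF w(1), of x\<^sub>0 x\<^sub>0] by simp
    then have dg: "dist (g x\<^sub>0) (l s) \<le> \<bar>M\<bar> + K"
      using M[OF q(1) p] h(2) dist_triangle[of "g x\<^sub>0" "l s" "h x\<^sub>0"] by (simp add: w_def dist_commute)
    let ?\<zeta> = "bdry_act (ginv g) \<eta>"
    have \<zeta>: "?\<zeta> \<in> bdry" by (rule act_bdry[OF inv_G[OF gG] limit_bdry[OF \<eta>(1)]])
    have gp: "bdry_act (ginv g) p = p" using act_inv(1)[OF gG, of p] stabD(2)[OF g] by simp
    have lg: "geodesic_on UNIV l" "(\<lambda>n. l (- real n)) \<in> p" "(\<lambda>n. l (real n)) \<in> \<eta>"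
      using l unfolding geodesic_line_between_def by auto
    have m1: "ginv g \<circ> (\<lambda>n. l (real n)) \<in> ?\<zeta>" "ginv g \<circ> (\<lambda>n. l (- real n)) \<in> p"
      using act_mem[OF lg(3)] act_mem[OF lg(2), of "ginv g"] gp by auto
    have "?\<zeta> \<in> dom p (\<bar>M\<bar> + K + 2)"
    proof (rule ccontr)
      assume "?\<zeta> \<notin> dom p (\<bar>M\<bar> + K + 2)"
      then have "ereal (\<bar>M\<bar> + K + 2) \<le> bprod ?\<zeta> p" using \<zeta> by (simp add: dom_iff)
      note ev = bprod_ge_ev[OF \<zeta> pP(2) this m1]
      obtain N :: nat where N: "\<bar>s\<bar> \<le> real N" using real_arch_simple by blast
      have "\<forall>\<^sub>F n in sequentially. False"
        using ev eventually_ge_at_top[of N]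
      proof eventually_elim
        case (elim n)
        have "gp (ginv g (l (real n))) (ginv g (l (- real n))) = gromov_product (g x\<^sub>0) (l (real n)) (l (- real n))"
          using gromov_product_G[OF gG, of x\<^sub>0 "ginv g (l (real n))" "ginv g (l (- real n))"]
          by (simp add: inv_cancel[OF gG])
        also have "\<dots> \<le> gromov_product (l s) (l (real n)) (l (- real n)) + (\<bar>M\<bar> + K)"
          using gp_change_base[of "g x\<^sub>0" "l (real n)" "l (- real n)" "l s"] dg by linarith
        also have "gromov_product (l s) (l (real n)) (l (- real n)) = 0"
          using geodesic_onD[OF lg(1)] N elim by (simp add: gromov_product_def)
        finally show ?case using elim by simp
      qed
      then show False by simp
    qed
    then show "\<exists>g\<in>stab p. \<eta> \<in> bdry_act g ` dom p (\<bar>M\<bar> + K + 2)"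
      using g act_inv(2)[OF gG, of \<eta>] by (intro bexI[of _ g]) (auto intro!: image_eqI[of _ _ ?\<zeta>])
  qed
qed

section \<open>Stabilizer orbits and translated fundamental sets\<close>

abbreviation nm :: "('a \<Rightarrow> 'a) \<Rightarrow> real" where "nm g \<equiv> dist x\<^sub>0 (g x\<^sub>0)"

lemma stab_dep:
  assumes "p \<in> P0" "g \<in> stab p" shows "\<bar>dep p (g x) - dep p x\<bar> \<le> K"
  using quasi_inv[OF stabD(1)[OF assms(2)] P0_D(1)[OF assms(1)], of x] stabD(2)[OF assms(2)] by simp

lemma stab_ginv: "g \<in> stab p \<Longrightarrow> ginv g \<in> stab p"
  by (rule subgroup_BijGroup_UNIV(4)[OF subgroup_stab])

lemma stab_comp: "g \<in> stab p \<Longrightarrow> h \<in> stab p \<Longrightarrow> g \<circ> h \<in> stab p"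
  by (rule subgroup_BijGroup_UNIV(3)[OF subgroup_stab])

text \<open>The stabilizer keeps the orbit on one horosphere up to \<open>K\<close>, so a geodesic
  from the base point to \<open>g x\<^sub>0\<close> heads for \<open>p\<close> during half of its
  length.\<close>

lemma stab_pp:
  assumes "p \<in> P0" "g \<in> stab p" shows "\<bar>pp (g x\<^sub>0) p - nm g / 2\<bar> \<le> K / 2"
  using stab_dep[OF assms, of x\<^sub>0] bus_base[OF P0_D(2)[OF assms(1)]]
  unfolding pp_def dep_def by (simp add: abs_le_iff field_simps)

text \<open>Seen from \<open>g x\<^sub>0\<close>, the points of the translate and \<open>p\<close>
  have small product, while \<open>g x\<^sub>0\<close> itself has product about
  \<open>nm g / 2\<close> with \<open>p\<close>. So the translates are sorted by
  \<open>nm g\<close>: a shadow at \<open>p\<close> contains the far ones and misses the near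
  ones.\<close>

lemma dom_translate_bprod:
  assumes p: "p \<in> P0" and g: "g \<in> stab p" and c: "0 \<le> c" and \<eta>: "\<eta> \<in> bdry_act g ` dom p c"
  shows "ereal (nm g / 2 - (c + 12 * K)) \<le> bprod \<eta> p" "\<not> ereal (nm g / 2 + (c + 12 * K)) \<le> bprod \<eta> p"
    "\<eta> \<in> bdry"
proof -
  have gG: "g \<in> \<Gamma>" by (rule stabD(1)[OF g])
  note pb = P0_D(2)[OF p]
  obtain \<zeta> where \<zeta>: "\<zeta> \<in> bdry" "\<not> ereal c \<le> bprod \<zeta> p" "\<eta> = bdry_act g \<zeta>" using \<eta> by (auto simp: dom_iff)
  show e: "\<eta> \<in> bdry" using act_bdry[OF gG] \<zeta> by blast
  obtain v where v: "v \<in> \<zeta>" using bdry_nonempty[OF \<zeta>(1)] .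
  obtain u where u: "u \<in> p" using bdry_nonempty[OF pb] .
  have m: "g \<circ> v \<in> \<eta>" "g \<circ> u \<in> p" using act_mem[OF v] act_mem[OF u, of g] \<zeta>(3) stabD(2)[OF g] by auto
  have main: "\<forall>\<^sub>F n in sequentially. nm g / 2 - (c + 10 * K) + 2 * D \<le> gp ((g \<circ> v) n) ((g \<circ> u) n) \<and>
      gp ((g \<circ> v) n) ((g \<circ> u) n) \<le> nm g / 2 + (c + 10 * K)"
    using bprod_less_ev[OF \<zeta>(1) pb \<zeta>(2) v u] pp_approx[OF pb m(2), of "g x\<^sub>0"]
  proof eventually_elim
    case (elim n)
    define y z where "y = (g \<circ> v) n" and "z = (g \<circ> u) n"
    have yz: "gromov_product (g x\<^sub>0) y z \<le> c + 2 * D" "0 \<le> gromov_product (g x\<^sub>0) y z"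
      using elim gromov_product_G[OF gG] gp_nonneg by (auto simp: y_def z_def)
    have zg: "\<bar>gp z (g x\<^sub>0) - nm g / 2\<bar> \<le> K / 2 + D"
      using elim stab_pp[OF p g] gp_commute[of x\<^sub>0 z "g x\<^sub>0"] unfolding z_def by linarith
    have "gp y z = gromov_product (g x\<^sub>0) y z + nm g - gromov_product (g x\<^sub>0) x\<^sub>0 y - gromov_product (g x\<^sub>0) x\<^sub>0 z"
      by (rule gp_base_formula)
    then have f: "gp y z = gromov_product (g x\<^sub>0) y z - nm g + gp y (g x\<^sub>0) + gp z (g x\<^sub>0)"
      unfolding gromov_product_def by (simp add: dist_commute field_simps)
    have lo: "nm g / 2 - c - 3 * D - K / 2 \<le> gp y (g x\<^sub>0)"
      using f gp_nonneg[of x\<^sub>0 y z] yz zg by linarith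
    then have l: "nm g / 2 - c - 4 * D - K / 2 \<le> gp y z"
      using gp_hyp[of y "g x\<^sub>0" z] gp_commute[of x\<^sub>0 z "g x\<^sub>0"] zg c D_ge_1 by linarith
    \<comment> \<open>\<open>z\<close> and \<open>g x\<^sub>0\<close> have product about
      \<open>nm g / 2\<close>, so \<open>y\<close> cannot have a much larger product with both of
      them; if the one with \<open>g x\<^sub>0\<close> is bounded, \<open>f\<close> bounds
      \<open>gp y z\<close> independently of \<open>g\<close>.\<close>
    have "gp y z \<le> nm g / 2 + K / 2 + 2 * D \<or> gp y (g x\<^sub>0) \<le> nm g / 2 + K / 2 + 2 * D"
      using gp_hyp[of z y "g x\<^sub>0"] gp_commute[of x\<^sub>0 z y] zg by linarith
    then have h: "gp y z \<le> nm g / 2 + c + K + 5 * D"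
    proof
      assume "gp y (g x\<^sub>0) \<le> nm g / 2 + K / 2 + 2 * D"
      then have "gp y z \<le> c + 5 * D + K" using f yz zg by linarith
      then show ?thesis using zero_le_dist[of x\<^sub>0 "g x\<^sub>0"] by linarith
    qed (use c D_ge_1 D_le_K in linarith)
    show ?case using l h D_le_K K_ge_1 unfolding y_def[symmetric] z_def[symmetric] by linarith
  qed
  have "\<exists>\<^sub>F n in sequentially. nm g / 2 - (c + 12 * K) + 2 * D \<le> gp ((g \<circ> v) n) ((g \<circ> u) n)"
    using K_ge_1 by (intro eventually_frequently[OF sequentially_bot] eventually_mono[OF main]) linarith
  then show "ereal (nm g / 2 - (c + 12 * K)) \<le> bprod \<eta> p" by (rule bprod_geI[OF e pb m])
  show "\<not> ereal (nm g / 2 + (c + 12 * K)) \<le> bprod \<eta> p"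
  proof
    assume "ereal (nm g / 2 + (c + 12 * K)) \<le> bprod \<eta> p"
    from bprod_ge_ev[OF e pb this m] main have "\<forall>\<^sub>F n in sequentially. False"
      by eventually_elim (use K_ge_1 in linarith)
    then show False by simp
  qed
qed

text \<open>For \<open>k = ginv g \<circ> h\<close> the set \<open>dom p c\<close> meets its
  translate by \<open>k\<close>; a common point has product below \<open>c\<close> with
  \<open>p\<close>, but also at least \<open>nm k / 2 - (c + 12 * K)\<close>.\<close>

lemma dom_translates_meet:
  assumes p: "p \<in> P0" and g: "g \<in> stab p" "h \<in> stab p" and c: "0 \<le> c"
    and meet: "\<eta> \<in> bdry_act g ` dom p c" "\<eta> \<in> bdry_act h ` dom p c"
  shows "dist (g x\<^sub>0) (h x\<^sub>0) \<le> 4 * c + 24 * K"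
proof -
  have gG: "g \<in> \<Gamma>" by (rule stabD(1)[OF g(1)])
  obtain \<zeta> where \<zeta>: "\<zeta> \<in> dom p c" "\<eta> = bdry_act g \<zeta>" using meet(1) by blast
  define k where "k = ginv g \<circ> h"
  have k: "k \<in> stab p" unfolding k_def by (rule stab_comp[OF stab_ginv[OF g(1)] g(2)])
  obtain \<omega> where "\<omega> \<in> dom p c" "\<eta> = bdry_act h \<omega>" using meet(2) by blast
  then have "\<zeta> \<in> bdry_act k ` dom p c"
    unfolding k_def using act_inv(1)[OF gG, of \<zeta>] \<zeta>(2) by (auto simp: act_comp)
  from dom_translate_bprod(1)[OF p k c this] have "ereal (nm k / 2 - (c + 12 * K)) \<le> bprod \<zeta> p" .
  then have "\<not> c \<le> nm k / 2 - (c + 12 * K)"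
    using \<zeta>(1) unfolding dom_iff by (meson ereal_less_eq(3) order_trans)
  moreover have "nm k = dist (g x\<^sub>0) (h x\<^sub>0)" unfolding k_def using dist_inv[OF gG, of "h x\<^sub>0" x\<^sub>0]
    by (simp add: dist_commute)
  ultimately show ?thesis by simp
qed

text \<open>\<open>x\<close> lies above the base point on the way to \<open>p\<close>. The lower
  bounds are the Lipschitz property of depth and the triangle inequality. The upper bound compares
  \<open>x\<close> and \<open>g x\<^sub>0\<close> through \<open>p\<close>: their product is at
  least about the smaller of \<open>d\<close> and \<open>nm g / 2\<close>.\<close>

lemma stab_dist_high:
  assumes p: "p \<in> P0" and g: "g \<in> stab p" and d: "0 \<le> d" and a: "0 \<le> a"
    and x: "dist x\<^sub>0 x \<le> d + a" "d - a \<le> dep p x"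
  shows "\<bar>dist x (g x\<^sub>0) - max d (nm g - d)\<bar> \<le> 3 * a + 10 * K"
proof -
  note pP = P0_D[OF p]
  have dg: "dep p (g x\<^sub>0) \<le> K" by (rule orbit_dep[OF stabD(1)[OF g] pP(1)])
  have 1: "d - a - K \<le> dist x (g x\<^sub>0)" using dep_lip[OF pP(1), of x "g x\<^sub>0"] dg x by linarith
  have 2: "nm g - d - a \<le> dist x (g x\<^sub>0)" using dist_triangle[of x\<^sub>0 "g x\<^sub>0" x] x by linarith
  have 3: "d - a - K \<le> dist x\<^sub>0 x" using dep_lip[OF pP(1), of x x\<^sub>0] pP x by (simp add: dist_commute)
  have ppx: "d - a - K \<le> pp x p"
    using 3 x pP unfolding pp_def dep_def by (simp add: field_simps)
  obtain u where u: "u \<in> p" using bdry_nonempty[OF pP(2)] .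
  have "\<forall>\<^sub>F n in sequentially. dist x (g x\<^sub>0) \<le> max d (nm g - d) + (3 * a + 10 * K)"
    using pp_approx[OF pP(2) u, of x] pp_approx[OF pP(2) u, of "g x\<^sub>0"]
  proof eventually_elim
    case (elim n)
    have "d - a - K - D \<le> gp x (u n)" "nm g / 2 - K / 2 - D \<le> gp (u n) (g x\<^sub>0)"
      using elim ppx stab_pp[OF p g] gp_commute[of x\<^sub>0 "u n" "g x\<^sub>0"] by linarith+
    then have "min d (nm g / 2) - a - K - 2 * D \<le> gp x (g x\<^sub>0)"
      using gp_hyp[of x "u n" "g x\<^sub>0"] a K_ge_1 by linarith
    moreover define mm where "mm = min d (nm g / 2)"
    ultimately have "mm - a - K - 2 * D \<le> (dist x\<^sub>0 x + nm g - dist x (g x\<^sub>0)) / 2"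
      unfolding gromov_product_def by simp
    then have "2 * mm - 2 * (a + K + 2 * D) \<le> dist x\<^sub>0 x + nm g - dist x (g x\<^sub>0)"
      by (simp add: field_simps)
    moreover define M where "M = max d (nm g - d)"
    moreover have "d + nm g - 2 * mm = M" by (simp add: M_def mm_def min_def max_def)
    ultimately have "dist x (g x\<^sub>0) \<le> M + (3 * a + 10 * K)" using x(1) D_le_K K_ge_1 by argo
    then show ?case by (simp add: M_def)
  qed
  then have "dist x (g x\<^sub>0) \<le> max d (nm g - d) + (3 * a + 10 * K)" by simp
  then show ?thesis using 1 2 a K_ge_1 by (simp add: abs_le_iff)
qed

text \<open>A fundamental set lies away from \<open>p\<close>, while \<open>ginv g x\<close> lies in
  the direction of \<open>p\<close>; hence it has bounded product with \<open>\<zeta>\<close>, and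
  its Busemann function is its distance to the base point up to a constant.\<close>

lemma dom_busemann_high:
  assumes p: "p \<in> P0" and g: "g \<in> stab p" and d: "0 \<le> d" and a: "0 \<le> a" and c: "0 \<le> c"
    and x: "dist x\<^sub>0 x \<le> d + a" "d - a \<le> dep p x" and \<zeta>: "\<zeta> \<in> dom p c"
  shows "\<bar>bus \<zeta> (ginv g x) - max d (nm g - d)\<bar> \<le> 5 * a + 4 * c + 40 * K"
proof -
  note pP = P0_D[OF p]
  have z: "\<zeta> \<in> bdry" "\<not> ereal c \<le> bprod \<zeta> p" using \<zeta> by (auto simp: dom_iff)
  let ?w = "ginv g x"
  have w: "dist x\<^sub>0 ?w = dist x (g x\<^sub>0)"
    using dist_inv[OF stabD(1)[OF g], of x x\<^sub>0] by (simp add: dist_commute)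
  have "d - a - K \<le> dep p ?w" using stab_dep[OF p stab_ginv[OF g], of x] x by linarith
  then have ppw: "(dist x\<^sub>0 ?w + d - a - 2 * K) / 2 \<le> pp ?w p"
    using pP unfolding pp_def dep_def by simp
  obtain u where u: "u \<in> p" using bdry_nonempty[OF pP(2)] .
  obtain v where v: "v \<in> \<zeta>" using bdry_nonempty[OF z(1)] .
  have "\<forall>\<^sub>F n in sequentially. pp ?w \<zeta> \<le> 2 * c + a + 12 * K"
    using bprod_less_ev[OF z(1) pP(2) z(2) v u] pp_approx[OF pP(2) u, of ?w] pp_approx[OF z(1) v, of ?w]
  proof eventually_elim
    case (elim n)
    have "gp (v n) ?w \<le> c + 3 * D \<or> gp ?w (u n) \<le> c + 3 * D"
      using gp_hyp[of "v n" ?w "u n"] elim by linarith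
    then have "gp ?w (v n) \<le> 2 * c + a + 8 * D + 2 * K"
    proof
      \<comment> \<open>If \<open>?w\<close> is not in the direction of \<open>p\<close>, its depth
        forces it to be near the base point, and its product with any point is small.\<close>
      assume "gp ?w (u n) \<le> c + 3 * D"
      then have "(dist x\<^sub>0 ?w + d - a - 2 * K) / 2 \<le> c + 4 * D" using ppw elim by linarith
      then have "dist x\<^sub>0 ?w \<le> 2 * c + 8 * D + a + 2 * K" using d by simp
      then show ?thesis using gp_le_dist(1)[of x\<^sub>0 ?w "v n"] by linarith
    qed (use a c D_ge_1 K_ge_1 gp_commute[of x\<^sub>0 "v n" ?w] in linarith)
    then show ?case using elim D_le_K K_ge_1 by linarith
  qed
  then have "pp ?w \<zeta> \<le> 2 * c + a + 12 * K" by simp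
  moreover have "- D \<le> pp ?w \<zeta>" by (rule pp_bounds(1)[OF z(1)])
  ultimately show ?thesis
    using stab_dist_high[OF p g d a x] w a c D_le_K K_ge_1 unfolding bus_pp by (simp add: abs_le_iff)
qed

section \<open>Moving a deep ray point to a standard position\<close>

lemma ray_dep_continuous:
  assumes "p \<in> P" "geodesic_ray_to x\<^sub>0 \<xi> c" "0 \<le> s"
  shows "continuous_on {s..t} (\<lambda>s. dep p (c s))"
proof -
  have "continuous_on {s..t} c"
    unfolding continuous_on_iff
  proof (intro ballI allI impI)
    fix r e :: real assume r: "r \<in> {s..t}" "0 < e"
    show "\<exists>d>0. \<forall>x'\<in>{s..t}. dist x' r < d \<longrightarrow> dist (c x') (c r) < e"
      using r assms(3) ray_dist2[OF assms(2)] by (intro exI[of _ e]) (auto simp: dist_real_def)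
  qed
  then show ?thesis using continuous_on_compose[OF _ continuous_dep[OF assms(1)]] by (simp add: o_def)
qed

text \<open>The orbit point \<open>h x\<^sub>0\<close> is found where the ray enters the horoball if it has not yet turned
  away from \<open>p\<close> at time \<open>t\<close>, and where it leaves the horoball otherwise.\<close>

lemma anchor:
  assumes \<xi>: "\<xi> \<in> \<Lambda>" and c: "geodesic_ray_to x\<^sub>0 \<xi> c" and t: "0 \<le> t" and p: "p \<in> P"
    and dp: "0 \<le> dep p (c t)"
  obtains h where "h \<in> \<Gamma>" "bdry_act (ginv h) p \<in> P0"
    "dist (c t) (h x\<^sub>0) \<le> dep p (c t) + 25 * K"
    "dep p (c t) - K \<le> dep (bdry_act (ginv h) p) (ginv h (c t))"
    "bdry_act h ` V (bdry_act (ginv h) p) (dep p (c t) + 40 * K) \<subseteq> V \<xi> t \<or>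
     bdry_act h ` dom (bdry_act (ginv h) p) (dep p (c t) - 40 * K) \<subseteq> V \<xi> t"
proof -
  note \<xi>b = limit_bdry[OF \<xi>] and pb = P_bdry[OF p]
  define f where "f s = dep p (c s)" for s
  have w: "(\<lambda>n. c (real n)) \<in> \<xi>" using c unfolding geodesic_ray_to_def by blast
  have fpp: "f s = lr p - s + 2 * pp (c s) p" if "0 \<le> s" for s
    using ray_dist[OF c that] by (simp add: f_def dep_def bus_pp)
  have near: "dep q (c s) \<le> m" if "0 \<le> f s" "f s \<le> m" "q \<in> P" for s q m
    using dep_disjoint[OF p that(3), of "c s"] that by (cases "0 \<le> dep q (c s)") (auto simp: f_def)
  have dep': "dep p (c t) - K \<le> dep (bdry_act (ginv h) p) (ginv h (c t))" if "h \<in> \<Gamma>" for h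
    using quasi_inv[OF inv_G[OF that] p, of "c t"] by linarith
  obtain u0 where u0: "u0 \<in> p" using bdry_nonempty[OF pb] .
  \<comment> \<open>The product of \<open>\<xi>\<close> and \<open>p\<close> is the time at which
    the ray turns away from \<open>p\<close>. Of the margin in the case distinction,
    \<open>1\<close> goes to \<open>bprod_ge_ev\<close>, \<open>D\<close> to hyperbolicity and
    \<open>2 * D\<close> to \<open>bprod_geI\<close>.\<close>
  show ?thesis
  proof (cases "ereal (t + (3 * D + 1)) \<le> bprod \<xi> p")
    case True
    have pps: "s - 2 * D \<le> pp (c s) p" if s: "0 \<le> s" "s \<le> t" for s
    proof -
      have "\<forall>\<^sub>F n in sequentially. s - 2 * D \<le> pp (c s) p"
        using bprod_ge_ev[OF \<xi>b pb True w u0] ray_gp_ev[OF c s(1)] pp_approx[OF pb u0, of "c s"]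
      proof eventually_elim
        case (elim n)
        then show ?case using gp_hyp[of "c s" "c (real n)" "u0 n"] s D_ge_1 by linarith
      qed
      then show ?thesis by simp
    qed
    have f0: "f 0 \<le> K" using orbit_dep[OF id_G p] c by (simp add: f_def geodesic_ray_to_def)
    \<comment> \<open>The entry time: if the base point is itself in the horoball, its depth is at
      most \<open>K\<close> and time 0 serves; otherwise the depth crosses 0 before
      \<open>t\<close>.\<close>
    have "\<exists>s. 0 \<le> s \<and> s \<le> t \<and> 0 \<le> f s \<and> f s \<le> K"
    proof (cases "0 \<le> f 0")
      case True
      then show ?thesis using f0 t by blast
    next
      case False
      then have "\<exists>s\<ge>0. s \<le> t \<and> f s = 0"
        using IVT'[of f 0 0 t] dp t ray_dep_continuous[OF p c order_refl, of t] by (auto simp: f_def)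
      then show ?thesis using K_ge_1 by force
    qed
    then obtain s where s: "0 \<le> s" "s \<le> t" "0 \<le> f s" "f s \<le> K" by blast
    obtain h where h: "h \<in> \<Gamma>" "dist (c s) (h x\<^sub>0) \<le> K + K"
      using ray_orbit[OF \<xi> c s(1), of K] near[OF s(3,4)] K_ge_1 by auto
    define q where "q = bdry_act (ginv h) p"
    have hq: "bdry_act h q = p" by (simp add: q_def act_inv[OF h(1)])
    have qP: "q \<in> P0" unfolding q_def using anchor_P0[OF h(1) p, of "c s"] s h by (simp add: f_def)
    note qb = P0_D(2)[OF qP]
    \<comment> \<open>Until \<open>t\<close> the ray climbs towards \<open>p\<close> at unit speed,
      so the time since entry is, up to \<open>6 * D\<close>, at most the depth gained.\<close>
    have rise: "t - s - 6 * D \<le> f t - f s"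
      using fpp[OF s(1)] fpp[OF t] pps[OF t order_refl] pp_bounds(2)[OF pb, of "c s"] ray_dist[OF c s(1)] by simp
    have "dist (c t) (h x\<^sub>0) \<le> (t - s) + 2 * K"
      using dist_triangle[of "c t" "h x\<^sub>0" "c s"] h(2) ray_dist2[OF c t s(1)] s by simp
    then have dist: "dist (c t) (h x\<^sub>0) \<le> dep p (c t) + 25 * K"
      using rise s D_le_K K_ge_1 by (simp add: f_def)
    have "bdry_act h ` V q (dep p (c t) + 40 * K) \<subseteq> V \<xi> t"
    proof clarify
      fix \<eta> assume "\<eta> \<in> V q (dep p (c t) + 40 * K)"
      then have \<eta>: "\<eta> \<in> bdry" "ereal (f t + 40 * K) \<le> bprod \<eta> q" by (auto simp: V_iff f_def)
      obtain v where v: "v \<in> \<eta>" using bdry_nonempty[OF \<eta>(1)] .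
      obtain u where u: "u \<in> q" using bdry_nonempty[OF qb] .
      have m: "h \<circ> v \<in> bdry_act h \<eta>" "h \<circ> u \<in> p" using act_mem[OF v] act_mem[OF u, of h] hq by auto
      have "\<forall>\<^sub>F n in sequentially. t + 2 * D \<le> gp ((h \<circ> v) n) (c (real n))"
        using bprod_ge_ev[OF \<eta>(1) qb \<eta>(2) v u] bprod_ge_ev[OF \<xi>b pb True w m(2)]
          pp_approx[OF pb m(2), of "c s"]
      proof eventually_elim
        case (elim n)
        define y z where "y = (h \<circ> v) n" and "z = (h \<circ> u) n"
        have "f t + 40 * K - 1 \<le> gromov_product (h x\<^sub>0) y z"
          using elim gromov_product_G[OF h(1)] by (simp add: y_def z_def)
        then have yz: "f t + 38 * K - 1 \<le> gromov_product (c s) y z"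
          using gp_change_base[of "h x\<^sub>0" y z "c s"] h(2) by (simp add: dist_commute)
        \<comment> \<open>\<open>c s\<close> is nearly on the way from the base point to
          \<open>p\<close>, so from \<open>c s\<close> the base point is opposite to
          \<open>z\<close>, hence to \<open>y\<close>. The base change then adds the length
          \<open>s\<close>, and \<open>rise\<close> turns the depth into the remaining time
          \<open>t - s\<close>.\<close>
        have "gromov_product (c s) x\<^sub>0 z = s - gp (c s) z"
          unfolding gromov_product_def using ray_dist[OF c s(1)] by (simp add: dist_commute field_simps)
        then have oz: "gromov_product (c s) x\<^sub>0 z \<le> 3 * D" using elim pps[OF s(1,2)] by (simp add: z_def)
        have "0 \<le> f t" using dp by (simp add: f_def)
        then have oy: "gromov_product (c s) x\<^sub>0 y \<le> 4 * D"
          using hyp[of "c s" x\<^sub>0 y z] yz oz D_le_K K_ge_1 by linarith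
        have "f t + 38 * K - 1 + s - 7 * D \<le> gp y z"
          using gp_base_formula[of x\<^sub>0 y z "c s"] yz oz oy ray_dist[OF c s(1)] by simp
        then have "t + 3 * D \<le> gp y z" using rise s D_le_K K_ge_1 by linarith
        moreover have "t + 3 * D \<le> gp (c (real n)) z" using elim by (simp add: z_def)
        ultimately have "t + 2 * D \<le> gp y (c (real n))"
          using gp_hyp[of y z "c (real n)"] gp_commute[of x\<^sub>0 z "c (real n)"] by linarith
        then show ?case by (simp add: y_def)
      qed
      then have "ereal t \<le> bprod (bdry_act h \<eta>) \<xi>"
        using bprod_geI[OF act_bdry[OF h(1) \<eta>(1)] \<xi>b m(1) w] eventually_frequently[OF sequentially_bot] by blast
      then show "bdry_act h \<eta> \<in> V \<xi> t" using act_bdry[OF h(1) \<eta>(1)] by (simp add: V_iff)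
    qed
    then show ?thesis using that[OF h(1)] qP dist dep'[OF h(1)] unfolding q_def by blast
  next
    case False
    \<comment> \<open>The turn is over at \<open>t\<close>: from then on the product of the ray with
      \<open>p\<close> grows by at most \<open>10 * D\<close>, so by \<open>fpp\<close> the depth
      decreases at unit speed.\<close>
    have ray_pp: "pp (c s) p \<le> pp (c t) p + 10 * D" if s: "t \<le> s" for s
    proof -
      have s0: "0 \<le> s" using s t by simp
      have gts: "gp (c t) (c s) = t"
        unfolding gromov_product_def using ray_dist[OF c t] ray_dist[OF c s0] ray_dist2[OF c t s0] s by simp
      have "\<forall>\<^sub>F n in sequentially. pp (c s) p \<le> pp (c t) p + 10 * D"
        using bprod_less_ev[OF \<xi>b pb False w u0] ray_gp_ev[OF c s0]
          pp_approx[OF pb u0, of "c s"] pp_approx[OF pb u0, of "c t"]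
      proof eventually_elim
        case (elim n)
        have "gp (c s) (u0 n) \<le> s" using gp_le_dist(1)[of x\<^sub>0 "c s" "u0 n"] ray_dist[OF c s0] by simp
        then have "gp (c s) (u0 n) \<le> t + 6 * D + 1"
          using gp_hyp[of "c (real n)" "c s" "u0 n"] gp_commute[of x\<^sub>0 "c s" "c (real n)"] elim D_ge_1 by linarith
        then show ?case using gp_hyp[of "c t" "c s" "u0 n"] gts elim D_ge_1 by linarith
      qed
      then show ?thesis by simp
    qed
    have fall: "s - t - 20 * D \<le> f t - f s" if "t \<le> s" for s
      using fpp[OF t] fpp[of s] ray_pp[OF that] that t by simp
    \<comment> \<open>A time by which the depth, losing at least \<open>s - t - 20 * D\<close> up to
      time \<open>s\<close>, has dropped to 0; it bounds the search for the exit time.\<close>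
    define S where "S = t + f t + 20 * D"
    have S: "t \<le> S" "f S \<le> 0" using fall[of S] dp D_ge_1 by (auto simp: S_def f_def)
    then obtain s where s: "t \<le> s" "f s = 0"
      using IVT2'[of f S 0 t] dp ray_dep_continuous[OF p c t, of S] by (auto simp: f_def)
    have s0: "0 \<le> s" using s t by simp
    obtain h where h: "h \<in> \<Gamma>" "dist (c s) (h x\<^sub>0) \<le> 0 + K"
      using ray_orbit[OF \<xi> c s0 order_refl] near[of s 0] s by auto
    define q where "q = bdry_act (ginv h) p"
    have hq: "bdry_act h q = p" by (simp add: q_def act_inv[OF h(1)])
    have qP: "q \<in> P0" unfolding q_def using anchor_P0[OF h(1) p, of "c s"] s h K_ge_1 by (simp add: f_def)
    note qb = P0_D(2)[OF qP]
    have dts: "dist (c t) (c s) = s - t" using ray_dist2[OF c t s0] s by simp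
    have dle: "f t \<le> s - t" using dep_lip[OF p, of "c t" "c s"] dts s by (simp add: f_def)
    have "dist (c t) (h x\<^sub>0) \<le> (s - t) + K"
      using dist_triangle[of "c t" "h x\<^sub>0" "c s"] h(2) dts by simp
    then have dist: "dist (c t) (h x\<^sub>0) \<le> dep p (c t) + 25 * K"
      using fall[OF s(1)] s D_le_K K_ge_1 by (simp add: f_def)
    obtain N :: nat where N: "s \<le> real N" using real_arch_simple by blast
    have "bdry_act h ` dom q (dep p (c t) - 40 * K) \<subseteq> V \<xi> t"
    proof clarify
      fix \<eta> assume "\<eta> \<in> dom q (dep p (c t) - 40 * K)"
      then have \<eta>: "\<eta> \<in> bdry" "\<not> ereal (f t - 40 * K) \<le> bprod \<eta> q" by (auto simp: dom_iff f_def)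
      obtain v where v: "v \<in> \<eta>" using bdry_nonempty[OF \<eta>(1)] .
      obtain u where u: "u \<in> q" using bdry_nonempty[OF qb] .
      have m: "h \<circ> v \<in> bdry_act h \<eta>" "h \<circ> u \<in> p" using act_mem[OF v] act_mem[OF u, of h] hq by auto
      have "\<forall>\<^sub>F n in sequentially. t + 2 * D \<le> gp ((h \<circ> v) n) (c (real n))"
        using bprod_less_ev[OF \<eta>(1) qb \<eta>(2) v u] eventually_ge_at_top[of N]
          busemann_approx[OF pb m(2), of "c s" x\<^sub>0] busemann_approx[OF pb m(2), of "c t" x\<^sub>0]
      proof eventually_elim
        case (elim n)
        define y z where "y = (h \<circ> v) n" and "z = (h \<circ> u) n"
        have n: "s \<le> real n" using elim N by linarith
        have "gromov_product (h x\<^sub>0) y z \<le> f t - 40 * K + 2 * D"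
          using elim gromov_product_G[OF h(1)] by (simp add: y_def z_def)
        then have yz: "gromov_product (c s) y z \<le> f t - 39 * K + 2 * D"
          using gp_change_base[of "c s" y z "h x\<^sub>0"] h(2) by simp
        \<comment> \<open>From the exit point \<open>c s\<close>, the points \<open>c t\<close> and
          \<open>p\<close> lie in the same direction up to distance about \<open>f t\<close>,
          whereas \<open>y\<close> parts from \<open>p\<close> earlier. So \<open>y\<close> parts
          from the segment to \<open>c t\<close> before reaching \<open>c t\<close>; seen from
          \<open>c t\<close> it is on the side of \<open>c s\<close>, further along the ray.\<close>
        have "f t - 4 * D \<le> dist (c s) z - dist (c t) z"
          using elim s(2) unfolding z_def f_def dep_def by linarith
        then have "f t - 2 * D \<le> gromov_product (c s) (c t) z"
          unfolding gromov_product_def using dts dle by (simp add: dist_commute)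
        then have "gromov_product (c s) y (c t) \<le> f t - 36 * K"
          using hyp[of "c s" y "c t" z] yz D_le_K K_ge_1 by linarith
        then have "36 * K \<le> gromov_product (c t) y (c s)"
          using dle dts unfolding gromov_product_def by (simp add: dist_commute field_simps)
        moreover have "gromov_product (c t) (c s) (c (real n)) = s - t"
          unfolding gromov_product_def using dts ray_dist2[OF c t, of "real n"] ray_dist2[OF c s0, of "real n"] n s
          by simp
        moreover have "37 * K \<le> s - t" using gp_nonneg[of "c s" y z] yz dle D_le_K K_ge_1 by linarith
        ultimately have "35 * K \<le> gromov_product (c t) y (c (real n))"
          using hyp[of "c t" y "c s" "c (real n)"] D_le_K K_ge_1 by linarith
        then show ?case using shadow_ray_step[OF c t, of "real n" y] n s D_le_K K_ge_1 by (simp add: y_def)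
      qed
      then have "ereal t \<le> bprod (bdry_act h \<eta>) \<xi>"
        using bprod_geI[OF act_bdry[OF h(1) \<eta>(1)] \<xi>b m(1) w] eventually_frequently[OF sequentially_bot] by blast
      then show "bdry_act h \<eta> \<in> V \<xi> t" using act_bdry[OF h(1) \<eta>(1)] by (simp add: V_iff)
    qed
    then show ?thesis using that[OF h(1)] qP dist dep'[OF h(1)] unfolding q_def by blast
  qed
qed

lemma infdist_orbit_le: "g \<in> \<Gamma> \<Longrightarrow> infdist x orb \<le> dist x (g x\<^sub>0)"
  unfolding orbit_of_def by (intro infdist_le) blast

lemma infdist_orbit_less:
  assumes "infdist x orb < r" obtains g where "g \<in> \<Gamma>" "dist x (g x\<^sub>0) < r"
proof -
  have ne: "orb \<noteq> {}" unfolding orbit_of_def using id_G by blast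
  then have "(INF a\<in>orb. dist x a) < r" using assms by (simp add: infdist_notempty)
  then have "\<exists>a\<in>orb. dist x a < r" using ne by (subst (asm) cINF_less_iff) (auto intro: bdd_belowI[of _ 0])
  then show ?thesis using that unfolding orbit_of_def by blast
qed

text \<open>Depth is Lipschitz and at most \<open>K\<close> on the orbit; together with
  \<open>ray_orbit\<close> it measures the distance of a deep ray point to the orbit.\<close>

lemma infdist_orbit_dep: assumes "p \<in> P" shows "dep p x - K \<le> infdist x orb"
proof (rule ccontr)
  assume "\<not> ?thesis"
  then have "infdist x orb < dep p x - K" by simp
  then obtain g where "g \<in> \<Gamma>" "dist x (g x\<^sub>0) < dep p x - K" by (rule infdist_orbit_less)
  then show False using dep_lip[OF assms, of x "g x\<^sub>0"] orbit_dep[OF _ assms, of g] by linarith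
qed

end

subsection \<open>Orbit growth\<close>

text \<open>A bound for one increment \<open>r0\<close> is telescoped over whole steps; monotonicity
  covers the remaining fraction of a step, which costs the \<open>1\<close>.\<close>

lemma increment_ge_linear:
  fixes L :: "real \<Rightarrow> real"
  assumes mono: "\<And>s t. 0 < s \<Longrightarrow> s \<le> t \<Longrightarrow> L s \<le> L t"
    and r0: "0 < r0" and c: "0 \<le> c" and inc: "\<And>t. 0 < t \<Longrightarrow> c \<le> L (t + r0) - L t"
    and t: "0 < t" and r: "0 \<le> r"
  shows "(r / r0 - 1) * c \<le> L (t + r) - L t"
proof -
  have tel: "real n * c \<le> L (t + real n * r0) - L t" for n
  proof (induction n)
    case (Suc n)
    have "0 < t + real n * r0" using t r0 by (simp add: add_pos_nonneg)
    from inc[OF this] Suc show ?case by (simp add: algebra_simps)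
  qed simp
  define n where "n = nat \<lfloor>r / r0\<rfloor>"
  have "0 \<le> r / r0" using r r0 by simp
  then have n: "real n \<le> r / r0" "r / r0 - 1 \<le> real n" unfolding n_def by linarith+
  have "(r / r0 - 1) * c \<le> real n * c" using n c by (simp add: mult_right_mono)
  also have "\<dots> \<le> L (t + real n * r0) - L t" by (rule tel)
  also have "\<dots> \<le> L (t + r) - L t"
    using mono[of "t + real n * r0" "t + r"] n(1) t r0 by (simp add: add_pos_nonneg pos_le_divide_eq)
  finally show ?thesis .
qed

lemma increment_le_linear:
  fixes L :: "real \<Rightarrow> real"
  assumes mono: "\<And>s t. 0 < s \<Longrightarrow> s \<le> t \<Longrightarrow> L s \<le> L t"
    and r0: "0 < r0" and inc: "\<And>t. 0 < t \<Longrightarrow> L (t + r0) - L t \<le> c"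
    and t: "0 < t" and r: "0 \<le> r"
  shows "L (t + r) - L t \<le> (r / r0 + 1) * c"
proof -
  have c: "0 \<le> c" using inc[OF zero_less_one] mono[of 1 "1 + r0"] r0 by linarith
  have tel: "L (t + real n * r0) - L t \<le> real n * c" for n
  proof (induction n)
    case (Suc n)
    have "0 < t + real n * r0" using t r0 by (simp add: add_pos_nonneg)
    from inc[OF this] Suc show ?case by (simp add: algebra_simps)
  qed simp
  define n where "n = nat \<lceil>r / r0\<rceil>"
  have "0 \<le> r / r0" using r r0 by simp
  then have n: "r / r0 \<le> real n" "real n \<le> r / r0 + 1" unfolding n_def by linarith+
  have "L (t + r) - L t \<le> L (t + real n * r0) - L t"
    using mono[of "t + r" "t + real n * r0"] n(1) t r r0 by (simp add: pos_divide_le_eq)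
  also have "\<dots> \<le> real n * c" by (rule tel)
  also have "\<dots> \<le> (r / r0 + 1) * c" using n c by (simp add: mult_right_mono)
  finally show ?thesis .
qed

text \<open>Fekete's lemma: \<open>r\<close> times the infimum (supremum) is superadditive (subadditive) in \<open>r\<close>.\<close>

lemma increment_rate_INF_tendsto:
  fixes L :: "real \<Rightarrow> real"
  assumes mono: "\<And>s t. 0 < s \<Longrightarrow> s \<le> t \<Longrightarrow> L s \<le> L t"
  defines "G \<equiv> \<lambda>r. INF t\<in>{0<..}. ereal (1 / r * (L (t + r) - L t))"
  shows "(G \<longlongrightarrow> (SUP r\<in>{0<..}. G r)) at_top"
proof (rule order_tendstoI)
  fix a assume "a < (SUP r\<in>{0<..}. G r)"
  then obtain r0 where r0: "0 < r0" "a < G r0" unfolding less_SUP_iff by auto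
  have G0: "0 \<le> G r" if "0 < r" for r
    unfolding G_def using mono that by (intro INF_greatest) auto
  show "eventually (\<lambda>r. a < G r) at_top"
  proof (cases "a < 0")
    case True
    show ?thesis
      using eventually_gt_at_top[of 0]
    proof eventually_elim
      case (elim r)
      show ?case using True G0[OF elim] by (rule less_le_trans)
    qed
  next
    case False
    obtain b where b: "a < ereal b" "ereal b < G r0" using ereal_dense2[OF r0(2)] by blast
    obtain a' where a': "a = ereal a'" "0 \<le> a'" "a' < b" using False b by (cases a) auto
    have inc: "b * r0 \<le> L (t + r0) - L t" if "0 < t" for t
    proof -
      have "G r0 \<le> ereal (1 / r0 * (L (t + r0) - L t))" unfolding G_def by (rule INF_lower) (use that in simp)
      then have "ereal b \<le> ereal (1 / r0 * (L (t + r0) - L t))" using b(2) by (meson less_imp_le order_trans)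
      then show ?thesis using r0(1) by (simp add: pos_le_divide_eq)
    qed
    \<comment> \<open>The lost step \<open>b * r0\<close> is constant; once \<open>r\<close> exceeds
      the threshold it is less than half of \<open>r * (b - a')\<close>.\<close>
    show ?thesis
      using eventually_gt_at_top[of "max 1 (2 * b * r0 / (b - a'))"]
    proof eventually_elim
      case (elim r)
      have r: "1 < r" "2 * b * r0 < r * (b - a')" using elim a' by (auto simp: pos_divide_less_eq)
      have "ereal ((a' + b) / 2) \<le> G r"
        unfolding G_def
      proof (rule INF_greatest)
        fix t :: real assume "t \<in> {0<..}"
        then have "(r / r0 - 1) * (b * r0) \<le> L (t + r) - L t"
          using increment_ge_linear[where L = L, OF mono r0(1) _ inc, of t r] a' r0 r by auto
        then have "r * b - b * r0 \<le> L (t + r) - L t" using r0 by (simp add: algebra_simps)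
        moreover have "r * ((a' + b) / 2) \<le> r * b - b * r0" using r(2) by (simp add: field_simps)
        ultimately have "r * ((a' + b) / 2) \<le> L (t + r) - L t" by linarith
        then show "ereal ((a' + b) / 2) \<le> ereal (1 / r * (L (t + r) - L t))"
          using r by (simp add: field_simps)
      qed
      moreover have "a < ereal ((a' + b) / 2)" using a' by simp
      ultimately show ?case by (rule less_le_trans[rotated])
    qed
  qed
next
  fix a assume a: "(SUP r\<in>{0<..}. G r) < a"
  show "eventually (\<lambda>r. G r < a) at_top"
    using eventually_gt_at_top[of 0]
  proof eventually_elim
    case (elim r)
    then have "G r \<le> (SUP r\<in>{0<..}. G r)" by (intro SUP_upper) simp
    then show ?case using a by simp
  qed
qed

lemma increment_rate_SUP_tendsto:
  fixes L :: "real \<Rightarrow> real"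
  assumes mono: "\<And>s t. 0 < s \<Longrightarrow> s \<le> t \<Longrightarrow> L s \<le> L t"
  defines "U \<equiv> \<lambda>r. SUP t\<in>{0<..}. ereal (1 / r * (L (t + r) - L t))"
  shows "(U \<longlongrightarrow> (INF r\<in>{0<..}. U r)) at_top"
proof (rule order_tendstoI)
  fix a assume "(INF r\<in>{0<..}. U r) < a"
  then obtain r0 where r0: "0 < r0" "U r0 < a" unfolding INF_less_iff by auto
  obtain b where b: "U r0 < ereal b" "ereal b < a" using ereal_dense2[OF r0(2)] by blast
  have inc: "L (t + r0) - L t \<le> b * r0" if "0 < t" for t
  proof -
    have "ereal (1 / r0 * (L (t + r0) - L t)) \<le> U r0" unfolding U_def by (rule SUP_upper) (use that in simp)
    then have "ereal (1 / r0 * (L (t + r0) - L t)) \<le> ereal b" using b(1) by (meson less_imp_le order_trans)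
    then show ?thesis using r0(1) by (simp add: pos_divide_le_eq)
  qed
  obtain d where d: "ereal b < ereal d" "ereal d < a" using ereal_dense2[OF b(2)] by blast
  show "eventually (\<lambda>r. U r < a) at_top"
    using eventually_gt_at_top[of "max 1 (b * r0 / (d - b))"]
  proof eventually_elim
    case (elim r)
    have r: "1 < r" "b * r0 < r * (d - b)" using elim d by (auto simp: pos_divide_less_eq)
    have "U r \<le> ereal d"
      unfolding U_def
    proof (rule SUP_least)
      fix t :: real assume "t \<in> {0<..}"
      then have "L (t + r) - L t \<le> (r / r0 + 1) * (b * r0)"
        using increment_le_linear[where L = L, OF mono r0(1) inc, of t r] r by auto
      then have "L (t + r) - L t \<le> r * b + b * r0" using r0 by (simp add: algebra_simps)
      also have "\<dots> \<le> r * d" using r(2) by (simp add: algebra_simps)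
      finally show "ereal (1 / r * (L (t + r) - L t)) \<le> ereal d" using r by (simp add: field_simps)
    qed
    then show ?case using d(2) by simp
  qed
next
  fix a assume a: "a < (INF r\<in>{0<..}. U r)"
  show "eventually (\<lambda>r. a < U r) at_top"
    using eventually_gt_at_top[of 0]
  proof eventually_elim
    case (elim r)
    then have "(INF r\<in>{0<..}. U r) \<le> U r" by (intro INF_lower) simp
    then show ?case using a by simp
  qed
qed

section \<open>Growth of parabolic stabilizers\<close>

context hyp_group
begin

lemma finite_orbit_ball: "finite {g \<in> \<Gamma>. dist x\<^sub>0 (g x\<^sub>0) \<le> t}"
proof (cases "0 \<le> t")
  case True
  have "finite {g \<in> \<Gamma>. g ` cball x\<^sub>0 t \<inter> cball x\<^sub>0 t \<noteq> {}}"
    using pdisc compact_cball unfolding properly_discontinuous_def by blast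
  moreover have "{g \<in> \<Gamma>. dist x\<^sub>0 (g x\<^sub>0) \<le> t} \<subseteq> {g \<in> \<Gamma>. g ` cball x\<^sub>0 t \<inter> cball x\<^sub>0 t \<noteq> {}}"
    using True by (auto intro!: image_eqI[of _ _ x\<^sub>0])
  ultimately show ?thesis by (rule finite_subset[rotated])
next
  case False
  then have "{g \<in> \<Gamma>. dist x\<^sub>0 (g x\<^sub>0) \<le> t} = {}" by (auto dest: order_trans[OF zero_le_dist])
  then show ?thesis by (simp only: finite.emptyI)
qed

abbreviation B :: "'a bdry \<Rightarrow> real \<Rightarrow> real" where "B p \<equiv> orbit_count x\<^sub>0 (stab p)"

lemma finite_stab_ball: "finite {g \<in> stab p. dist x\<^sub>0 (g x\<^sub>0) \<le> t}"
  by (rule finite_subset[OF _ finite_orbit_ball[of t]]) (use stabD in blast)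

lemma B_mono: "s \<le> t \<Longrightarrow> B p s \<le> B p t"
  unfolding orbit_count_def of_nat_le_iff by (rule card_mono[OF finite_stab_ball]) auto

lemma B_ge_1: assumes "0 \<le> t" shows "1 \<le> B p t"
proof -
  have "id \<in> {g \<in> stab p. dist x\<^sub>0 (g x\<^sub>0) \<le> t}" using assms by (auto intro: stabI simp: id_G act_id)
  then have "{g \<in> stab p. dist x\<^sub>0 (g x\<^sub>0) \<le> t} \<noteq> {}" by blast
  then have "0 < card {g \<in> stab p. dist x\<^sub>0 (g x\<^sub>0) \<le> t}" using finite_stab_ball by (simp add: card_gt_0_iff)
  then show ?thesis unfolding orbit_count_def by linarith
qed

text \<open>The two halves of tempered growth as they are used: an exponential upper bound, to sum
  over far elements, and doubling over a bounded step, to find many elements in an annulus.\<close>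

definition growth_bounds :: "'a bdry \<Rightarrow> real \<Rightarrow> real \<Rightarrow> real \<Rightarrow> bool" where
  "growth_bounds p b C r \<longleftrightarrow> 0 \<le> b \<and> 1 \<le> C \<and> 0 < r \<and>
     (\<forall>s\<ge>0. \<forall>u\<ge>0. B p (s + u) \<le> C * exp (b * u) * B p s) \<and> (\<forall>s\<ge>0. 2 * B p s \<le> B p (s + r))"

lemma growth_bounds_mono:
  assumes "growth_bounds p b C r" "b \<le> b'" "C \<le> C'" "r \<le> r'"
  shows "growth_bounds p b' C' r'"
  unfolding growth_bounds_def
proof (intro conjI allI impI)
  note g = assms(1)[unfolded growth_bounds_def]
  show "0 \<le> b'" "1 \<le> C'" "0 < r'" using g assms by auto
  fix s u :: real assume su: "0 \<le> s" "0 \<le> u"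
  have "C * exp (b * u) \<le> C' * exp (b' * u)"
    using assms su g by (intro mult_mono) (auto intro: mult_right_mono)
  then have "C * exp (b * u) * B p s \<le> C' * exp (b' * u) * B p s"
    using B_ge_1[OF su(1), of p] by (intro mult_right_mono) auto
  then show "B p (s + u) \<le> C' * exp (b' * u) * B p s" using g su by (meson order_trans)
next
  fix s :: real assume s: "0 \<le> s"
  note g = assms(1)[unfolded growth_bounds_def]
  then show "2 * B p s \<le> B p (s + r')" using B_mono[of "s + r" "s + r'" p] assms(4) s by force
qed

text \<open>By Fekete's lemma the two limits are a supremum and an infimum over \<open>r\<close>, so
  each inequality holds already at a single step, \<open>r0\<close> or \<open>r1\<close>, uniformly
  in \<open>t\<close>; telescoping extends it to all steps.\<close>

lemma tempered_growth_bounds: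
  assumes "tempered_growth x\<^sub>0 \<delta> (stab p)"
  obtains b C r where "b < \<delta>" "growth_bounds p b C r"
proof -
  define L where "L t = ln (B p t)" for t
  have B0: "0 < B p t" if "0 \<le> t" for t using B_ge_1[OF that, of p] by linarith
  have mono: "L s \<le> L t" if "0 < s" "s \<le> t" for s t
    unfolding L_def using B_mono[OF that(2)] B0[of s] B0[of t] that by simp
  have rate: "growth_rate x\<^sub>0 (stab p) r t = 1 / r * (L (t + r) - L t)" if "0 < r" "0 < t" for r t
    using B0[of t] B0[of "t + r"] that unfolding growth_rate_def L_def by (simp add: ln_div)
  define G where "G r = (INF t\<in>{0<..}. ereal (1 / r * (L (t + r) - L t)))" for r
  define U where "U r = (SUP t\<in>{0<..}. ereal (1 / r * (L (t + r) - L t)))" for r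
  have "((\<lambda>r. INF t\<in>{0<..}. ereal (growth_rate x\<^sub>0 (stab p) r t)) \<longlongrightarrow> (SUP r\<in>{0<..}. G r)) at_top"
  proof (rule Lim_transform_eventually)
    show "(G \<longlongrightarrow> (SUP r\<in>{0<..}. G r)) at_top"
      unfolding G_def by (rule increment_rate_INF_tendsto[where L = L, OF mono])
    show "\<forall>\<^sub>F r in at_top. G r = (INF t\<in>{0<..}. ereal (growth_rate x\<^sub>0 (stab p) r t))"
      using eventually_gt_at_top[of 0] by eventually_elim (auto simp: G_def rate intro!: INF_cong)
  qed
  then have lo: "lower_growth x\<^sub>0 (stab p) = (SUP r\<in>{0<..}. G r)"
    unfolding lower_growth_def by (intro tendsto_Lim) auto
  have "((\<lambda>r. SUP t\<in>{0<..}. ereal (growth_rate x\<^sub>0 (stab p) r t)) \<longlongrightarrow> (INF r\<in>{0<..}. U r)) at_top"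
  proof (rule Lim_transform_eventually)
    show "(U \<longlongrightarrow> (INF r\<in>{0<..}. U r)) at_top"
      unfolding U_def by (rule increment_rate_SUP_tendsto[where L = L, OF mono])
    show "\<forall>\<^sub>F r in at_top. U r = (SUP t\<in>{0<..}. ereal (growth_rate x\<^sub>0 (stab p) r t))"
      using eventually_gt_at_top[of 0] by eventually_elim (auto simp: U_def rate intro!: SUP_cong)
  qed
  then have up: "upper_growth x\<^sub>0 (stab p) = (INF r\<in>{0<..}. U r)"
    unfolding upper_growth_def by (intro tendsto_Lim) auto
  have "0 < (SUP r\<in>{0<..}. G r)" "(INF r\<in>{0<..}. U r) < ereal \<delta>"
    using assms lo up unfolding tempered_growth_def by auto
  then obtain r0 r1 where r0: "0 < r0" "0 < G r0" and r1: "0 < r1" "U r1 < ereal \<delta>"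
    unfolding less_SUP_iff INF_less_iff by auto
  obtain a where a: "0 < ereal a" "ereal a < G r0" using ereal_dense2[OF r0(2)] by blast
  obtain b where b: "U r1 < ereal b" "ereal b < ereal \<delta>" using ereal_dense2[OF r1(2)] by blast
  have inc0: "a * r0 \<le> L (t + r0) - L t" if "0 < t" for t
  proof -
    have "G r0 \<le> ereal (1 / r0 * (L (t + r0) - L t))" unfolding G_def by (rule INF_lower) (use that in simp)
    then have "ereal a \<le> ereal (1 / r0 * (L (t + r0) - L t))" using a(2) by (meson less_imp_le order_trans)
    then show ?thesis using r0(1) by (simp add: pos_le_divide_eq)
  qed
  have inc1: "L (t + r1) - L t \<le> b * r1" if "0 < t" for t
  proof -
    have "ereal (1 / r1 * (L (t + r1) - L t)) \<le> U r1" unfolding U_def by (rule SUP_upper) (use that in simp)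
    then have "ereal (1 / r1 * (L (t + r1) - L t)) \<le> ereal b" using b(1) by (meson less_imp_le order_trans)
    then show ?thesis using r1(1) by (simp add: pos_divide_le_eq)
  qed
  have "0 \<le> b * r1" using inc1[OF zero_less_one] mono[of 1 "1 + r1"] r1 by simp
  then have b0: "0 \<le> b" using r1 by (simp add: zero_le_mult_iff)
  \<comment> \<open>Chosen so that the guaranteed increase of \<open>ln (B p t)\<close> over the
    time \<open>r\<close> is exactly \<open>ln 2\<close>.\<close>
  define r where "r = r0 + ln 2 / a"
  have r: "0 < r" unfolding r_def using r0 a by (simp add: add_pos_nonneg)
  have up1: "B p (s + u) \<le> exp (b * r1) * exp (b * u) * B p s" if su: "0 < s" "0 \<le> u" for s u
  proof -
    have "L (s + u) - L s \<le> (u / r1 + 1) * (b * r1)"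
      by (rule increment_le_linear[where L = L, OF mono r1(1) inc1 su])
    also have "\<dots> = b * r1 + b * u" using r1 by (simp add: algebra_simps)
    finally have "exp (L (s + u)) \<le> exp (b * r1 + b * u + L s)" by simp
    then show ?thesis using B0[of s] B0[of "s + u"] su by (simp add: L_def exp_add)
  qed
  have lo1: "2 * B p s \<le> B p (s + r)" if s: "0 < s" for s
  proof -
    have "(r / r0 - 1) * (a * r0) \<le> L (s + r) - L s"
      using increment_ge_linear[where L = L, OF mono r0(1) _ inc0 s, of r] a r0 r by simp
    moreover have "(r / r0 - 1) * (a * r0) = ln 2" unfolding r_def using r0 a by (simp add: field_simps)
    ultimately have "exp (ln 2 + L s) \<le> exp (L (s + r))" by simp
    then show ?thesis using B0[of s] B0[of "s + r"] s r by (simp add: L_def exp_add)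
  qed
  have B1: "1 \<le> B p 1" by (rule B_ge_1) simp
  \<comment> \<open>The rates only concern \<open>t > 0\<close>; the factor \<open>B p 1\<close> and
    the additional unit in \<open>r + 1\<close> serve the case \<open>s = 0\<close>.\<close>
  have "growth_bounds p b (exp (b * r1) * B p 1) (r + 1)"
    unfolding growth_bounds_def
  proof (intro conjI allI impI)
    have e: "1 \<le> exp (b * r1)" using b0 r1 by simp
    show "1 \<le> exp (b * r1) * B p 1" using mult_mono[OF e B1] by simp
    fix s u :: real assume su: "0 \<le> s" "0 \<le> u"
    show "B p (s + u) \<le> exp (b * r1) * B p 1 * exp (b * u) * B p s"
    proof (cases "s = 0")
      case True
      have "B p (s + u) \<le> B p (1 + u)" using True by (intro B_mono) simp
      also have "\<dots> \<le> exp (b * r1) * exp (b * u) * B p 1" by (rule up1) (use su in auto)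
      also have "\<dots> \<le> exp (b * r1) * exp (b * u) * B p 1 * B p s"
        using mult_left_mono[OF B_ge_1[OF su(1), of p], of "exp (b * r1) * exp (b * u) * B p 1"] B1 by simp
      finally show ?thesis by (simp add: mult_ac)
    next
      case False
      then have "B p (s + u) \<le> exp (b * r1) * exp (b * u) * B p s" using su by (intro up1) auto
      also have "\<dots> \<le> exp (b * r1) * exp (b * u) * B p s * B p 1"
        using mult_left_mono[OF B1, of "exp (b * r1) * exp (b * u) * B p s"] B_ge_1[OF su(1), of p] by simp
      finally show ?thesis by (simp add: mult_ac)
    qed
  next
    fix s :: real assume s: "0 \<le> s"
    show "2 * B p s \<le> B p (s + (r + 1))"
    proof (cases "s = 0")
      case True
      have "2 * B p s \<le> 2 * B p 1" using True B_mono[of s 1 p] by simp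
      also have "\<dots> \<le> B p (1 + r)" by (rule lo1) simp
      finally show ?thesis using True by (simp add: add.commute)
    next
      case False
      then have "2 * B p s \<le> B p (s + r)" using s by (intro lo1) simp
      also have "\<dots> \<le> B p (s + (r + 1))" by (rule B_mono) simp
      finally show ?thesis .
    qed
  qed (use b0 r in auto)
  then show ?thesis using that[of b] b(2) by simp
qed

text \<open>The point fixed by a larger parabolic group is also fixed by \<open>stab p\<close>,
  hence is \<open>p\<close> by uniqueness, and so the larger group is contained in
  \<open>stab p\<close>.\<close>

lemma stab_maximal_parabolic:
  assumes "p \<in> P" shows "maximal_parabolic_subgroup x\<^sub>0 \<Gamma> (stab p)"
  unfolding maximal_parabolic_subgroup_def
proof (intro conjI allI impI)
  show par: "parabolic_subgroup x\<^sub>0 \<Gamma> (stab p)" using assms unfolding parabolic_points_def by blast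
  fix Q assume Q: "parabolic_subgroup x\<^sub>0 \<Gamma> Q \<and> stab p \<subseteq> Q"
  have "\<exists>!\<xi>. \<xi> \<in> bdry \<and> (\<forall>g\<in>Q. bdry_act g \<xi> = \<xi>)"
    using Q unfolding parabolic_subgroup_def by (elim conjE)
  then obtain \<xi> where \<xi>: "\<xi> \<in> bdry" "\<forall>g\<in>Q. bdry_act g \<xi> = \<xi>" by (elim ex1E conjE)
  have "\<exists>!\<xi>. \<xi> \<in> bdry \<and> (\<forall>h\<in>stab p. bdry_act h \<xi> = \<xi>)" using par unfolding parabolic_subgroup_def by blast
  moreover have "p \<in> bdry \<and> (\<forall>h\<in>stab p. bdry_act h p = p)" using P_bdry[OF assms] stabD by blast
  moreover have "\<xi> \<in> bdry \<and> (\<forall>h\<in>stab p. bdry_act h \<xi> = \<xi>)" using \<xi> Q by blast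
  ultimately have "\<xi> = p" by blast
  moreover have "Q \<subseteq> \<Gamma>" using Q unfolding parabolic_subgroup_def by (elim conjE)
  ultimately have "Q \<subseteq> stab p" using \<xi>(2) by (auto intro: stabI)
  then show "Q = stab p" using Q by blast
qed

text \<open>Conjugation changes a displacement by at most twice that of \<open>g\<close>.\<close>

lemma B_translate_le:
  assumes "g \<in> \<Gamma>" shows "B (bdry_act g p) s \<le> B p (s + 2 * dist x\<^sub>0 (g x\<^sub>0))"
  unfolding orbit_count_def of_nat_le_iff
proof (rule card_inj_on_le[OF _ _ finite_stab_ball])
  let ?f = "\<lambda>k. ginv g \<circ> k \<circ> g"
  show "inj_on ?f {h \<in> stab (bdry_act g p). dist x\<^sub>0 (h x\<^sub>0) \<le> s}"
  proof (rule inj_onI)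
    fix h h' assume "ginv g \<circ> h \<circ> g = ginv g \<circ> h' \<circ> g"
    then have "g \<circ> (ginv g \<circ> h \<circ> g) \<circ> ginv g = g \<circ> (ginv g \<circ> h' \<circ> g) \<circ> ginv g" by simp
    then show "h = h'" by (simp add: fun_eq_iff inv_cancel[OF assms])
  qed
  show "?f ` {h \<in> stab (bdry_act g p). dist x\<^sub>0 (h x\<^sub>0) \<le> s} \<subseteq> {h \<in> stab p. dist x\<^sub>0 (h x\<^sub>0) \<le> s + 2 * dist x\<^sub>0 (g x\<^sub>0)}"
  proof clarify
    fix k assume k: "k \<in> stab (bdry_act g p)" "dist x\<^sub>0 (k x\<^sub>0) \<le> s"
    have "dist x\<^sub>0 (?f k x\<^sub>0) = dist (g x\<^sub>0) (k (g x\<^sub>0))" using dist_inv[OF assms, of "k (g x\<^sub>0)" x\<^sub>0] by (simp add: dist_commute)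
    also have "\<dots> \<le> dist (g x\<^sub>0) x\<^sub>0 + dist x\<^sub>0 (k x\<^sub>0) + dist (k x\<^sub>0) (k (g x\<^sub>0))"
      using dist_triangle[of "g x\<^sub>0" "k (g x\<^sub>0)" x\<^sub>0] dist_triangle[of x\<^sub>0 "k (g x\<^sub>0)" "k x\<^sub>0"] by linarith
    also have "\<dots> \<le> s + 2 * dist x\<^sub>0 (g x\<^sub>0)"
      using k(2) dist_G[OF stabD(1)[OF k(1)], of x\<^sub>0 "g x\<^sub>0"] by (simp add: dist_commute)
    finally show "?f k \<in> stab p \<and> dist x\<^sub>0 (?f k x\<^sub>0) \<le> s + 2 * dist x\<^sub>0 (g x\<^sub>0)"
      using stab_conj'[OF assms k(1)] by blast
  qed
qed

end

context cusp_const
begin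

lemma uniform_growth_bounds:
  assumes temp: "tempered_parabolic_subgroups x\<^sub>0 \<delta> \<Gamma>" and \<delta>: "0 < \<delta>"
  obtains b C r where "0 \<le> b" "b < \<delta>" "1 \<le> C" "0 < r" "\<And>p. p \<in> P0 \<Longrightarrow> growth_bounds p b C r"
proof -
  have "\<exists>b C r. 0 \<le> b \<and> b < \<delta> \<and> 1 \<le> C \<and> 0 < r \<and> (\<forall>p\<in>F. growth_bounds p b C r)" if "finite F" "F \<subseteq> P0" for F
    using that
  proof (induction F rule: finite_induct)
    case empty
    show ?case using \<delta> by (intro exI[of _ 0] exI[of _ 1]) auto
  next
    case (insert p F)
    then obtain b C r where b: "0 \<le> b" "b < \<delta>" "1 \<le> C" "0 < r" "\<And>q. q \<in> F \<Longrightarrow> growth_bounds q b C r" by auto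
    have "p \<in> P" using insert P0_D by blast
    then have "tempered_growth x\<^sub>0 \<delta> (stab p)"
      using temp stab_maximal_parabolic unfolding tempered_parabolic_subgroups_def by blast
    then obtain b' C' r' where b': "b' < \<delta>" "growth_bounds p b' C' r'" by (rule tempered_growth_bounds)
    have "growth_bounds q (max b b') (max C C') (max r r')" if "q \<in> insert p F" for q
      using that growth_bounds_mono[OF b'(2)] growth_bounds_mono[OF b(5)] by auto
    then show ?case using b b'(1)
      by (intro exI[of _ "max b b'"] exI[of _ "max C C'"] exI[of _ "max r r'"]) auto
  qed
  from this[OF finite_P0 order_refl] show ?thesis using that by blast
qed

text \<open>The cusp function counts in the stabilizer of the representative, the geometry in that
  of a point of \<open>P0\<close>. The two are conjugate by one of finitely many elements, and the
  resulting shift \<open>c\<close> of the argument is absorbed by the growth bound.\<close>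

lemma representative_growth_comparison:
  assumes R: "parabolic_representatives x\<^sub>0 \<Gamma> R"
    and gb: "\<And>p. p \<in> P0 \<Longrightarrow> growth_bounds p b C r" and C: "1 \<le> C"
  obtains E where "1 \<le> E" "\<And>p q s. p \<in> P0 \<Longrightarrow> q \<in> R \<Longrightarrow> q \<in> bdry_orbit_of \<Gamma> p \<Longrightarrow> 0 \<le> s \<Longrightarrow>
    B q s \<le> E * B p s \<and> B p s \<le> E * B q s"
proof -
  have "\<forall>p\<in>P0. \<exists>g. g \<in> \<Gamma> \<and> bdry_act g p \<in> R"
  proof
    fix p assume "p \<in> P0"
    then have "p \<in> P" using P0_D by blast
    then show "\<exists>g. g \<in> \<Gamma> \<and> bdry_act g p \<in> R"
      using R unfolding parabolic_representatives_def bdry_orbit_of_def by blast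
  qed
  then obtain f where f: "\<And>p. p \<in> P0 \<Longrightarrow> f p \<in> \<Gamma> \<and> bdry_act (f p) p \<in> R" by metis
  have un: "q = bdry_act (f p) p" if "p \<in> P0" "q \<in> R" "q \<in> bdry_orbit_of \<Gamma> p" for p q
  proof -
    have "\<exists>!q. q \<in> R \<and> q \<in> bdry_orbit_of \<Gamma> p"
      using R P0_D(1)[OF that(1)] unfolding parabolic_representatives_def by blast
    moreover have "bdry_act (f p) p \<in> R \<and> bdry_act (f p) p \<in> bdry_orbit_of \<Gamma> p"
      using f[OF that(1)] unfolding bdry_orbit_of_def by blast
    ultimately show ?thesis using that(2,3) by blast
  qed
  have "bdd_above ((\<lambda>p. dist x\<^sub>0 (f p x\<^sub>0)) ` P0)" using finite_P0 by (intro bdd_above_finite) simp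
  then obtain M where M: "\<And>p. p \<in> P0 \<Longrightarrow> dist x\<^sub>0 (f p x\<^sub>0) \<le> M" unfolding bdd_above_def by auto
  define c where "c = 2 * \<bar>M\<bar>"
  define N where "N = real (card {g \<in> \<Gamma>. dist x\<^sub>0 (g x\<^sub>0) \<le> c})"
  define E where "E = C * exp (\<bar>b\<bar> * c) + N"
  have "0 \<le> N" by (simp add: N_def)
  have c0: "0 \<le> c" by (simp add: c_def)
  have "1 \<le> C * exp (\<bar>b\<bar> * c)" using C c0 mult_mono[of 1 C 1 "exp (\<bar>b\<bar> * c)"] by simp
  then have E: "1 \<le> E" "C * exp (\<bar>b\<bar> * c) \<le> E" "N \<le> E" using \<open>0 \<le> N\<close> unfolding E_def by linarith+
  show ?thesis
  proof (rule that[OF E(1)])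
    fix p q s assume p: "p \<in> P0" and q: "q \<in> R" "q \<in> bdry_orbit_of \<Gamma> p" and s: "0 \<le> (s::real)"
    define g where "g = f p"
    have g: "g \<in> \<Gamma>" "q = bdry_act g p" "2 * dist x\<^sub>0 (g x\<^sub>0) \<le> c"
      using f[OF p] un[OF p q] M[OF p] by (auto simp: g_def c_def)
    have inc: "B p (u + c) \<le> E * B p u" if u: "0 \<le> u" for u
    proof -
      have "B p (u + c) \<le> C * exp (b * c) * B p u"
        using gb[OF p] u c0 unfolding growth_bounds_def by blast
      also have "\<dots> \<le> C * exp (\<bar>b\<bar> * c) * B p u"
        using C c0 B_ge_1[OF u, of p] by (intro mult_right_mono mult_left_mono) (auto intro: mult_right_mono)
      also have "\<dots> \<le> E * B p u" using E B_ge_1[OF u, of p] by (intro mult_right_mono) auto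
      finally show ?thesis .
    qed
    have "B q s \<le> B p (s + c)" using B_translate_le[OF g(1), of p s] B_mono[of "s + 2 * dist x\<^sub>0 (g x\<^sub>0)" "s + c" p] g by simp
    then have 1: "B q s \<le> E * B p s" using inc[OF s] by linarith
    have "dist x\<^sub>0 (ginv g x\<^sub>0) = dist x\<^sub>0 (g x\<^sub>0)" using dist_inv[OF g(1), of x\<^sub>0 x\<^sub>0] by (simp add: dist_commute)
    then have *: "B p u \<le> B q (u + c)" for u
      using B_translate_le[OF inv_G[OF g(1)], of q u] B_mono[of "u + 2 * dist x\<^sub>0 (g x\<^sub>0)" "u + c" q] g
      by (simp add: act_inv)
    \<comment> \<open>For \<open>s < c\<close> the argument \<open>s - c\<close> would be negative;
      then \<open>B p s\<close> is at most \<open>N\<close>, and \<open>B q s\<close> is at least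
      1.\<close>
    have 2: "B p s \<le> E * B q s"
    proof (cases "c \<le> s")
      case True
      have "B p s \<le> E * B p (s - c)" using inc[of "s - c"] True by simp
      also have "\<dots> \<le> E * B q s" using *[of "s - c"] E by (intro mult_left_mono) auto
      finally show ?thesis .
    next
      case False
      have "B p s \<le> B p c" using False by (intro B_mono) simp
      also have "\<dots> \<le> N" unfolding N_def orbit_count_def of_nat_le_iff
        by (rule card_mono[OF finite_orbit_ball]) (use stabD in blast)
      also have "\<dots> \<le> E * B q s" using E B_ge_1[OF s, of q] mult_mono[of N E 1 "B q s"] by simp
      finally show ?thesis .
    qed
    show "B q s \<le> E * B p s \<and> B p s \<le> E * B q s" using 1 2 by blast
  qed
qed

end

subsection \<open>Quasi-conformal densities\<close>

lemma emeasure_density_bounds: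
  assumes f: "f \<in> borel_measurable M" "density M f = N" and A: "A \<in> sets M"
    and ae: "AE \<eta> in M. \<eta> \<in> A \<longrightarrow> a \<le> f \<eta> \<and> f \<eta> \<le> b"
  shows "a * emeasure M A \<le> emeasure N A" "emeasure N A \<le> b * emeasure M A"
proof -
  have N: "emeasure N A = (\<integral>\<^sup>+ \<eta>. f \<eta> * indicator A \<eta> \<partial>M)"
    using emeasure_density[OF f(1) A] f(2) by simp
  have "(\<integral>\<^sup>+ \<eta>. a * indicator A \<eta> \<partial>M) \<le> (\<integral>\<^sup>+ \<eta>. f \<eta> * indicator A \<eta> \<partial>M)"
    by (rule nn_integral_mono_AE) (use ae in \<open>eventually_elim, auto simp: indicator_def\<close>)
  then show "a * emeasure M A \<le> emeasure N A" using A N by (simp add: nn_integral_cmult_indicator)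
  have "(\<integral>\<^sup>+ \<eta>. f \<eta> * indicator A \<eta> \<partial>M) \<le> (\<integral>\<^sup>+ \<eta>. b * indicator A \<eta> \<partial>M)"
    by (rule nn_integral_mono_AE) (use ae in \<open>eventually_elim, auto simp: indicator_def\<close>)
  then show "emeasure N A \<le> b * emeasure M A" using A N by (simp add: nn_integral_cmult_indicator)
qed

locale qc_density = hyp_group x\<^sub>0 D \<Gamma> for x\<^sub>0 :: "'a::heine_borel" and D \<Gamma> +
  fixes \<delta> :: real and \<mu> :: "'a \<Rightarrow> 'a bdry measure" and C0 :: real
  assumes qcd: "quasi_conformal_density x\<^sub>0 \<Gamma> \<delta> \<mu>"
    and no_atoms: "\<And>x \<eta>. \<eta> \<in> bdry \<Longrightarrow> emeasure (\<mu> x) {\<eta>} = 0"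
    and C0_ge_1: "1 \<le> C0"
    and C0_equivariant: "\<And>g x. g \<in> \<Gamma> \<Longrightarrow> AE \<eta> in \<mu> (g x).
           ennreal (1 / C0) \<le> RN_deriv (\<mu> (g x)) (distr (\<mu> x) (bdry_borel x\<^sub>0) (bdry_act g)) \<eta> \<and>
           RN_deriv (\<mu> (g x)) (distr (\<mu> x) (bdry_borel x\<^sub>0) (bdry_act g)) \<eta> \<le> ennreal C0"
    and C0_conformal: "\<And>x y. AE \<eta> in \<mu> y.
           ennreal (1 / C0 * exp (- \<delta> * busemann \<eta> x y)) \<le> RN_deriv (\<mu> y) (\<mu> x) \<eta> \<and>
           RN_deriv (\<mu> y) (\<mu> x) \<eta> \<le> ennreal (C0 * exp (- \<delta> * busemann \<eta> x y))"

lemma (in hyp_group) qc_density_exists: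
  assumes q: "quasi_conformal_density x\<^sub>0 \<Gamma> \<delta> \<mu>"
    and na: "\<And>x \<eta>. \<eta> \<in> bdry \<Longrightarrow> emeasure (\<mu> x) {\<eta>} = 0"
  shows "\<exists>C0. qc_density x\<^sub>0 D \<Gamma> \<delta> \<mu> C0"
proof -
  have "\<exists>C>0. (\<forall>g\<in>\<Gamma>. \<forall>x. AE \<eta> in \<mu> (g x).
           ennreal (1 / C) \<le> RN_deriv (\<mu> (g x)) (distr (\<mu> x) (bdry_borel x\<^sub>0) (bdry_act g)) \<eta> \<and>
           RN_deriv (\<mu> (g x)) (distr (\<mu> x) (bdry_borel x\<^sub>0) (bdry_act g)) \<eta> \<le> ennreal C) \<and>
      (\<forall>x y. AE \<eta> in \<mu> y.
           ennreal (1 / C * exp (- \<delta> * busemann \<eta> x y)) \<le> RN_deriv (\<mu> y) (\<mu> x) \<eta> \<and>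
           RN_deriv (\<mu> y) (\<mu> x) \<eta> \<le> ennreal (C * exp (- \<delta> * busemann \<eta> x y)))"
    using q unfolding quasi_conformal_density_def by (elim conjE)
  then obtain C where C: "C > 0"
    "\<forall>g\<in>\<Gamma>. \<forall>x. AE \<eta> in \<mu> (g x).
           ennreal (1 / C) \<le> RN_deriv (\<mu> (g x)) (distr (\<mu> x) (bdry_borel x\<^sub>0) (bdry_act g)) \<eta> \<and>
           RN_deriv (\<mu> (g x)) (distr (\<mu> x) (bdry_borel x\<^sub>0) (bdry_act g)) \<eta> \<le> ennreal C"
    "\<forall>x y. AE \<eta> in \<mu> y.
           ennreal (1 / C * exp (- \<delta> * busemann \<eta> x y)) \<le> RN_deriv (\<mu> y) (\<mu> x) \<eta> \<and>
           RN_deriv (\<mu> y) (\<mu> x) \<eta> \<le> ennreal (C * exp (- \<delta> * busemann \<eta> x y))"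
    by (elim exE conjE)
  define C0 where "C0 = max 1 C"
  have le: "C \<le> C0" "1 / C0 \<le> 1 / C" "1 \<le> C0" using C(1) by (auto simp: C0_def frac_le)
  have "qc_density x\<^sub>0 D \<Gamma> \<delta> \<mu> C0"
  proof
    show "AE \<eta> in \<mu> (g x).
           ennreal (1 / C0) \<le> RN_deriv (\<mu> (g x)) (distr (\<mu> x) (bdry_borel x\<^sub>0) (bdry_act g)) \<eta> \<and>
           RN_deriv (\<mu> (g x)) (distr (\<mu> x) (bdry_borel x\<^sub>0) (bdry_act g)) \<eta> \<le> ennreal C0" if "g \<in> \<Gamma>" for g x
      using C(2)[rule_format, OF that]
    proof eventually_elim
      case (elim \<eta>)
      then show ?case using ennreal_leI[OF le(1)] ennreal_leI[OF le(2)] by (meson order_trans)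
    qed
    show "AE \<eta> in \<mu> y.
           ennreal (1 / C0 * exp (- \<delta> * busemann \<eta> x y)) \<le> RN_deriv (\<mu> y) (\<mu> x) \<eta> \<and>
           RN_deriv (\<mu> y) (\<mu> x) \<eta> \<le> ennreal (C0 * exp (- \<delta> * busemann \<eta> x y))" for x y
      using C(3)[rule_format, of x y]
    proof eventually_elim
      case (elim \<eta>)
      have "ennreal (1 / C0 * exp (- \<delta> * busemann \<eta> x y)) \<le> ennreal (1 / C * exp (- \<delta> * busemann \<eta> x y))"
        "ennreal (C * exp (- \<delta> * busemann \<eta> x y)) \<le> ennreal (C0 * exp (- \<delta> * busemann \<eta> x y))"
        using mult_right_mono[OF le(2), of "exp (- \<delta> * busemann \<eta> x y)"]
          mult_right_mono[OF le(1), of "exp (- \<delta> * busemann \<eta> x y)"] by (simp_all only: ennreal_leI exp_ge_zero)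
      then show ?case using elim by (meson order_trans)
    qed
  qed (use q na le in auto)
  then show ?thesis by blast
qed

context qc_density
begin

lemma \<delta>_pos: "0 < \<delta>" using qcd unfolding quasi_conformal_density_def by (elim conjE)

lemma \<mu>_basic: "sets (\<mu> x) = sets (bdry_borel x\<^sub>0) \<and> finite_measure (\<mu> x) \<and>
    emeasure (\<mu> x) bdry \<noteq> 0 \<and> (AE \<eta> in \<mu> x. \<eta> \<in> \<Lambda>)"
  using qcd unfolding quasi_conformal_density_def by (elim conjE) (erule spec)

lemma sets_\<mu>: "sets (\<mu> x) = sets (bdry_borel x\<^sub>0)" using \<mu>_basic by blast
lemma finite_\<mu>: "finite_measure (\<mu> x)" using \<mu>_basic by blast
lemma limit_AE: "AE \<eta> in \<mu> x. \<eta> \<in> \<Lambda>" using \<mu>_basic by blast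
lemma space_\<mu>: "space (\<mu> x) = bdry" using sets_eq_imp_space_eq[OF sets_\<mu>] space_bdry_borel by simp

lemma emeasure_\<mu>: "emeasure (\<mu> x) A = ennreal (measure (\<mu> x) A)"
  by (rule finite_measure.emeasure_eq_measure[OF finite_\<mu>])

lemma measure_\<mu>_mono: "A \<subseteq> S \<Longrightarrow> S \<in> sets (bdry_borel x\<^sub>0) \<Longrightarrow> measure (\<mu> x) A \<le> measure (\<mu> x) S"
  using finite_measure.finite_measure_mono[OF finite_\<mu>] sets_\<mu> by blast

lemma bdry_sets: "bdry \<in> sets (bdry_borel x\<^sub>0)"
  using sets.top[of "bdry_borel x\<^sub>0"] by (simp add: space_bdry_borel)

lemma le_times_measureD:
  assumes "ennreal a * emeasure (\<mu> x) A \<le> emeasure (\<mu> y) S" "0 \<le> a"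
  shows "a * measure (\<mu> x) A \<le> measure (\<mu> y) S"
  using assms unfolding emeasure_\<mu> by (simp add: ennreal_mult[symmetric])

lemma measure_le_timesD:
  assumes "emeasure (\<mu> y) S \<le> ennreal a * emeasure (\<mu> x) A" "0 \<le> a"
  shows "measure (\<mu> y) S \<le> a * measure (\<mu> x) A"
  using assms unfolding emeasure_\<mu> by (simp add: ennreal_mult[symmetric])

lemma measure_equivariant:
  assumes g: "g \<in> \<Gamma>" and A: "A \<in> sets (bdry_borel x\<^sub>0)"
  shows "measure (\<mu> x) A \<le> C0 * measure (\<mu> (g x)) (bdry_act g ` A)"
    "measure (\<mu> (g x)) (bdry_act g ` A) \<le> C0 * measure (\<mu> x) A"
proof -
  define N where "N = distr (\<mu> x) (bdry_borel x\<^sub>0) (bdry_act g)"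
  define f where "f = RN_deriv (\<mu> (g x)) N"
  have ae: "AE \<eta> in \<mu> (g x). ennreal (1 / C0) \<le> f \<eta> \<and> f \<eta> \<le> ennreal C0"
    unfolding f_def N_def by (rule C0_equivariant[OF g])
  have pos: "0 < ennreal (1 / C0)" using C0_ge_1 by simp
  \<comment> \<open>That the pushed measure has a density must be derived: \<open>RN_deriv\<close>
    is 0 if there is none, and then the lower bound \<open>1 / C0\<close> would fail at every point,
    although it holds almost everywhere for a nonzero measure.\<close>
  have "\<exists>f. f \<in> borel_measurable (\<mu> (g x)) \<and> density (\<mu> (g x)) f = N"
  proof (rule ccontr)
    assume "\<not> ?thesis"
    then have "f = (\<lambda>_. 0)" unfolding f_def RN_deriv_def by (simp only: if_False)
    then have "AE \<eta> in \<mu> (g x). False" using ae pos by simp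
    then have "emeasure (\<mu> (g x)) (space (\<mu> (g x))) = 0" 
      by (simp only: ae_filter_eq_bot_iff[symmetric] trivial_limit_def)
    then show False using \<mu>_basic[of "g x"] by (simp add: space_\<mu>)
  qed
  then have f: "f \<in> borel_measurable (\<mu> (g x))" "density (\<mu> (g x)) f = N"
    unfolding f_def using RN_derivI by (auto intro: borel_measurable_RN_deriv)
  have gA: "bdry_act g ` A \<in> sets (bdry_borel x\<^sub>0)" by (rule act_image_measurable[OF g A])
  have Ab: "A \<subseteq> bdry" using sets.sets_into_space[OF A] by (simp add: space_bdry_borel)
  have "bdry_act g -` (bdry_act g ` A) \<inter> bdry = A"
  proof (intro equalityI subsetI)
    fix \<eta> assume "\<eta> \<in> bdry_act g -` (bdry_act g ` A) \<inter> bdry"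
    then obtain \<zeta> where "\<zeta> \<in> A" "bdry_act g \<eta> = bdry_act g \<zeta>" by auto
    then show "\<eta> \<in> A" using act_inv(1)[OF g] by metis
  qed (use Ab in auto)
  moreover have "bdry_act g \<in> measurable (\<mu> x) (bdry_borel x\<^sub>0)"
    using act_measurable[OF g] measurable_cong_sets[OF sets_\<mu> refl] by blast
  ultimately have NA: "emeasure N (bdry_act g ` A) = emeasure (\<mu> x) A"
    unfolding N_def using gA by (subst emeasure_distr) (auto simp: space_\<mu>)
  have gA': "bdry_act g ` A \<in> sets (\<mu> (g x))" using gA sets_\<mu> by simp
  have "AE \<eta> in \<mu> (g x). \<eta> \<in> bdry_act g ` A \<longrightarrow> ennreal (1 / C0) \<le> f \<eta> \<and> f \<eta> \<le> ennreal C0"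
    using ae by eventually_elim simp
  note b = emeasure_density_bounds[OF f gA' this, unfolded NA]
  show "measure (\<mu> x) A \<le> C0 * measure (\<mu> (g x)) (bdry_act g ` A)"
    using measure_le_timesD[OF b(2)] C0_ge_1 by simp
  have "1 / C0 * measure (\<mu> (g x)) (bdry_act g ` A) \<le> measure (\<mu> x) A"
    using le_times_measureD[OF b(1)] C0_ge_1 by simp
  then show "measure (\<mu> (g x)) (bdry_act g ` A) \<le> C0 * measure (\<mu> x) A"
    using C0_ge_1 by (simp add: field_simps)
qed

lemma RN_density: "RN_deriv (\<mu> y) (\<mu> x) \<in> borel_measurable (\<mu> y)" "density (\<mu> y) (RN_deriv (\<mu> y) (\<mu> x)) = \<mu> x"
proof -
  have "\<forall>x y. absolutely_continuous (\<mu> x) (\<mu> y)" using qcd unfolding quasi_conformal_density_def by (elim conjE)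
  then show "density (\<mu> y) (RN_deriv (\<mu> y) (\<mu> x)) = \<mu> x"
    using sigma_finite_measure.density_RN_deriv[OF finite_measure.axioms(1)[OF finite_\<mu>]] sets_\<mu> by blast
qed (rule borel_measurable_RN_deriv)

lemma measure_conformal_le:
  assumes A: "A \<in> sets (bdry_borel x\<^sub>0)" and k: "\<And>\<eta>. \<eta> \<in> A \<Longrightarrow> \<eta> \<in> \<Lambda> \<Longrightarrow> k \<le> busemann \<eta> x y"
  shows "measure (\<mu> x) A \<le> C0 * exp (- \<delta> * k) * measure (\<mu> y) A"
proof -
  have "AE \<eta> in \<mu> y. \<eta> \<in> A \<longrightarrow> 0 \<le> RN_deriv (\<mu> y) (\<mu> x) \<eta> \<and> RN_deriv (\<mu> y) (\<mu> x) \<eta> \<le> ennreal (C0 * exp (- \<delta> * k))"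
    using C0_conformal[of x y] limit_AE[of y]
  proof eventually_elim
    case (elim \<eta>)
    show ?case
    proof (intro impI conjI)
      assume "\<eta> \<in> A"
      then have "C0 * exp (- \<delta> * busemann \<eta> x y) \<le> C0 * exp (- \<delta> * k)"
        using k[of \<eta>] elim \<delta>_pos C0_ge_1 by simp
      then show "RN_deriv (\<mu> y) (\<mu> x) \<eta> \<le> ennreal (C0 * exp (- \<delta> * k))"
        using elim ennreal_leI order_trans by blast
    qed simp
  qed
  from emeasure_density_bounds(2)[OF RN_density _ this]
  show ?thesis using A C0_ge_1 sets_\<mu> by (intro measure_le_timesD) auto
qed

lemma measure_conformal_ge:
  assumes A: "A \<in> sets (bdry_borel x\<^sub>0)" and k: "\<And>\<eta>. \<eta> \<in> A \<Longrightarrow> \<eta> \<in> \<Lambda> \<Longrightarrow> busemann \<eta> x y \<le> k"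
  shows "exp (- \<delta> * k) * measure (\<mu> y) A \<le> C0 * measure (\<mu> x) A"
proof -
  have "AE \<eta> in \<mu> y. \<eta> \<in> A \<longrightarrow> ennreal (1 / C0 * exp (- \<delta> * k)) \<le> RN_deriv (\<mu> y) (\<mu> x) \<eta> \<and> RN_deriv (\<mu> y) (\<mu> x) \<eta> \<le> \<infinity>"
    using C0_conformal[of x y] limit_AE[of y]
  proof eventually_elim
    case (elim \<eta>)
    show ?case
    proof (intro impI conjI)
      assume "\<eta> \<in> A"
      then have "1 / C0 * exp (- \<delta> * k) \<le> 1 / C0 * exp (- \<delta> * busemann \<eta> x y)"
        using k[of \<eta>] elim \<delta>_pos C0_ge_1 by (intro mult_left_mono) auto
      then show "ennreal (1 / C0 * exp (- \<delta> * k)) \<le> RN_deriv (\<mu> y) (\<mu> x) \<eta>"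
        using elim ennreal_leI order_trans by blast
    qed simp
  qed
  from emeasure_density_bounds(1)[OF RN_density _ this]
  have "1 / C0 * exp (- \<delta> * k) * measure (\<mu> y) A \<le> measure (\<mu> x) A"
    using A C0_ge_1 sets_\<mu> by (intro le_times_measureD) auto
  then show ?thesis using C0_ge_1 by (simp add: field_simps)
qed

section \<open>Uniform mass bounds for shadows and their complements at the base point\<close>

definition M0 :: real where "M0 = measure (\<mu> x\<^sub>0) bdry"

lemma M0_pos: "0 < M0"
  using \<mu>_basic[of x\<^sub>0] unfolding emeasure_\<mu> M0_def by (simp add: less_le)

lemma measure_le_M0: "A \<subseteq> bdry \<Longrightarrow> measure (\<mu> x\<^sub>0) A \<le> M0"
  unfolding M0_def by (rule measure_\<mu>_mono[OF _ bdry_sets])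

text \<open>Moved back by \<open>g\<close>, the measure at \<open>x\<close> becomes the one at
  \<open>ginv g x\<close>, at distance \<open>dist x (g x\<^sub>0)\<close> from the base point;
  Busemann functions exceed this distance by at most \<open>2 * D\<close>, wherever \<open>S\<close>
  lies. One factor \<open>C0\<close> stems from equivariance, one from conformality.\<close>

lemma measure_translate_ge:
  assumes g: "g \<in> \<Gamma>" and S: "S \<in> sets (bdry_borel x\<^sub>0)"
  shows "exp (- \<delta> * (dist x (g x\<^sub>0) + 2 * D)) * measure (\<mu> x\<^sub>0) S \<le> C0\<^sup>2 * measure (\<mu> x) (bdry_act g ` S)"
proof -
  have Sb: "S \<subseteq> bdry" using sets.sets_into_space[OF S] by (simp add: space_bdry_borel)
  have d: "dist (ginv g x) x\<^sub>0 = dist x (g x\<^sub>0)" by (rule dist_inv[OF g])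
  have "exp (- \<delta> * (dist x (g x\<^sub>0) + 2 * D)) * measure (\<mu> x\<^sub>0) S \<le> C0 * measure (\<mu> (ginv g x)) S"
  proof (rule measure_conformal_ge[OF S])
    fix \<eta> assume "\<eta> \<in> S"
    then show "bus \<eta> (ginv g x) \<le> dist x (g x\<^sub>0) + 2 * D"
      using busemann_abs[of \<eta> "ginv g x" x\<^sub>0] Sb d by (auto simp: abs_le_iff)
  qed
  also have "\<dots> \<le> C0 * (C0 * measure (\<mu> x) (bdry_act g ` S))"
    using measure_equivariant(1)[OF g S, of "ginv g x"] C0_ge_1 by (intro mult_left_mono) (auto simp: inv_cancel[OF g])
  finally show ?thesis by (simp add: power2_eq_square)
qed

text \<open>Otherwise, for every \<open>n\<close>, some shadow of parameter \<open>n\<close> carries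
  more than half of the mass. The points lying in infinitely many of these form a set of positive
  mass; around such a point \<open>\<eta>\<close> every shadow carries half of the mass, so
  \<open>\<eta>\<close> would be an atom. This takes the place of compactness of the
  boundary.\<close>

lemma shadows_uniformly_small:
  obtains R0 where "\<And>\<zeta>. \<zeta> \<in> bdry \<Longrightarrow> measure (\<mu> x\<^sub>0) (V \<zeta> R0) \<le> M0 / 2"
proof (rule ccontr)
  assume "\<not> thesis"
  then have "\<forall>n::nat. \<exists>\<zeta>. \<zeta> \<in> bdry \<and> M0 / 2 < measure (\<mu> x\<^sub>0) (V \<zeta> (real n))" using that by (meson not_le)
  then obtain z where z: "\<And>n. z n \<in> bdry" "\<And>n. M0 / 2 < measure (\<mu> x\<^sub>0) (V (z n) (real n))" by metis
  interpret fm: finite_measure "\<mu> x\<^sub>0" by (rule finite_\<mu>)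
  have Vs: "V \<zeta> t \<in> sets (\<mu> x\<^sub>0)" if "\<zeta> \<in> bdry" for \<zeta> t using shadow_measurable[OF that] sets_\<mu> by simp
  define U where "U m = (\<Union>n\<in>{m..}. V (z n) (real n))" for m :: nat
  have Us: "U m \<in> sets (\<mu> x\<^sub>0)" for m unfolding U_def using Vs[OF z(1)] by (intro sets.countable_UN'') auto
  have "decseq U" unfolding decseq_def U_def by (auto intro: order_trans)
  then have lim: "(\<lambda>m. measure (\<mu> x\<^sub>0) (U m)) \<longlonglongrightarrow> measure (\<mu> x\<^sub>0) (\<Inter>m. U m)"
    using Us by (intro fm.finite_Lim_measure_decseq) auto
  have "M0 / 2 \<le> measure (\<mu> x\<^sub>0) (U m)" for m
    using z(2)[of m] fm.finite_measure_mono[of "V (z m) (real m)" "U m", OF _ Us] by (force simp: U_def)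
  then have "M0 / 2 \<le> measure (\<mu> x\<^sub>0) (\<Inter>m. U m)" by (intro LIMSEQ_le_const[OF lim]) auto
  then have "(\<Inter>m. U m) \<noteq> {}" using M0_pos by auto
  then obtain \<eta> where \<eta>: "\<And>m. \<eta> \<in> U m" by blast
  have \<eta>b: "\<eta> \<in> bdry" using \<eta>[of 0] by (auto simp: U_def V_iff)
  have ge: "M0 / 2 \<le> measure (\<mu> x\<^sub>0) (V \<eta> (real m))" for m :: nat
  proof -
    obtain k :: nat where k: "4 * D \<le> real k" using real_arch_simple by blast
    obtain n where n: "n \<ge> m + k" "\<eta> \<in> V (z n) (real n)" using \<eta>[of "m + k"] by (auto simp: U_def)
    have "V (z n) (real n) \<subseteq> V \<eta> (real m)"
    proof
      fix \<omega> assume "\<omega> \<in> V (z n) (real n)"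
      then have "\<omega> \<in> bdry" "ereal (real n - 4 * D) \<le> bprod \<omega> \<eta>"
        using n(2) bprod_hyp[of \<omega> "z n" \<eta> "real n"] z(1) \<eta>b bprod_commute[of "z n"] by (auto simp: V_iff)
      moreover have "real m \<le> real n - 4 * D" using n k by linarith
      ultimately show "\<omega> \<in> V \<eta> (real m)" using shadow_antimono[of "real m" "real n - 4 * D" x\<^sub>0 \<eta>] by (auto simp: V_iff)
    qed
    then show ?thesis using z(2)[of n] fm.finite_measure_mono[OF _ Vs[OF \<eta>b]] by (meson less_imp_le order_trans)
  qed
  have "decseq (\<lambda>m. V \<eta> (real m))" unfolding decseq_def by (auto intro!: shadow_antimono)
  then have "(\<lambda>m. measure (\<mu> x\<^sub>0) (V \<eta> (real m))) \<longlonglongrightarrow> measure (\<mu> x\<^sub>0) (\<Inter>m. V \<eta> (real m))"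
    using Vs[OF \<eta>b] by (intro fm.finite_Lim_measure_decseq) auto
  then have "M0 / 2 \<le> measure (\<mu> x\<^sub>0) {\<eta>}"
    unfolding shadow_INT_eq[OF \<eta>b] by (rule LIMSEQ_le_const) (use ge in auto)
  moreover have "measure (\<mu> x\<^sub>0) {\<eta>} = 0" using no_atoms[OF \<eta>b, of x\<^sub>0] by (simp add: measure_def)
  ultimately show False using M0_pos by simp
qed

lemma dom_large:
  obtains c0 where "\<And>p c. p \<in> bdry \<Longrightarrow> c0 \<le> c \<Longrightarrow> M0 / 2 \<le> measure (\<mu> x\<^sub>0) (dom p c)"
proof -
  obtain R0 where R0: "\<And>\<zeta>. \<zeta> \<in> bdry \<Longrightarrow> measure (\<mu> x\<^sub>0) (V \<zeta> R0) \<le> M0 / 2" using shadows_uniformly_small by blast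
  show ?thesis
  proof (rule that)
    fix p c assume p: "p \<in> bdry" and c: "R0 \<le> c"
    have Vs: "V p c \<in> sets (\<mu> x\<^sub>0)" using shadow_measurable[OF p] sets_\<mu> by simp
    have "measure (\<mu> x\<^sub>0) (V p c) \<le> M0 / 2"
      using R0[OF p] measure_\<mu>_mono[OF shadow_antimono[OF c] shadow_measurable[OF p]] by (rule order_trans[rotated])
    moreover have "measure (\<mu> x\<^sub>0) (dom p c) = M0 - measure (\<mu> x\<^sub>0) (V p c)"
      unfolding dom_def M0_def using finite_measure.finite_measure_compl[OF finite_\<mu> Vs] by (simp add: space_\<mu>)
    ultimately show "M0 / 2 \<le> measure (\<mu> x\<^sub>0) (dom p c)" by simp
  qed
qed

text \<open>If some \<open>\<zeta>\<close> lies in the direction of \<open>x\<close>, all points in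
  that direction have large product with \<open>\<zeta>\<close>, so the complement of a shadow at
  \<open>\<zeta>\<close> avoids them; otherwise the whole boundary serves.\<close>

lemma large_set_behind_point:
  obtains R1 where "\<And>x. \<exists>S\<in>sets (bdry_borel x\<^sub>0). M0 / 2 \<le> measure (\<mu> x\<^sub>0) S \<and> (\<forall>\<eta>\<in>S. pp x \<eta> \<le> R1)"
proof -
  obtain R0 where R0: "\<And>p c. p \<in> bdry \<Longrightarrow> R0 \<le> c \<Longrightarrow> M0 / 2 \<le> measure (\<mu> x\<^sub>0) (dom p c)" using dom_large by blast
  show ?thesis
  proof (rule that)
    fix x
    show "\<exists>S\<in>sets (bdry_borel x\<^sub>0). M0 / 2 \<le> measure (\<mu> x\<^sub>0) S \<and> (\<forall>\<eta>\<in>S. pp x \<eta> \<le> R0 + 5 * D)"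
    proof (cases "\<exists>\<zeta>\<in>bdry. R0 + 5 * D \<le> pp x \<zeta>")
      case False
      then show ?thesis using bdry_sets M0_pos by (intro bexI[of _ bdry]) (auto simp: M0_def)
    next
      case True
      then obtain \<zeta> where \<zeta>: "\<zeta> \<in> bdry" "R0 + 5 * D \<le> pp x \<zeta>" by blast
      have "pp x \<eta> \<le> R0 + 5 * D" if \<eta>: "\<eta> \<in> dom \<zeta> R0" for \<eta>
      proof (rule ccontr)
        assume n: "\<not> pp x \<eta> \<le> R0 + 5 * D"
        have \<eta>b: "\<eta> \<in> bdry" "\<not> ereal R0 \<le> bprod \<eta> \<zeta>" using \<eta> by (auto simp: dom_iff)
        obtain v where v: "v \<in> \<eta>" using bdry_nonempty[OF \<eta>b(1)] .
        obtain w where w: "w \<in> \<zeta>" using bdry_nonempty[OF \<zeta>(1)] .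
        have "\<forall>\<^sub>F n in sequentially. R0 + 2 * D \<le> gp (v n) (w n)"
          using pp_approx[OF \<eta>b(1) v, of x] pp_approx[OF \<zeta>(1) w, of x]
        proof eventually_elim
          case (elim k)
          then show ?case using gp_hyp[of "v k" x "w k"] gp_commute[of x\<^sub>0 "v k" x] n \<zeta>(2) by linarith
        qed
        then have "ereal R0 \<le> bprod \<eta> \<zeta>"
          using bprod_geI[OF \<eta>b(1) \<zeta>(1) v w] eventually_frequently[OF sequentially_bot] by blast
        then show False using \<eta>b by blast
      qed
      then show ?thesis using dom_measurable[OF \<zeta>(1)] R0[OF \<zeta>(1) order_refl] by blast
    qed
  qed
qed

text \<open>A substitute for compactness of the limit set, obtained from a ball of X: every limit
  point is represented by a point \<open>z\<close> at distance \<open>S\<close> on the way to it,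
  and limit points whose representatives are within distance 2 can share one orbit point.\<close>

lemma limit_points_approximated_uniformly:
  obtains F where "finite F" "F \<subseteq> \<Gamma>" "\<And>\<zeta>. \<zeta> \<in> \<Lambda> \<Longrightarrow> \<exists>g\<in>F. g x\<^sub>0 \<in> near \<zeta> T"
proof -
  define S where "S = \<bar>T\<bar> + 8 * D"
  have S: "0 \<le> S" "T \<le> S - 8 * D" using D_ge_1 by (auto simp: S_def)
  have "\<forall>\<zeta>\<in>\<Lambda>. \<exists>z g. dist x\<^sub>0 z = S \<and> z \<in> near \<zeta> (S - D) \<and> g \<in> \<Gamma> \<and> g x\<^sub>0 \<in> near \<zeta> S"
  proof
    fix \<zeta> assume \<zeta>: "\<zeta> \<in> \<Lambda>"
    note \<zeta>b = limit_bdry[OF \<zeta>]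
    obtain u where u: "u \<in> \<zeta>" "range u \<subseteq> orb" using \<zeta> unfolding limit_set_def by blast
    have "\<forall>\<^sub>F n in sequentially. u n \<in> near \<zeta> S \<and> S \<le> gp (u n) (u n)"
      using eventually_near[OF \<zeta>b, of S] u(1) bdry_ev_gp[OF \<zeta>b u(1) u(1), of S]
      unfolding eventually_towards by (auto intro: eventually_conj)
    then obtain n where n: "u n \<in> near \<zeta> S" "S \<le> gp (u n) (u n)"
      using eventually_happens'[OF sequentially_bot] by blast
    obtain g where g: "g \<in> \<Gamma>" "u n = g x\<^sub>0" using u(2) unfolding orbit_of_def by blast
    have dn: "S \<le> dist x\<^sub>0 (u n)" using n(2) by (simp add: gromov_product_def)
    obtain c where c: "geodesic_on {0..dist x\<^sub>0 (u n)} c" "c 0 = x\<^sub>0" "c (dist x\<^sub>0 (u n)) = u n"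
      using obtain_geodesic by blast
    have d: "dist x\<^sub>0 (c S) = S" "dist (c S) (u n) = dist x\<^sub>0 (u n) - S"
      using geodesic_onD[OF c(1), of 0 S] geodesic_onD[OF c(1), of S "dist x\<^sub>0 (u n)"] dn S c by auto
    have "c S \<in> near \<zeta> (S - D)"
      unfolding near_def
    proof (intro CollectI ballI)
      fix v assume v: "v \<in> \<zeta>"
      show "\<forall>\<^sub>F k in sequentially. S - D \<le> gp (c S) (v k)"
        using near_ev[OF n(1) v]
      proof eventually_elim
        case (elim k)
        have "gp (c S) (u n) = S" unfolding gromov_product_def using d by simp
        then show ?case using gp_hyp[of "c S" "u n" "v k"] elim by simp
      qed
    qed
    then show "\<exists>z g. dist x\<^sub>0 z = S \<and> z \<in> near \<zeta> (S - D) \<and> g \<in> \<Gamma> \<and> g x\<^sub>0 \<in> near \<zeta> S"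
      using d(1) g n(1) by auto
  qed
  then obtain z h where zh: "\<And>\<zeta>. \<zeta> \<in> \<Lambda> \<Longrightarrow> dist x\<^sub>0 (z \<zeta>) = S" "\<And>\<zeta>. \<zeta> \<in> \<Lambda> \<Longrightarrow> z \<zeta> \<in> near \<zeta> (S - D)"
    "\<And>\<zeta>. \<zeta> \<in> \<Lambda> \<Longrightarrow> h \<zeta> \<in> \<Gamma>" "\<And>\<zeta>. \<zeta> \<in> \<Lambda> \<Longrightarrow> h \<zeta> x\<^sub>0 \<in> near \<zeta> S" by metis
  obtain k where k: "finite k" "cball x\<^sub>0 S \<subseteq> (\<Union>a\<in>k. ball a 1)"
    by (rule compactE_image[OF compact_cball, of "cball x\<^sub>0 S" "\<lambda>a. ball a 1" x\<^sub>0 S]) auto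
  define e where "e a = (SOME \<zeta>. \<zeta> \<in> \<Lambda> \<and> z \<zeta> \<in> ball a 1)" for a
  define k' where "k' = {a \<in> k. \<exists>\<zeta>. \<zeta> \<in> \<Lambda> \<and> z \<zeta> \<in> ball a 1}"
  have e: "e a \<in> \<Lambda> \<and> z (e a) \<in> ball a 1" if "a \<in> k'" for a
    using that someI_ex[of "\<lambda>\<zeta>. \<zeta> \<in> \<Lambda> \<and> z \<zeta> \<in> ball a 1"] unfolding k'_def e_def by blast
  show ?thesis
  proof (rule that[of "(\<lambda>a. h (e a)) ` k'"])
    show "finite ((\<lambda>a. h (e a)) ` k')" using k(1) by (simp add: k'_def)
    show "(\<lambda>a. h (e a)) ` k' \<subseteq> \<Gamma>" using e zh(3) by blast
    fix \<zeta> assume \<zeta>: "\<zeta> \<in> \<Lambda>"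
    then have "z \<zeta> \<in> cball x\<^sub>0 S" using zh(1) by simp
    then obtain a where a: "a \<in> k" "z \<zeta> \<in> ball a 1" using k(2) by blast
    then have a': "a \<in> k'" using \<zeta> by (auto simp: k'_def)
    let ?\<omega> = "e a"
    have \<omega>: "?\<omega> \<in> \<Lambda>" "z ?\<omega> \<in> ball a 1" using e[OF a'] by auto
    have "dist (z ?\<omega>) (z \<zeta>) \<le> 2" using a(2) \<omega>(2) dist_triangle[of "z ?\<omega>" "z \<zeta>" a] by (simp add: dist_commute)
    then have 1: "S - 1 \<le> gp (z ?\<omega>) (z \<zeta>)" unfolding gromov_product_def using zh(1)[OF \<zeta>] zh(1)[OF \<omega>(1)] by simp
    have "h ?\<omega> x\<^sub>0 \<in> near ?\<omega> (S - D)" using zh(4)[OF \<omega>(1)] near_mono[of "S - D" S] D_ge_1 by auto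
    then have 2: "S - 2 * D \<le> gp (h ?\<omega> x\<^sub>0) (z ?\<omega>)"
      using near_gp[OF limit_bdry[OF \<omega>(1)] _ zh(2)[OF \<omega>(1)]] by force
    have "h ?\<omega> x\<^sub>0 \<in> near \<zeta> T"
      unfolding near_def
    proof (intro CollectI ballI)
      fix v assume v: "v \<in> \<zeta>"
      show "\<forall>\<^sub>F n in sequentially. T \<le> gp (h ?\<omega> x\<^sub>0) (v n)"
        using near_ev[OF zh(2)[OF \<zeta>] v]
      proof eventually_elim
        case (elim n)
        then show ?case using 1 2 S D_ge_1 gp_hyp[of "h ?\<omega> x\<^sub>0" "z ?\<omega>" "z \<zeta>"] gp_hyp[of "h ?\<omega> x\<^sub>0" "z \<zeta>" "v n"]
          by linarith
      qed
    qed
    then show "\<exists>g\<in>(\<lambda>a. h (e a)) ` k'. g x\<^sub>0 \<in> near \<zeta> T" using a' by blast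
  qed
qed

text \<open>The argument of Sullivan's shadow lemma: at least half of the mass lies in directions
  away from \<open>ginv g x\<^sub>0\<close>, and \<open>g\<close> sends these close to
  \<open>g x\<^sub>0\<close>, which is close to \<open>\<zeta>\<close>. As \<open>g\<close> comes
  from a finite set, the distortion is bounded.\<close>

lemma shadows_uniformly_charged:
  obtains c where "0 < c" "\<And>\<zeta>. \<zeta> \<in> \<Lambda> \<Longrightarrow> c \<le> measure (\<mu> x\<^sub>0) (V \<zeta> k)"
proof -
  obtain R1 where R1: "\<And>x. \<exists>S\<in>sets (bdry_borel x\<^sub>0). M0 / 2 \<le> measure (\<mu> x\<^sub>0) S \<and> (\<forall>\<eta>\<in>S. pp x \<eta> \<le> R1)"
    using large_set_behind_point by blast
  define T where "T = k + \<bar>R1\<bar> + 4 * D"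
  obtain F where F: "finite F" "F \<subseteq> \<Gamma>" "\<And>\<zeta>. \<zeta> \<in> \<Lambda> \<Longrightarrow> \<exists>g\<in>F. g x\<^sub>0 \<in> near \<zeta> T"
    using limit_points_approximated_uniformly by blast
  have "bdd_above ((\<lambda>g. dist x\<^sub>0 (g x\<^sub>0)) ` F)" using F(1) by (intro bdd_above_finite) simp
  then obtain E where E: "\<And>g. g \<in> F \<Longrightarrow> dist x\<^sub>0 (g x\<^sub>0) \<le> E" unfolding bdd_above_def by auto
  define c where "c = exp (- \<delta> * (E + 2 * D)) * (M0 / 2) / C0\<^sup>2"
  have "0 < C0\<^sup>2" using C0_ge_1 by simp
  show ?thesis
  proof (rule that)
    show "0 < c" unfolding c_def using M0_pos \<open>0 < C0\<^sup>2\<close> by simp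
    fix \<zeta> assume \<zeta>: "\<zeta> \<in> \<Lambda>"
    note \<zeta>b = limit_bdry[OF \<zeta>]
    obtain g where g: "g \<in> F" "g x\<^sub>0 \<in> near \<zeta> T" using F(3)[OF \<zeta>] by blast
    have gG: "g \<in> \<Gamma>" using F(2) g(1) by blast
    obtain S where S: "S \<in> sets (bdry_borel x\<^sub>0)" "M0 / 2 \<le> measure (\<mu> x\<^sub>0) S" "\<And>\<eta>. \<eta> \<in> S \<Longrightarrow> pp (ginv g x\<^sub>0) \<eta> \<le> R1"
      using R1[of "ginv g x\<^sub>0"] by blast
    have Sb: "S \<subseteq> bdry" using sets.sets_into_space[OF S(1)] by (simp add: space_bdry_borel)
    have sub: "bdry_act g ` S \<subseteq> V \<zeta> k"
    proof clarify
      fix \<eta> assume \<eta>: "\<eta> \<in> S"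
      then have \<eta>b: "\<eta> \<in> bdry" using Sb by blast
      obtain v where v: "v \<in> \<eta>" using bdry_nonempty[OF \<eta>b] .
      obtain w where w: "w \<in> \<zeta>" using bdry_nonempty[OF \<zeta>b] .
      have "\<forall>\<^sub>F n in sequentially. k + 2 * D \<le> gp ((g \<circ> v) n) (w n)"
        using pp_approx[OF \<eta>b v, of "ginv g x\<^sub>0"] near_ev[OF g(2) w]
      proof eventually_elim
        case (elim n)
        have "dist (ginv g x\<^sub>0) (v n) = dist x\<^sub>0 (g (v n))" "dist x\<^sub>0 (ginv g x\<^sub>0) = dist x\<^sub>0 (g x\<^sub>0)"
          using dist_inv[OF gG] by (auto simp: dist_commute)
        then have "gp (g (v n)) (g x\<^sub>0) = dist x\<^sub>0 (g x\<^sub>0) - gp (ginv g x\<^sub>0) (v n)"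
          unfolding gromov_product_def using dist_G[OF gG, of "v n" x\<^sub>0] by (simp add: dist_commute field_simps)
        moreover have "T \<le> dist x\<^sub>0 (g x\<^sub>0)" using elim(2) gp_le_dist(1)[of x\<^sub>0 "g x\<^sub>0" "w n"] by linarith
        ultimately have "T - \<bar>R1\<bar> - D \<le> gp (g (v n)) (g x\<^sub>0)" using elim(1) S(3)[OF \<eta>] by linarith
        then show ?case using gp_hyp[of "g (v n)" "g x\<^sub>0" "w n"] elim(2) D_ge_1 by (simp add: T_def)
      qed
      then have "ereal k \<le> bprod (bdry_act g \<eta>) \<zeta>"
        using bprod_geI[OF act_bdry[OF gG \<eta>b] \<zeta>b act_mem[OF v] w] eventually_frequently[OF sequentially_bot] by blast
      then show "bdry_act g \<eta> \<in> V \<zeta> k" using act_bdry[OF gG \<eta>b] by (simp add: V_iff)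
    qed
    have "exp (- \<delta> * (E + 2 * D)) * (M0 / 2) \<le> exp (- \<delta> * (dist x\<^sub>0 (g x\<^sub>0) + 2 * D)) * measure (\<mu> x\<^sub>0) S"
      using E[OF g(1)] S(2) \<delta>_pos M0_pos by (intro mult_mono) auto
    also have "\<dots> \<le> C0\<^sup>2 * measure (\<mu> x\<^sub>0) (bdry_act g ` S)" by (rule measure_translate_ge[OF gG S(1)])
    also have "\<dots> \<le> C0\<^sup>2 * measure (\<mu> x\<^sub>0) (V \<zeta> k)"
      using measure_\<mu>_mono[OF sub shadow_measurable[OF \<zeta>b]] by (intro mult_left_mono) auto
    finally show "c \<le> measure (\<mu> x\<^sub>0) (V \<zeta> k)"
      unfolding c_def using \<open>0 < C0\<^sup>2\<close> by (simp add: pos_divide_le_eq mult_ac)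
  qed
qed

end

subsection \<open>The mass of a point high in a horoball\<close>

lemma le_mult_trans:
  fixes a b c :: real
  assumes "a \<le> C * b" "b \<le> E * c" "0 \<le> C" shows "a \<le> (C * E) * c"
  using assms mult_left_mono[OF assms(2,3)] by (simp add: mult.assoc)

locale cusp_density = cusp_const x\<^sub>0 D \<Gamma> H K + qc_density x\<^sub>0 D \<Gamma> \<delta> \<mu> C0
  for x\<^sub>0 :: "'a::heine_borel" and D \<Gamma> H K \<delta> \<mu> C0 +
  fixes b Cg rg cd :: real
  assumes b_less: "b < \<delta>"
    and growth: "\<And>p. p \<in> P0 \<Longrightarrow> growth_bounds p b Cg rg"
    and growth_const: "0 \<le> b" "1 \<le> Cg" "0 < rg"
    and cd_nonneg: "0 \<le> cd"
    and cover: "\<And>p \<eta>. p \<in> P0 \<Longrightarrow> \<eta> \<in> \<Lambda> \<Longrightarrow> \<eta> \<noteq> p \<Longrightarrow> \<exists>g\<in>stab p. \<eta> \<in> bdry_act g ` dom p cd"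
    and dom_mass: "\<And>p. p \<in> bdry \<Longrightarrow> M0 / 2 \<le> measure (\<mu> x\<^sub>0) (dom p cd)"
begin

lemma growth_le: "p \<in> P0 \<Longrightarrow> 0 \<le> s \<Longrightarrow> 0 \<le> u \<Longrightarrow> B p (s + u) \<le> Cg * exp (b * u) * B p s"
  using growth unfolding growth_bounds_def by blast

lemma growth_double: "p \<in> P0 \<Longrightarrow> 0 \<le> s \<Longrightarrow> 2 * B p s \<le> B p (s + rg)"
  using growth unfolding growth_bounds_def by blast

abbreviation piece :: "'a bdry \<Rightarrow> ('a \<Rightarrow> 'a) \<Rightarrow> 'a bdry set" where
  "piece p g \<equiv> bdry_act g ` dom p cd"

lemma piece_measurable: "p \<in> P0 \<Longrightarrow> g \<in> stab p \<Longrightarrow> piece p g \<in> sets (bdry_borel x\<^sub>0)"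
  by (rule act_image_measurable[OF stabD(1) dom_measurable[OF P0_D(2)]])

text \<open>The standard position of a ray point after \<open>anchor\<close>, whose error is
  \<open>25 * K\<close>. Depth exceeds the distance to the base point by at most \<open>K\<close>,
  so distance at most about \<open>d\<close> and depth at least about \<open>d\<close> place
  \<open>x\<close> on the way from the base point to \<open>p\<close>.\<close>

definition height :: "'a bdry \<Rightarrow> real \<Rightarrow> 'a \<Rightarrow> bool" where
  "height p d x \<longleftrightarrow> p \<in> P0 \<and> 0 \<le> d \<and> dist x\<^sub>0 x \<le> d + 25 * K \<and> d - 25 * K \<le> dep p x"

text \<open>Moved back by \<open>g\<close>, the piece becomes the fixed set \<open>dom p cd\<close>
  seen from \<open>ginv g x\<close>, where \<open>dom_busemann_high\<close> makes the conformal
  factor constant up to bounded error.\<close>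

lemma piece_mass_le:
  obtains C where "0 < C" "\<And>p d x g. height p d x \<Longrightarrow> g \<in> stab p \<Longrightarrow>
    measure (\<mu> x) (piece p g) \<le> C * exp (- \<delta> * max d (nm g - d))"
proof -
  define k where "k = 5 * (25 * K) + 4 * cd + 40 * K"
  show ?thesis
  proof (rule that[of "C0\<^sup>2 * exp (\<delta> * k) * M0"])
    show "0 < C0\<^sup>2 * exp (\<delta> * k) * M0" using C0_ge_1 M0_pos by simp
    fix p d x g assume h: "height p d x" and g: "g \<in> stab p"
    have p: "p \<in> P0" and d: "0 \<le> d" "dist x\<^sub>0 x \<le> d + 25 * K" "d - 25 * K \<le> dep p x"
      using h by (auto simp: height_def)
    have gG: "g \<in> \<Gamma>" by (rule stabD(1)[OF g])
    have dm: "dom p cd \<in> sets (bdry_borel x\<^sub>0)" by (rule dom_measurable[OF P0_D(2)[OF p]])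
    have "measure (\<mu> x) (piece p g) \<le> C0 * measure (\<mu> (ginv g x)) (dom p cd)"
      using measure_equivariant(2)[OF gG dm, of "ginv g x"] by (simp add: inv_cancel[OF gG])
    also have "measure (\<mu> (ginv g x)) (dom p cd) \<le> C0 * exp (- \<delta> * (max d (nm g - d) - k)) * measure (\<mu> x\<^sub>0) (dom p cd)"
    proof (rule measure_conformal_le[OF dm])
      fix \<eta> assume "\<eta> \<in> dom p cd"
      from dom_busemann_high[OF p g d(1) _ cd_nonneg d(2,3) this]
      show "max d (nm g - d) - k \<le> bus \<eta> (ginv g x)" using K_ge_1 by (simp add: k_def abs_le_iff)
    qed
    also have "\<dots> \<le> C0 * exp (- \<delta> * (max d (nm g - d) - k)) * M0"
      using C0_ge_1 by (intro mult_left_mono measure_le_M0) (auto simp: dom_def)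
    finally have "measure (\<mu> x) (piece p g) \<le> C0 * (C0 * exp (- \<delta> * (max d (nm g - d) - k)) * M0)"
      using C0_ge_1 by simp
    also have "\<dots> = C0\<^sup>2 * exp (\<delta> * k) * M0 * exp (- \<delta> * max d (nm g - d))"
      by (simp add: power2_eq_square right_diff_distrib exp_diff exp_minus field_simps)
    finally show "measure (\<mu> x) (piece p g) \<le> C0\<^sup>2 * exp (\<delta> * k) * M0 * exp (- \<delta> * max d (nm g - d))" .
  qed
qed

text \<open>Here a bound for the distance from \<open>x\<close> to \<open>g x\<^sub>0\<close> is
  enough, as a Busemann function exceeds the distance by at most \<open>2 * D\<close>.\<close>

lemma piece_mass_ge:
  obtains C where "0 < C" "\<And>p d x g. height p d x \<Longrightarrow> g \<in> stab p \<Longrightarrow>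
    exp (- \<delta> * max d (nm g - d)) \<le> C * measure (\<mu> x) (piece p g)"
proof -
  define k where "k = 3 * (25 * K) + 10 * K + 2 * D"
  show ?thesis
  proof (rule that[of "exp (\<delta> * k) * C0\<^sup>2 * (2 / M0)"])
    show "0 < exp (\<delta> * k) * C0\<^sup>2 * (2 / M0)" using C0_ge_1 M0_pos by simp
    fix p d x g assume h: "height p d x" and g: "g \<in> stab p"
    have p: "p \<in> P0" and d: "0 \<le> d" "dist x\<^sub>0 x \<le> d + 25 * K" "d - 25 * K \<le> dep p x"
      using h by (auto simp: height_def)
    have dm: "dom p cd \<in> sets (bdry_borel x\<^sub>0)" by (rule dom_measurable[OF P0_D(2)[OF p]])
    have "dist x (g x\<^sub>0) + 2 * D \<le> max d (nm g - d) + k"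
      using stab_dist_high[OF p g d(1) _ d(2,3)] K_ge_1 by (simp add: k_def abs_le_iff)
    then have "exp (- \<delta> * (max d (nm g - d) + k)) \<le> exp (- \<delta> * (dist x (g x\<^sub>0) + 2 * D))"
      using \<delta>_pos by simp
    then have "exp (- \<delta> * (max d (nm g - d) + k)) * (M0 / 2)
        \<le> exp (- \<delta> * (dist x (g x\<^sub>0) + 2 * D)) * measure (\<mu> x\<^sub>0) (dom p cd)"
      using dom_mass[OF P0_D(2)[OF p]] M0_pos by (intro mult_mono) auto
    also have "\<dots> \<le> C0\<^sup>2 * measure (\<mu> x) (piece p g)" by (rule measure_translate_ge[OF stabD(1)[OF g] dm])
    finally have *: "exp (- \<delta> * (max d (nm g - d) + k)) * (M0 / 2) \<le> C0\<^sup>2 * measure (\<mu> x) (piece p g)" .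
    have "exp (- \<delta> * max d (nm g - d)) = exp (\<delta> * k) * (2 / M0) * (exp (- \<delta> * (max d (nm g - d) + k)) * (M0 / 2))"
    proof -
      have e: "exp (- \<delta> * max d (nm g - d)) = exp (\<delta> * k) * exp (- \<delta> * (max d (nm g - d) + k))"
        unfolding exp_add[symmetric] by (simp add: algebra_simps)
      have "X * Y = X * (2 / M0) * (Y * (M0 / 2))" for X Y :: real using M0_pos by simp
      then show ?thesis unfolding e .
    qed
    also have "\<dots> \<le> exp (\<delta> * k) * (2 / M0) * (C0\<^sup>2 * measure (\<mu> x) (piece p g))"
      using * M0_pos by (intro mult_left_mono) auto
    finally show "exp (- \<delta> * max d (nm g - d)) \<le> exp (\<delta> * k) * C0\<^sup>2 * (2 / M0) * measure (\<mu> x) (piece p g)"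
      by (simp add: mult_ac)
  qed
qed

text \<open>The pieces are grouped in layers of width 1 beyond \<open>2 * d\<close>. The number of
  pieces in layer \<open>n\<close> grows at most like \<open>exp (b * n)\<close>, and the mass of
  each falls like \<open>exp (- \<delta> * n)\<close>, so a geometric series dominates.\<close>

lemma total_mass_high:
  obtains C where "0 < C" "\<And>p d x. height p d x \<Longrightarrow> measure (\<mu> x) bdry \<le> C * (B p (2 * d) * exp (- \<delta> * d))"
proof -
  obtain C1 where C1: "0 < C1" "\<And>p d x g. height p d x \<Longrightarrow> g \<in> stab p \<Longrightarrow>
    measure (\<mu> x) (piece p g) \<le> C1 * exp (- \<delta> * max d (nm g - d))"
    using piece_mass_le by blast
  define q where "q = exp (b - \<delta>)"
  have q: "0 < q" "q < 1" using b_less by (auto simp: q_def)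
  define C where "C = C1 * Cg * exp b * (1 / (1 - q))"
  show ?thesis
  proof (rule that)
    show "0 < C" using C1 q growth_const by (simp add: C_def)
    fix p d x assume h: "height p d x"
    have p: "p \<in> P0" and d: "0 \<le> d" using h by (auto simp: height_def)
    interpret fm: finite_measure "\<mu> x" by (rule finite_\<mu>)
    \<comment> \<open>Layer 0 takes in all elements with \<open>nm g \<le> 2 * d + 1\<close>, each
      of which gives a piece of mass at most about \<open>exp (- \<delta> * d)\<close>.\<close>
    define S where "S n = {g \<in> stab p. nm g \<le> 2 * d + real n + 1 \<and> (n = 0 \<or> 2 * d + real n < nm g)}" for n :: nat
    define A where "A n = (\<Union>g\<in>S n. piece p g)" for n
    have Sfin: "finite (S n)" for n
      by (rule finite_subset[OF _ finite_stab_ball[of p "2 * d + real n + 1"]]) (auto simp: S_def)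
    have Sst: "g \<in> stab p" if "g \<in> S n" for g n using that by (simp add: S_def)
    have ps: "piece p g \<in> sets (\<mu> x)" if "g \<in> S n" for g n
      using piece_measurable[OF p Sst[OF that]] sets_\<mu> by simp
    have As: "A n \<in> sets (\<mu> x)" for n unfolding A_def using Sfin ps by (intro sets.finite_UN) auto
    define W where "W = C1 * Cg * exp b * (B p (2 * d) * exp (- \<delta> * d))"
    have layer: "measure (\<mu> x) (A n) \<le> W * q ^ n" for n
    proof -
      have "measure (\<mu> x) (A n) \<le> (\<Sum>g\<in>S n. measure (\<mu> x) (piece p g))"
        unfolding A_def using Sfin ps by (intro measure_UNION_le) auto
      also have "\<dots> \<le> (\<Sum>g\<in>S n. C1 * exp (- \<delta> * (d + real n)))"
      proof (rule sum_mono)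
        fix g assume g: "g \<in> S n"
        have "d + real n \<le> max d (nm g - d)" using g by (auto simp: S_def)
        then have "exp (- \<delta> * max d (nm g - d)) \<le> exp (- \<delta> * (d + real n))" using \<delta>_pos by simp
        then show "measure (\<mu> x) (piece p g) \<le> C1 * exp (- \<delta> * (d + real n))"
          using C1(2)[OF h Sst[OF g]] C1(1) by (meson mult_left_mono less_imp_le order_trans)
      qed
      also have "\<dots> = real (card (S n)) * (C1 * exp (- \<delta> * (d + real n)))" by simp
      also have "\<dots> \<le> B p (2 * d + (real n + 1)) * (C1 * exp (- \<delta> * (d + real n)))"
      proof (rule mult_right_mono)
        show "real (card (S n)) \<le> B p (2 * d + (real n + 1))"
          unfolding orbit_count_def of_nat_le_iff by (rule card_mono[OF finite_stab_ball]) (auto simp: S_def)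
      qed (use C1 in simp)
      also have "\<dots> \<le> (Cg * exp (b * (real n + 1)) * B p (2 * d)) * (C1 * exp (- \<delta> * (d + real n)))"
        using growth_le[OF p, of "2 * d" "real n + 1"] d C1 by (intro mult_right_mono) auto
      also have "\<dots> = W * q ^ n"
      proof -
        have "exp (b * (real n + 1)) * exp (- \<delta> * (d + real n)) = exp b * exp (- \<delta> * d) * exp (real n * (b - \<delta>))"
          by (simp add: exp_add[symmetric] algebra_simps)
        then show ?thesis unfolding W_def q_def exp_of_nat_mult by (simp add: mult_ac)
      qed
      finally show ?thesis .
    qed
    have sq: "summable (\<lambda>n. W * q ^ n)" using q by (intro summable_mult summable_geometric) auto
    have sm: "summable (\<lambda>n. measure (\<mu> x) (A n))"
      by (rule summable_comparison_test'[OF sq, of 0]) (use layer in auto)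
    have "measure (\<mu> x) (\<Union>n. A n) \<le> (\<Sum>n. measure (\<mu> x) (A n))"
      using As sm by (intro fm.finite_measure_subadditive_countably) auto
    also have "\<dots> \<le> (\<Sum>n. W * q ^ n)" by (rule suminf_le[OF layer sm sq])
    also have "\<dots> = W * (1 / (1 - q))" using q by (subst suminf_mult) (auto simp: suminf_geometric)
    also have "\<dots> = C * (B p (2 * d) * exp (- \<delta> * d))" by (simp add: C_def W_def mult_ac)
    finally have le: "measure (\<mu> x) (\<Union>n. A n) \<le> C * (B p (2 * d) * exp (- \<delta> * d))" .
    have pb: "p \<in> bdry" by (rule P0_D(2)[OF p])
    \<comment> \<open>The cover leaves out the point \<open>p\<close>, which is null because there
      are no atoms.\<close>
    have "{p} \<in> sets (\<mu> x)"
      unfolding shadow_INT_eq[OF pb, symmetric] using shadow_measurable[OF pb] sets_\<mu>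
      by (intro sets.countable_INT') auto
    then have "AE \<eta> in \<mu> x. \<eta> \<notin> {p}" using no_atoms[OF pb] by (intro AE_not_in) (auto simp: null_sets_def)
    then have "AE \<eta> in \<mu> x. \<eta> \<in> bdry \<longleftrightarrow> \<eta> \<in> (\<Union>n. A n)"
      using limit_AE[of x]
    proof eventually_elim
      case (elim \<eta>)
      then obtain g where g: "g \<in> stab p" "\<eta> \<in> piece p g" using cover[OF p, of \<eta>] by auto
      have "\<exists>n::nat. nm g \<le> 2 * d + real n + 1"
        using real_arch_simple[of "nm g - 2 * d - 1"] by (auto simp: algebra_simps)
      then obtain n :: nat where n: "nm g \<le> 2 * d + real n + 1" "\<And>m. m < n \<Longrightarrow> \<not> nm g \<le> 2 * d + real m + 1"
        using exists_least_iff[of "\<lambda>n. nm g \<le> 2 * d + real n + 1"] by blast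
      have "n = 0 \<or> 2 * d + real n < nm g" using n(2)[of "n - 1"] by (cases n) auto
      then have "g \<in> S n" using g(1) n(1) by (simp add: S_def)
      then have "\<eta> \<in> (\<Union>n. A n)" using g(2) by (auto simp: A_def)
      then show ?case using limit_bdry elim by blast
    qed
    then have "measure (\<mu> x) bdry = measure (\<mu> x) (\<Union>n. A n)"
      using As bdry_sets sets_\<mu> by (intro measure_eq_AE) auto
    then show "measure (\<mu> x) bdry \<le> C * (B p (2 * d) * exp (- \<delta> * d))" using le by simp
  qed
qed

section \<open>Multiplicity of the pieces and lower mass bounds\<close>

definition mult :: real where "mult = real (card {g \<in> \<Gamma>. nm g \<le> 4 * cd + 24 * K})"

text \<open>Pieces through one point belong to elements whose orbit points are at bounded mutual
  distance, by \<open>dom_translates_meet\<close>; shifted by one of them, these elements fall into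
  a finite ball of the group.\<close>

lemma pieces_multiplicity:
  assumes p: "p \<in> P0" and S: "finite S" "S \<subseteq> stab p"
  shows "real (card {g \<in> S. \<eta> \<in> piece p g}) \<le> mult"
proof (cases "{g \<in> S. \<eta> \<in> piece p g} = {}")
  case True
  then show ?thesis unfolding True by (simp add: mult_def)
next
  case False
  then obtain g where g: "g \<in> S" "\<eta> \<in> piece p g" by blast
  have gs: "g \<in> stab p" using g S by blast
  have gG: "g \<in> \<Gamma>" by (rule stabD(1)[OF gs])
  have "card {g \<in> S. \<eta> \<in> piece p g} \<le> card {g \<in> \<Gamma>. nm g \<le> 4 * cd + 24 * K}"
  proof (rule card_inj_on_le[OF _ _ finite_orbit_ball])
    show "inj_on (\<lambda>h. ginv g \<circ> h) {g \<in> S. \<eta> \<in> piece p g}"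
    proof (rule inj_onI)
      fix h h' assume "ginv g \<circ> h = ginv g \<circ> h'"
      then have "g \<circ> (ginv g \<circ> h) = g \<circ> (ginv g \<circ> h')" by simp
      then show "h = h'" by (simp add: fun_eq_iff inv_cancel[OF gG])
    qed
    show "(\<lambda>h. ginv g \<circ> h) ` {g \<in> S. \<eta> \<in> piece p g} \<subseteq> {g \<in> \<Gamma>. nm g \<le> 4 * cd + 24 * K}"
    proof (rule image_subsetI)
      fix h assume "h \<in> {g \<in> S. \<eta> \<in> piece p g}"
      then have h: "h \<in> S" "\<eta> \<in> piece p h" by blast+
      have hs: "h \<in> stab p" using h S by blast
      have "dist (g x\<^sub>0) (h x\<^sub>0) \<le> 4 * cd + 24 * K"
        by (rule dom_translates_meet[OF p gs hs cd_nonneg g(2) h(2)])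
      then have "nm (ginv g \<circ> h) \<le> 4 * cd + 24 * K"
        using dist_inv[OF gG, of "h x\<^sub>0" x\<^sub>0] by (simp add: dist_commute)
      then show "ginv g \<circ> h \<in> {g \<in> \<Gamma>. nm g \<le> 4 * cd + 24 * K}"
        using comp_G[OF inv_G[OF gG] stabD(1)[OF hs]] by blast
    qed
  qed
  then show ?thesis unfolding mult_def by simp
qed

text \<open>Integration of the sum of indicators, at most \<open>mult\<close> of which are 1 at any
  point. The common lower bound \<open>v\<close> turns the number of pieces into mass.\<close>

lemma pieces_sum_le:
  assumes p: "p \<in> P0" and S: "finite S" "S \<subseteq> stab p"
    and W: "W \<in> sets (bdry_borel x\<^sub>0)" "\<And>g. g \<in> S \<Longrightarrow> piece p g \<subseteq> W"
    and v: "\<And>g. g \<in> S \<Longrightarrow> v \<le> C * measure (\<mu> x) (piece p g)" and C: "0 \<le> C"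
  shows "real (card S) * v \<le> C * mult * measure (\<mu> x) W"
proof -
  interpret fm: finite_measure "\<mu> x" by (rule finite_\<mu>)
  have ps: "piece p g \<in> sets (\<mu> x)" if "g \<in> S" for g
    using piece_measurable[OF p] that S(2) sets_\<mu> by blast
  have "(\<Sum>g\<in>S. emeasure (\<mu> x) (piece p g)) = (\<Sum>g\<in>S. (\<integral>\<^sup>+ \<eta>. indicator (piece p g) \<eta> \<partial>\<mu> x))"
    using ps by (intro sum.cong) auto
  also have "\<dots> = (\<integral>\<^sup>+ \<eta>. (\<Sum>g\<in>S. indicator (piece p g) \<eta>) \<partial>\<mu> x)"
    using ps by (intro nn_integral_sum[symmetric]) auto
  also have "\<dots> \<le> (\<integral>\<^sup>+ \<eta>. ennreal mult * indicator W \<eta> \<partial>\<mu> x)"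
  proof (rule nn_integral_mono)
    fix \<eta>
    have "(\<Sum>g\<in>S. indicator (piece p g) \<eta>) = (of_nat (card {g \<in> S. \<eta> \<in> piece p g}) :: ennreal)"
      using S(1) by (simp add: indicator_def sum.If_cases Int_def)
    also have "\<dots> \<le> ennreal mult * indicator W \<eta>"
    proof (cases "\<eta> \<in> W")
      case True
      then show ?thesis
        using ennreal_leI[OF pieces_multiplicity[OF p S, of \<eta>]] by (simp add: ennreal_of_nat_eq_real_of_nat)
    next
      case False
      then have e: "{g \<in> S. \<eta> \<in> piece p g} = {}" using W(2) by blast
      show ?thesis unfolding e by simp
    qed
    finally show "(\<Sum>g\<in>S. indicator (piece p g) \<eta>) \<le> ennreal mult * indicator W \<eta>" .
  qed
  also have "\<dots> = ennreal mult * emeasure (\<mu> x) W"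
    using W(1) sets_\<mu> by (simp add: nn_integral_cmult_indicator)
  finally have "(\<Sum>g\<in>S. measure (\<mu> x) (piece p g)) \<le> mult * measure (\<mu> x) W"
    unfolding emeasure_\<mu> by (simp add: mult_def ennreal_mult[symmetric] sum_nonneg)
  then have "C * (\<Sum>g\<in>S. measure (\<mu> x) (piece p g)) \<le> C * (mult * measure (\<mu> x) W)"
    using C by (rule mult_left_mono)
  moreover have "real (card S) * v \<le> C * (\<Sum>g\<in>S. measure (\<mu> x) (piece p g))"
    unfolding sum_distrib_left using sum_mono[of S "\<lambda>_. v" "\<lambda>g. C * measure (\<mu> x) (piece p g)"] v by simp
  ultimately show ?thesis by (simp add: mult.assoc)
qed

text \<open>\<open>40 * K\<close> is the margin in \<open>anchor\<close>, the rest the error in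
  \<open>dom_translate_bprod\<close>: pieces with \<open>nm g\<close> beyond
  \<open>2 * d + 2 * kd\<close>, or at most \<open>2 * d - 2 * kd\<close>, lie on the proper side of
  the shadow at \<open>p\<close>.\<close>

definition kd :: real where "kd = 40 * K + cd + 12 * K"

lemma kd_nonneg: "0 \<le> kd" using K_ge_1 cd_nonneg by (simp add: kd_def)

lemma mass_high_ge:
  obtains C where "0 < C"
    "\<And>p d x. height p d x \<Longrightarrow> B p (2 * d) * exp (- \<delta> * d) \<le> C * measure (\<mu> x) (V p (d + 40 * K))"
    "\<And>p d x. height p d x \<Longrightarrow> kd \<le> d \<Longrightarrow> B p (2 * d) * exp (- \<delta> * d) \<le> C * measure (\<mu> x) (dom p (d - 40 * K))"
proof -
  obtain C1 where C1: "0 < C1" "\<And>p d x g. height p d x \<Longrightarrow> g \<in> stab p \<Longrightarrow>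
    exp (- \<delta> * max d (nm g - d)) \<le> C1 * measure (\<mu> x) (piece p g)"
    using piece_mass_ge by blast
  have m0: "0 \<le> mult" by (simp add: mult_def)
  define CA where "CA = exp (\<delta> * (2 * kd + rg)) * C1 * mult"
  define CB where "CB = Cg * exp (b * (2 * kd)) * C1 * mult"
  have pos: "0 \<le> CA" "0 \<le> CB" using C1 m0 growth_const by (auto simp: CA_def CB_def)
  have A: "B p (2 * d) * exp (- \<delta> * d) \<le> CA * measure (\<mu> x) (V p (d + 40 * K))" if h: "height p d x" for p d x
  proof -
    have p: "p \<in> P0" and d: "0 \<le> d" using h by (auto simp: height_def)
    \<comment> \<open>By doubling, the annulus between \<open>s\<close> and \<open>s + rg\<close>
      holds at least as many elements as the ball of radius \<open>s\<close>, hence at least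
      \<open>B p (2 * d)\<close>; its pieces lie in the shadow and still have mass about
      \<open>exp (- \<delta> * d)\<close>.\<close>
    define s where "s = 2 * d + 2 * kd"
    have s: "0 \<le> s" "2 * d \<le> s" using d kd_nonneg by (auto simp: s_def)
    define S where "S = {g \<in> stab p. nm g \<le> s + rg} - {g \<in> stab p. nm g \<le> s}"
    have S: "finite S" "S \<subseteq> stab p" using finite_stab_ball by (auto simp: S_def)
    have "card S = card {g \<in> stab p. nm g \<le> s + rg} - card {g \<in> stab p. nm g \<le> s}"
      unfolding S_def using growth_const by (intro card_Diff_subset finite_stab_ball) auto
    then have "B p (s + rg) - B p s \<le> real (card S)" unfolding orbit_count_def by linarith
    then have cS: "B p (2 * d) \<le> real (card S)"
      using growth_double[OF p s(1)] B_mono[OF s(2), of p] by linarith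
    have "real (card S) * exp (- \<delta> * (d + (2 * kd + rg))) \<le> C1 * mult * measure (\<mu> x) (V p (d + 40 * K))"
    proof (rule pieces_sum_le[OF p S])
      show "V p (d + 40 * K) \<in> sets (bdry_borel x\<^sub>0)" by (rule shadow_measurable[OF P0_D(2)[OF p]])
      fix g assume g: "g \<in> S"
      then have gs: "g \<in> stab p" "s < nm g" "nm g \<le> s + rg" by (auto simp: S_def)
      show "piece p g \<subseteq> V p (d + 40 * K)"
      proof
        fix \<eta> assume "\<eta> \<in> piece p g"
        note dt = dom_translate_bprod[OF p gs(1) cd_nonneg this]
        have "d + 40 * K \<le> nm g / 2 - (cd + 12 * K)" using gs(2) by (simp add: s_def kd_def)
        then have "ereal (d + 40 * K) \<le> bprod \<eta> p" using dt(1) by (meson ereal_less_eq(3) order_trans)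
        then show "\<eta> \<in> V p (d + 40 * K)" using dt(3) by (simp add: V_iff)
      qed
      have "max d (nm g - d) \<le> d + (2 * kd + rg)" using gs(3) kd_nonneg growth_const by (simp add: s_def)
      then have "exp (- \<delta> * (d + (2 * kd + rg))) \<le> exp (- \<delta> * max d (nm g - d))" using \<delta>_pos by simp
      then show "exp (- \<delta> * (d + (2 * kd + rg))) \<le> C1 * measure (\<mu> x) (piece p g)"
        using C1(2)[OF h gs(1)] by linarith
    qed (use C1 in simp)
    then have "B p (2 * d) * exp (- \<delta> * (d + (2 * kd + rg))) \<le> C1 * mult * measure (\<mu> x) (V p (d + 40 * K))"
      using mult_right_mono[OF cS exp_ge_zero, of "- \<delta> * (d + (2 * kd + rg))"] by linarith
    then have *: "exp (\<delta> * (2 * kd + rg)) * (B p (2 * d) * exp (- \<delta> * (d + (2 * kd + rg))))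
        \<le> exp (\<delta> * (2 * kd + rg)) * (C1 * mult * measure (\<mu> x) (V p (d + 40 * K)))"
      by (intro mult_left_mono) auto
    have e: "exp (- \<delta> * d) = exp (\<delta> * (2 * kd + rg)) * exp (- \<delta> * (d + (2 * kd + rg)))"
      by (simp add: exp_add[symmetric] algebra_simps)
    have "B p (2 * d) * exp (- \<delta> * d) = exp (\<delta> * (2 * kd + rg)) * (B p (2 * d) * exp (- \<delta> * (d + (2 * kd + rg))))"
      unfolding e by (simp only: mult_ac)
    also note *
    finally show ?thesis unfolding CA_def by (simp only: mult_ac)
  qed
  have Bc: "B p (2 * d) * exp (- \<delta> * d) \<le> CB * measure (\<mu> x) (dom p (d - 40 * K))"
    if h: "height p d x" and kd: "kd \<le> d" for p d x
  proof -
    have p: "p \<in> P0" and d: "0 \<le> d" using h by (auto simp: height_def)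
    \<comment> \<open>Here the whole ball of radius \<open>s\<close> is used, on which the maximum
      is \<open>d\<close>; cutting \<open>2 * d\<close> down to \<open>s\<close> loses only a
      constant factor by \<open>growth_le\<close>. The hypothesis \<open>kd \<le> d\<close> makes
      \<open>s\<close> nonnegative.\<close>
    define s where "s = 2 * d - 2 * kd"
    have s: "0 \<le> s" using kd by (simp add: s_def)
    define S where "S = {g \<in> stab p. nm g \<le> s}"
    have S: "finite S" "S \<subseteq> stab p" using finite_stab_ball by (auto simp: S_def)
    have cS: "real (card S) = B p s" by (simp add: S_def orbit_count_def)
    have "real (card S) * exp (- \<delta> * d) \<le> C1 * mult * measure (\<mu> x) (dom p (d - 40 * K))"
    proof (rule pieces_sum_le[OF p S])
      show "dom p (d - 40 * K) \<in> sets (bdry_borel x\<^sub>0)" by (rule dom_measurable[OF P0_D(2)[OF p]])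
      fix g assume g: "g \<in> S"
      then have gs: "g \<in> stab p" "nm g \<le> s" by (auto simp: S_def)
      show "piece p g \<subseteq> dom p (d - 40 * K)"
      proof
        fix \<eta> assume "\<eta> \<in> piece p g"
        note dt = dom_translate_bprod[OF p gs(1) cd_nonneg this]
        have "nm g / 2 + (cd + 12 * K) \<le> d - 40 * K" using gs(2) by (simp add: s_def kd_def)
        then have "\<not> ereal (d - 40 * K) \<le> bprod \<eta> p" using dt(2) by (meson ereal_less_eq(3) order_trans)
        then show "\<eta> \<in> dom p (d - 40 * K)" using dt(3) by (simp add: dom_iff)
      qed
      have "max d (nm g - d) = d" using gs(2) kd_nonneg by (simp add: s_def)
      then show "exp (- \<delta> * d) \<le> C1 * measure (\<mu> x) (piece p g)"
        using C1(2)[OF h gs(1)] by simp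
    qed (use C1 in simp)
    then have *: "B p s * exp (- \<delta> * d) \<le> C1 * mult * measure (\<mu> x) (dom p (d - 40 * K))" using cS by simp
    have "B p (2 * d) \<le> Cg * exp (b * (2 * kd)) * B p s"
      using growth_le[OF p s, of "2 * kd"] kd_nonneg by (simp add: s_def)
    then have "B p (2 * d) * exp (- \<delta> * d) \<le> Cg * exp (b * (2 * kd)) * (B p s * exp (- \<delta> * d))"
      using mult_right_mono[of "B p (2 * d)" _ "exp (- \<delta> * d)"] by (simp add: mult.assoc)
    also have "\<dots> \<le> Cg * exp (b * (2 * kd)) * (C1 * mult * measure (\<mu> x) (dom p (d - 40 * K)))"
      using * growth_const by (intro mult_left_mono) auto
    finally show ?thesis unfolding CB_def by (simp add: mult_ac)
  qed
  show ?thesis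
  proof (rule that[of "CA + CB + 1"])
    show "0 < CA + CB + 1" using pos by simp
    show "B p (2 * d) * exp (- \<delta> * d) \<le> (CA + CB + 1) * measure (\<mu> x) (V p (d + 40 * K))" if "height p d x" for p d x
      by (rule order_trans[OF A[OF that]]) (use pos in \<open>intro mult_right_mono; simp\<close>)
    show "B p (2 * d) * exp (- \<delta> * d) \<le> (CA + CB + 1) * measure (\<mu> x) (dom p (d - 40 * K))"
      if "height p d x" "kd \<le> d" for p d x
      by (rule order_trans[OF Bc[OF that]]) (use pos in \<open>intro mult_right_mono; simp\<close>)
  qed
qed

subsection \<open>The global shadow formula\<close>

text \<open>The shadow carries a definite proportion of the total mass of
  \<open>\<mu> (c t)\<close>: it is bounded above by the whole and below by whichever region
  \<open>anchor\<close> places in it, and both are comparable to the same number.\<close>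

lemma shadow_mass_deep:
  obtains C where "0 < C" "\<And>\<xi> c t p. \<xi> \<in> \<Lambda> \<Longrightarrow> geodesic_ray_to x\<^sub>0 \<xi> c \<Longrightarrow> 0 \<le> t \<Longrightarrow> p \<in> P \<Longrightarrow> kd \<le> dep p (c t) \<Longrightarrow>
    \<exists>h\<in>\<Gamma>. bdry_act (ginv h) p \<in> P0 \<and>
      measure (\<mu> (c t)) (V \<xi> t) \<le> C * (B (bdry_act (ginv h) p) (2 * dep p (c t)) * exp (- \<delta> * dep p (c t))) \<and>
      B (bdry_act (ginv h) p) (2 * dep p (c t)) * exp (- \<delta> * dep p (c t)) \<le> C * measure (\<mu> (c t)) (V \<xi> t)"
proof -
  obtain C1 where C1: "0 < C1" "\<And>p d x. height p d x \<Longrightarrow> measure (\<mu> x) bdry \<le> C1 * (B p (2 * d) * exp (- \<delta> * d))"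
    using total_mass_high by blast
  obtain C2 where C2: "0 < C2"
    "\<And>p d x. height p d x \<Longrightarrow> B p (2 * d) * exp (- \<delta> * d) \<le> C2 * measure (\<mu> x) (V p (d + 40 * K))"
    "\<And>p d x. height p d x \<Longrightarrow> kd \<le> d \<Longrightarrow> B p (2 * d) * exp (- \<delta> * d) \<le> C2 * measure (\<mu> x) (dom p (d - 40 * K))"
    using mass_high_ge by blast
  show ?thesis
  proof (rule that[of "C0 * C1 + C2 * C0"])
    show "0 < C0 * C1 + C2 * C0" using C0_ge_1 C1 C2 by (simp add: add_pos_pos)
    fix \<xi> c t p
    assume \<xi>: "\<xi> \<in> \<Lambda>" and c: "geodesic_ray_to x\<^sub>0 \<xi> c" and t: "0 \<le> t" and p: "p \<in> P" and deep: "kd \<le> dep p (c t)"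
    define d where "d = dep p (c t)"
    have d0: "0 \<le> dep p (c t)" using deep kd_nonneg by simp
    obtain h where h: "h \<in> \<Gamma>" "bdry_act (ginv h) p \<in> P0" "dist (c t) (h x\<^sub>0) \<le> d + 25 * K"
      "d - K \<le> dep (bdry_act (ginv h) p) (ginv h (c t))"
      "bdry_act h ` V (bdry_act (ginv h) p) (d + 40 * K) \<subseteq> V \<xi> t \<or>
       bdry_act h ` dom (bdry_act (ginv h) p) (d - 40 * K) \<subseteq> V \<xi> t"
      unfolding d_def using anchor[OF \<xi> c t p d0] by blast
    define q where "q = bdry_act (ginv h) p"
    define x where "x = ginv h (c t)"
    have hx: "h x = c t" by (simp add: x_def inv_cancel[OF h(1)])
    have "dist x\<^sub>0 x = dist (c t) (h x\<^sub>0)" unfolding x_def using dist_inv[OF h(1), of "c t" x\<^sub>0] by (simp add: dist_commute)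
    then have hq: "height q d x"
      unfolding height_def using h d0 K_ge_1 by (auto simp: q_def x_def d_def)
    have qb: "q \<in> bdry" using h(2) P0_D(2) by (simp add: q_def)
    have \<xi>b: "\<xi> \<in> bdry" by (rule limit_bdry[OF \<xi>])
    let ?W = "B q (2 * d) * exp (- \<delta> * d)"
    have W0: "0 \<le> ?W" using B_ge_1[of "2 * d" q] d0 by (simp add: d_def)
    have "measure (\<mu> (c t)) (V \<xi> t) \<le> measure (\<mu> (c t)) bdry"
      by (rule measure_\<mu>_mono[OF _ bdry_sets]) (auto simp: V_iff)
    also have "bdry = bdry_act h ` bdry"
    proof (intro equalityI subsetI)
      fix \<eta> assume "\<eta> \<in> bdry"
      then show "\<eta> \<in> bdry_act h ` bdry" using act_inv(2)[OF h(1), of \<eta>] act_bdry[OF inv_G[OF h(1)]] by (metis image_eqI)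
    qed (use act_bdry[OF h(1)] in auto)
    also have "measure (\<mu> (c t)) (bdry_act h ` bdry) \<le> C0 * measure (\<mu> x) bdry"
      using measure_equivariant(2)[OF h(1) bdry_sets, of x] by (simp add: hx)
    finally have "measure (\<mu> (c t)) (V \<xi> t) \<le> (C0 * C1) * ?W"
      using le_mult_trans C1(2)[OF hq] C0_ge_1 by force
    also have "\<dots> \<le> (C0 * C1 + C2 * C0) * ?W" using W0 C0_ge_1 C2(1) by (intro mult_right_mono) auto
    finally have up: "measure (\<mu> (c t)) (V \<xi> t) \<le> (C0 * C1 + C2 * C0) * ?W" .
    have low: "?W \<le> (C2 * C0) * measure (\<mu> (c t)) (V \<xi> t)"
      if U: "U \<in> sets (bdry_borel x\<^sub>0)" "bdry_act h ` U \<subseteq> V \<xi> t" "?W \<le> C2 * measure (\<mu> x) U" for U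
    proof (rule le_mult_trans[OF U(3)])
      have "measure (\<mu> x) U \<le> C0 * measure (\<mu> (c t)) (bdry_act h ` U)"
        using measure_equivariant(1)[OF h(1) U(1), of x] by (simp add: hx)
      also have "\<dots> \<le> C0 * measure (\<mu> (c t)) (V \<xi> t)"
        using measure_\<mu>_mono[OF U(2) shadow_measurable[OF \<xi>b]] C0_ge_1 by (intro mult_left_mono) auto
      finally show "measure (\<mu> x) U \<le> C0 * measure (\<mu> (c t)) (V \<xi> t)" .
    qed (use C2 in simp)
    have "?W \<le> (C2 * C0) * measure (\<mu> (c t)) (V \<xi> t)"
      using h(5)
    proof
      assume "bdry_act h ` V (bdry_act (ginv h) p) (d + 40 * K) \<subseteq> V \<xi> t"
      then show ?thesis using C2(2)[OF hq] shadow_measurable[OF qb] by (intro low) (auto simp: q_def)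
    next
      assume "bdry_act h ` dom (bdry_act (ginv h) p) (d - 40 * K) \<subseteq> V \<xi> t"
      then show ?thesis using C2(3)[OF hq] deep dom_measurable[OF qb] by (intro low) (auto simp: q_def d_def)
    qed
    also have "\<dots> \<le> (C0 * C1 + C2 * C0) * measure (\<mu> (c t)) (V \<xi> t)"
      using C0_ge_1 C1(1) by (intro mult_right_mono) auto
    finally show "\<exists>h\<in>\<Gamma>. bdry_act (ginv h) p \<in> P0 \<and>
      measure (\<mu> (c t)) (V \<xi> t) \<le> (C0 * C1 + C2 * C0) * (B (bdry_act (ginv h) p) (2 * dep p (c t)) * exp (- \<delta> * dep p (c t))) \<and>
      B (bdry_act (ginv h) p) (2 * dep p (c t)) * exp (- \<delta> * dep p (c t)) \<le> (C0 * C1 + C2 * C0) * measure (\<mu> (c t)) (V \<xi> t)"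
      using up h(1,2) unfolding q_def d_def by blast
  qed
qed

lemma shadow_mass_shallow:
  obtains C where "0 < C" "\<And>\<xi> c t. \<xi> \<in> \<Lambda> \<Longrightarrow> geodesic_ray_to x\<^sub>0 \<xi> c \<Longrightarrow> 0 \<le> t \<Longrightarrow>
    (\<And>p. p \<in> P \<Longrightarrow> dep p (c t) \<le> kd) \<Longrightarrow>
    infdist (c t) orb \<le> kd + K \<and> measure (\<mu> (c t)) (V \<xi> t) \<le> C \<and> 1 \<le> C * measure (\<mu> (c t)) (V \<xi> t)"
proof -
  \<comment> \<open>The size of the shadow is the one that \<open>shadow_translate_subset\<close>
    requires for an orbit point at distance \<open>kd + K\<close>.\<close>
  obtain e where e: "0 < e" "\<And>\<zeta>. \<zeta> \<in> \<Lambda> \<Longrightarrow> e \<le> measure (\<mu> x\<^sub>0) (V \<zeta> (kd + K + 6 * D))"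
    using shadows_uniformly_charged by blast
  define k where "k = kd + K + 2 * D"
  define E where "E = exp (\<delta> * k)"
  have E: "0 < E" by (simp add: E_def)
  define CU where "CU = C0 * (C0 * E * M0)"
  define CL where "CL = E * C0\<^sup>2 / e"
  have pos: "0 < CU" "0 < CL" using E e(1) C0_ge_1 M0_pos by (auto simp: CU_def CL_def)
  show ?thesis
  proof (rule that[of "CU + CL"])
    show "0 < CU + CL" using pos by simp
    fix \<xi> c t assume \<xi>: "\<xi> \<in> \<Lambda>" and c: "geodesic_ray_to x\<^sub>0 \<xi> c" and t: "0 \<le> t"
      and sh: "\<And>p. p \<in> P \<Longrightarrow> dep p (c t) \<le> kd"
    obtain g where g: "g \<in> \<Gamma>" "dist (c t) (g x\<^sub>0) \<le> kd + K"
      using ray_orbit[OF \<xi> c t kd_nonneg sh] by blast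
    have 1: "infdist (c t) orb \<le> kd + K" using infdist_orbit_le[OF g(1), of "c t"] g(2) by linarith
    have \<xi>b: "\<xi> \<in> bdry" by (rule limit_bdry[OF \<xi>])
    define x where "x = ginv g (c t)"
    have gx: "g x = c t" by (simp add: x_def inv_cancel[OF g(1)])
    have dx: "dist x x\<^sub>0 \<le> kd + K" unfolding x_def using dist_inv[OF g(1), of "c t" x\<^sub>0] g(2) by simp
    have "measure (\<mu> (c t)) (V \<xi> t) \<le> measure (\<mu> (c t)) bdry"
      by (rule measure_\<mu>_mono[OF _ bdry_sets]) (auto simp: V_iff)
    also have "bdry = bdry_act g ` bdry"
    proof (intro equalityI subsetI)
      fix \<eta> assume "\<eta> \<in> bdry"
      then show "\<eta> \<in> bdry_act g ` bdry" using act_inv(2)[OF g(1), of \<eta>] act_bdry[OF inv_G[OF g(1)]] by (metis image_eqI)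
    qed (use act_bdry[OF g(1)] in auto)
    also have "measure (\<mu> (c t)) (bdry_act g ` bdry) \<le> C0 * measure (\<mu> x) bdry"
      using measure_equivariant(2)[OF g(1) bdry_sets, of x] by (simp add: gx)
    also have "measure (\<mu> x) bdry \<le> C0 * exp (- \<delta> * (- k)) * measure (\<mu> x\<^sub>0) bdry"
    proof (rule measure_conformal_le[OF bdry_sets])
      fix \<eta> assume "\<eta> \<in> bdry"
      from busemann_abs[OF this, of x x\<^sub>0] show "- k \<le> bus \<eta> x" using dx by (simp add: k_def abs_le_iff)
    qed
    finally have 2: "measure (\<mu> (c t)) (V \<xi> t) \<le> CU" using C0_ge_1 by (simp add: CU_def E_def M0_def)
    let ?\<zeta> = "bdry_act (ginv g) \<xi>"
    have \<zeta>: "?\<zeta> \<in> \<Lambda>" by (rule act_limit[OF inv_G[OF g(1)] \<xi>])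
    have S: "V ?\<zeta> (kd + K + 6 * D) \<in> sets (bdry_borel x\<^sub>0)" by (rule shadow_measurable[OF limit_bdry[OF \<zeta>]])
    have "1 / E = exp (- \<delta> * k)" by (simp add: E_def exp_minus field_simps)
    also have "\<dots> \<le> exp (- \<delta> * (dist (c t) (g x\<^sub>0) + 2 * D))" using g(2) \<delta>_pos by (simp add: k_def)
    finally have "1 / E * e \<le> exp (- \<delta> * (dist (c t) (g x\<^sub>0) + 2 * D)) * measure (\<mu> x\<^sub>0) (V ?\<zeta> (kd + K + 6 * D))"
      using e(2)[OF \<zeta>] e(1) E by (intro mult_mono) auto
    also have "\<dots> \<le> C0\<^sup>2 * measure (\<mu> (c t)) (bdry_act g ` V ?\<zeta> (kd + K + 6 * D))"
      by (rule measure_translate_ge[OF g(1) S])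
    also have "\<dots> \<le> C0\<^sup>2 * measure (\<mu> (c t)) (V \<xi> t)"
      using measure_\<mu>_mono[OF shadow_translate_subset[OF c t \<xi>b g] shadow_measurable[OF \<xi>b]]
      by (intro mult_left_mono) auto
    finally have 3: "1 \<le> CL * measure (\<mu> (c t)) (V \<xi> t)"
      using E e(1) by (simp add: CL_def field_simps)
    have "measure (\<mu> (c t)) (V \<xi> t) \<le> CU + CL" using 2 pos by simp
    moreover have "1 \<le> (CU + CL) * measure (\<mu> (c t)) (V \<xi> t)"
      using 3 pos mult_right_mono[of CL "CU + CL" "measure (\<mu> (c t)) (V \<xi> t)"] by (simp add: order_trans)
    ultimately show "infdist (c t) orb \<le> kd + K \<and> measure (\<mu> (c t)) (V \<xi> t) \<le> CU + CL \<and>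
        1 \<le> (CU + CL) * measure (\<mu> (c t)) (V \<xi> t)" using 1 by blast
  qed
qed

lemma cusp_function_outside: "(\<And>p. p \<in> P \<Longrightarrow> x \<notin> H p) \<Longrightarrow> cusp_function x\<^sub>0 \<Gamma> H R x = 1"
  unfolding cusp_function_def by auto

lemma cusp_function_inside:
  assumes R: "parabolic_representatives x\<^sub>0 \<Gamma> R" and p: "p \<in> P" "x \<in> H p"
  obtains q where "q \<in> R" "q \<in> bdry_orbit_of \<Gamma> p" "cusp_function x\<^sub>0 \<Gamma> H R x = B q (2 * infdist x orb)"
proof -
  have ex1: "\<exists>!q. q \<in> R \<and> q \<in> bdry_orbit_of \<Gamma> p" using R p(1) unfolding parabolic_representatives_def by blast
  define q where "q = (THE q. q \<in> R \<and> q \<in> bdry_orbit_of \<Gamma> p)"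
  have q: "q \<in> R \<and> q \<in> bdry_orbit_of \<Gamma> p" unfolding q_def by (rule theI'[OF ex1])
  have "(THE p. p \<in> P \<and> x \<in> H p) = p"
  proof (rule the_equality)
    fix p' assume "p' \<in> P \<and> x \<in> H p'"
    then show "p' = p" using dep_disjoint p H_iff by blast
  qed (use p in blast)
  moreover have "\<exists>p\<in>P. x \<in> H p" using p by blast
  ultimately have "cusp_function x\<^sub>0 \<Gamma> H R x = B q (2 * infdist x orb)"
    unfolding cusp_function_def q_def by (simp add: Let_def)
  then show ?thesis using that q by blast
qed

text \<open>Depth, point of \<open>P0\<close> and its counting function are replaced by distance to
  the orbit, representative and cusp function; each replacement costs a constant factor.\<close>

lemma shadow_mass_ray_point:
  assumes R: "parabolic_representatives x\<^sub>0 \<Gamma> R"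
  obtains C where "0 < C" "\<And>\<xi> c t. \<xi> \<in> \<Lambda> \<Longrightarrow> geodesic_ray_to x\<^sub>0 \<xi> c \<Longrightarrow> 0 \<le> t \<Longrightarrow>
    measure (\<mu> (c t)) (V \<xi> t) \<le> C * (cusp_function x\<^sub>0 \<Gamma> H R (c t) * exp (- \<delta> * infdist (c t) orb)) \<and>
    cusp_function x\<^sub>0 \<Gamma> H R (c t) * exp (- \<delta> * infdist (c t) orb) \<le> C * measure (\<mu> (c t)) (V \<xi> t)"
proof -
  obtain C1 where C1: "0 < C1" "\<And>\<xi> c t p. \<xi> \<in> \<Lambda> \<Longrightarrow> geodesic_ray_to x\<^sub>0 \<xi> c \<Longrightarrow> 0 \<le> t \<Longrightarrow> p \<in> P \<Longrightarrow> kd \<le> dep p (c t) \<Longrightarrow>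
    \<exists>h\<in>\<Gamma>. bdry_act (ginv h) p \<in> P0 \<and>
      measure (\<mu> (c t)) (V \<xi> t) \<le> C1 * (B (bdry_act (ginv h) p) (2 * dep p (c t)) * exp (- \<delta> * dep p (c t))) \<and>
      B (bdry_act (ginv h) p) (2 * dep p (c t)) * exp (- \<delta> * dep p (c t)) \<le> C1 * measure (\<mu> (c t)) (V \<xi> t)"
    using shadow_mass_deep by blast
  obtain C2 where C2: "0 < C2" "\<And>\<xi> c t. \<xi> \<in> \<Lambda> \<Longrightarrow> geodesic_ray_to x\<^sub>0 \<xi> c \<Longrightarrow> 0 \<le> t \<Longrightarrow>
    (\<And>p. p \<in> P \<Longrightarrow> dep p (c t) \<le> kd) \<Longrightarrow>
    infdist (c t) orb \<le> kd + K \<and> measure (\<mu> (c t)) (V \<xi> t) \<le> C2 \<and> 1 \<le> C2 * measure (\<mu> (c t)) (V \<xi> t)"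
    using shadow_mass_shallow by blast
  obtain E where E: "1 \<le> E" "\<And>p q s. p \<in> P0 \<Longrightarrow> q \<in> R \<Longrightarrow> q \<in> bdry_orbit_of \<Gamma> p \<Longrightarrow> 0 \<le> s \<Longrightarrow>
    B q s \<le> E * B p s \<and> B p s \<le> E * B q s"
    using representative_growth_comparison[OF R growth growth_const(2)] by blast
  define G where "G = Cg * exp (b * (2 * K))"
  have G1: "1 \<le> G" unfolding G_def using growth_const K_ge_1 mult_mono[of 1 Cg 1 "exp (b * (2 * K))"] by simp
  define X where "X = exp (\<delta> * (kd + K))"
  have X: "1 \<le> X" "exp (\<delta> * K) \<le> X" unfolding X_def using \<delta>_pos kd_nonneg K_ge_1 by auto
  \<comment> \<open>A bound for the cusp function in the shallow case, where twice the distance to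
    the orbit is at most \<open>2 * (kd + K)\<close>; the summand 1 also covers the value 1 outside
    the horoballs.\<close>
  define N where "N = real (card {g \<in> \<Gamma>. nm g \<le> 2 * (kd + K)}) + 1"
  have N: "1 \<le> N" by (simp add: N_def)
  define CD where "CD = (G * E) * X"
  have CD: "0 \<le> CD" using G1 E X by (simp add: CD_def)
  define C where "C = C1 * CD + C2 * X * N"
  have pos: "0 < C" unfolding C_def using C1(1) C2(1) CD X N by (intro add_nonneg_pos) auto
  show ?thesis
  proof (rule that[OF pos])
    fix \<xi> c t assume \<xi>: "\<xi> \<in> \<Lambda>" and c: "geodesic_ray_to x\<^sub>0 \<xi> c" and t: "0 \<le> (t::real)"
    define \<Delta> where "\<Delta> = infdist (c t) orb"
    have \<Delta>0: "0 \<le> \<Delta>" by (simp add: \<Delta>_def infdist_nonneg)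
    define m where "m = measure (\<mu> (c t)) (V \<xi> t)"
    have m0: "0 \<le> m" by (simp add: m_def)
    define cf where "cf = cusp_function x\<^sub>0 \<Gamma> H R (c t)"
    have "m \<le> C * (cf * exp (- \<delta> * \<Delta>)) \<and> cf * exp (- \<delta> * \<Delta>) \<le> C * m"
    proof (cases "\<exists>p\<in>P. kd \<le> dep p (c t)")
      case True
      then obtain p where p: "p \<in> P" "kd \<le> dep p (c t)" by blast
      define d where "d = dep p (c t)"
      have d0: "0 \<le> d" using p(2) kd_nonneg by (simp add: d_def)
      obtain h where h: "h \<in> \<Gamma>" "bdry_act (ginv h) p \<in> P0"
        "m \<le> C1 * (B (bdry_act (ginv h) p) (2 * d) * exp (- \<delta> * d))"
        "B (bdry_act (ginv h) p) (2 * d) * exp (- \<delta> * d) \<le> C1 * m"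
        using C1(2)[OF \<xi> c t p] unfolding m_def d_def by blast
      define p' where "p' = bdry_act (ginv h) p"
      have p': "p' \<in> P0" "bdry_act h p' = p" using h by (auto simp: p'_def act_inv[OF h(1)])
      have inH: "c t \<in> H p" using H_iff[OF p(1)] d0 by (simp add: d_def)
      obtain q where q: "q \<in> R" "q \<in> bdry_orbit_of \<Gamma> p" "cf = B q (2 * \<Delta>)"
        using cusp_function_inside[OF R p(1) inH] unfolding cf_def \<Delta>_def by blast
      have q': "q \<in> bdry_orbit_of \<Gamma> p'"
      proof -
        obtain g where "g \<in> \<Gamma>" "q = bdry_act g p" using q(2) unfolding bdry_orbit_of_def by blast
        then have "q = bdry_act (g \<circ> h) p'" "g \<circ> h \<in> \<Gamma>" using p'(2) comp_G h(1) by (auto simp: act_comp)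
        then show ?thesis unfolding bdry_orbit_of_def by blast
      qed
      have "d - K \<le> \<Delta>" unfolding d_def \<Delta>_def by (rule infdist_orbit_dep[OF p(1)])
      \<comment> \<open>All other depths are negative by disjointness, so \<open>d\<close> is the
        largest one and \<open>ray_orbit\<close> applies with \<open>m = d\<close>.\<close>
      moreover have "\<Delta> \<le> d + K"
      proof -
        have "dep q (c t) \<le> d" if "q \<in> P" for q
          using dep_disjoint[OF p(1) that, of "c t"] d0 by (cases "0 \<le> dep q (c t)") (auto simp: d_def)
        then obtain g where "g \<in> \<Gamma>" "dist (c t) (g x\<^sub>0) \<le> d + K" using ray_orbit[OF \<xi> c t d0] by blast
        then show ?thesis using infdist_orbit_le[of g "c t"] by (simp add: \<Delta>_def)
      qed
      ultimately have cl: "2 * d \<le> 2 * \<Delta> + 2 * K" "2 * \<Delta> \<le> 2 * d + 2 * K" "\<Delta> \<le> d + K" "d \<le> \<Delta> + K" by auto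
      have b1: "B p' (2 * d) \<le> G * B p' (2 * \<Delta>)"
        using B_mono[OF cl(1), of p'] growth_le[OF p'(1), of "2 * \<Delta>" "2 * K"] \<Delta>0 K_ge_1 by (simp add: G_def)
      have b2: "B p' (2 * \<Delta>) \<le> G * B p' (2 * d)"
        using B_mono[OF cl(2), of p'] growth_le[OF p'(1), of "2 * d" "2 * K"] d0 K_ge_1 by (simp add: G_def)
      have cmp: "cf \<le> E * B p' (2 * \<Delta>)" "B p' (2 * \<Delta>) \<le> E * cf"
        using E(2)[OF p'(1) q(1) q', of "2 * \<Delta>"] \<Delta>0 q(3) by auto
      have 1: "B p' (2 * d) \<le> (G * E) * cf" by (rule le_mult_trans[OF b1 cmp(2)]) (use G1 in simp)
      have 2: "cf \<le> (G * E) * B p' (2 * d)"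
        using le_mult_trans[OF cmp(1) b2] E(1) by (simp add: mult.commute)
      have cf0: "0 \<le> cf" using q(3) B_ge_1[of "2 * \<Delta>" q] \<Delta>0 by simp
      have Bp0: "0 \<le> B p' (2 * d)" using B_ge_1[of "2 * d" p'] d0 by simp
      have "exp (- \<delta> * d) \<le> exp (\<delta> * K) * exp (- \<delta> * \<Delta>)" "exp (- \<delta> * \<Delta>) \<le> exp (\<delta> * K) * exp (- \<delta> * d)"
        using mult_left_mono[OF cl(3), of \<delta>] mult_left_mono[OF cl(4), of \<delta>] \<delta>_pos
        by (auto simp: exp_add[symmetric] algebra_simps)
      moreover have "exp (\<delta> * K) * exp (- \<delta> * s) \<le> X * exp (- \<delta> * s)" for s using X(2) by (intro mult_right_mono) auto
      ultimately have e: "exp (- \<delta> * d) \<le> X * exp (- \<delta> * \<Delta>)" "exp (- \<delta> * \<Delta>) \<le> X * exp (- \<delta> * d)"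
        by (meson order_trans)+
      have GE: "0 \<le> G * E" using G1 E(1) by simp
      have u: "B p' (2 * d) * exp (- \<delta> * d) \<le> CD * (cf * exp (- \<delta> * \<Delta>))"
        using mult_mono[OF 1 e(1) mult_nonneg_nonneg[OF GE cf0] exp_ge_zero] by (simp add: CD_def mult_ac)
      have l: "cf * exp (- \<delta> * \<Delta>) \<le> CD * (B p' (2 * d) * exp (- \<delta> * d))"
        using mult_mono[OF 2 e(2) mult_nonneg_nonneg[OF GE Bp0] exp_ge_zero] by (simp add: CD_def mult_ac)
      have le: "C1 * CD \<le> C" using C2(1) X N by (simp add: C_def)
      have "m \<le> (C1 * CD) * (cf * exp (- \<delta> * \<Delta>))"
        using le_mult_trans[OF h(3)[folded p'_def] u] C1(1) by simp
      also have "\<dots> \<le> C * (cf * exp (- \<delta> * \<Delta>))" using le cf0 by (intro mult_right_mono) auto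
      finally have i: "m \<le> C * (cf * exp (- \<delta> * \<Delta>))" .
      have "cf * exp (- \<delta> * \<Delta>) \<le> (CD * C1) * m" by (rule le_mult_trans[OF l h(4)[folded p'_def] CD])
      also have "\<dots> \<le> C * m" using le m0 by (intro mult_right_mono) (auto simp: mult.commute)
      finally show ?thesis using i by blast
    next
      case False
      then have "\<And>p. p \<in> P \<Longrightarrow> dep p (c t) \<le> kd" by (meson less_imp_le not_le)
      from C2(2)[OF \<xi> c t this] have s: "\<Delta> \<le> kd + K" "m \<le> C2" "1 \<le> C2 * m" by (auto simp: \<Delta>_def m_def)
      have cf: "1 \<le> cf \<and> cf \<le> N"
      proof (cases "\<exists>p\<in>P. c t \<in> H p")
        case True
        then obtain p where p: "p \<in> P" "c t \<in> H p" by blast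
        obtain q where q: "cf = B q (2 * \<Delta>)"
          using cusp_function_inside[OF R p] unfolding cf_def \<Delta>_def by blast
        have "card {g \<in> stab q. nm g \<le> 2 * \<Delta>} \<le> card {g \<in> \<Gamma>. nm g \<le> 2 * (kd + K)}"
          by (rule card_mono[OF finite_orbit_ball]) (use s(1) stabD(1) in fastforce)
        then have "cf \<le> N" unfolding q N_def orbit_count_def by simp
        then show ?thesis using B_ge_1[of "2 * \<Delta>" q] \<Delta>0 q by simp
      next
        case False
        then show ?thesis using cusp_function_outside N unfolding cf_def by auto
      qed
      have ex: "exp (- \<delta> * \<Delta>) \<le> 1" "1 \<le> X * exp (- \<delta> * \<Delta>)"
        using s(1) \<Delta>0 \<delta>_pos by (auto simp: X_def exp_add[symmetric] right_diff_distrib[symmetric])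
      have le: "C2 * X * N \<le> C" using C1(1) CD by (simp add: C_def)
      have xe: "0 \<le> X * exp (- \<delta> * \<Delta>)" using X by simp
      have "m \<le> C2 * (X * exp (- \<delta> * \<Delta>))" using s(2) mult_left_mono[OF ex(2) less_imp_le[OF C2(1)]] by linarith
      also have "\<dots> \<le> C2 * (X * exp (- \<delta> * \<Delta>)) * (N * cf)"
      proof -
        have "1 \<le> N * cf" using N cf mult_mono[of 1 N 1 cf] by simp
        then show ?thesis using mult_left_mono[of 1 "N * cf" "C2 * (X * exp (- \<delta> * \<Delta>))"] C2(1) xe by simp
      qed
      also have "\<dots> = (C2 * X * N) * (cf * exp (- \<delta> * \<Delta>))" by (simp add: mult_ac)
      also have "\<dots> \<le> C * (cf * exp (- \<delta> * \<Delta>))" using le cf by (intro mult_right_mono) auto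
      finally have i: "m \<le> C * (cf * exp (- \<delta> * \<Delta>))" .
      have "cf * exp (- \<delta> * \<Delta>) \<le> N * 1" using cf ex(1) N by (intro mult_mono) auto
      also have "\<dots> \<le> (N * X) * (C2 * m)" using s(3) X N mult_mono[of 1 X 1 "C2 * m"] mult_left_mono[of 1 "X * (C2 * m)" N] by (simp add: mult_ac)
      also have "\<dots> = (C2 * X * N) * m" by (simp add: mult_ac)
      also have "\<dots> \<le> C * m" using le m0 by (rule mult_right_mono)
      finally show ?thesis using i by blast
    qed
    then show "measure (\<mu> (c t)) (V \<xi> t) \<le> C * (cusp_function x\<^sub>0 \<Gamma> H R (c t) * exp (- \<delta> * infdist (c t) orb)) \<and>
      cusp_function x\<^sub>0 \<Gamma> H R (c t) * exp (- \<delta> * infdist (c t) orb) \<le> C * measure (\<mu> (c t)) (V \<xi> t)"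
      by (simp add: m_def cf_def \<Delta>_def)
  qed
qed

text \<open>Only the change from \<open>\<mu> (c t)\<close> back to \<open>\<mu> x\<^sub>0\<close>
  remains; by \<open>shadow_busemann\<close> it amounts to the factor
  \<open>exp (- \<delta> * t)\<close> on the whole shadow, up to a constant.\<close>

lemma global_shadow_formula:
  assumes R: "parabolic_representatives x\<^sub>0 \<Gamma> R"
  shows "\<exists>C\<ge>1. \<forall>\<xi>\<in>\<Lambda>. \<forall>c. geodesic_ray_to x\<^sub>0 \<xi> c \<longrightarrow> (\<forall>t\<ge>0.
      1 / C * cusp_function x\<^sub>0 \<Gamma> H R (c t) * exp (- \<delta> * (t + infdist (c t) orb)) \<le> measure (\<mu> x\<^sub>0) (V \<xi> t) \<and>
      measure (\<mu> x\<^sub>0) (V \<xi> t) \<le> C * cusp_function x\<^sub>0 \<Gamma> H R (c t) * exp (- \<delta> * (t + infdist (c t) orb)))"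
proof -
  obtain C1 where C1: "0 < C1" "\<And>\<xi> c t. \<xi> \<in> \<Lambda> \<Longrightarrow> geodesic_ray_to x\<^sub>0 \<xi> c \<Longrightarrow> 0 \<le> t \<Longrightarrow>
    measure (\<mu> (c t)) (V \<xi> t) \<le> C1 * (cusp_function x\<^sub>0 \<Gamma> H R (c t) * exp (- \<delta> * infdist (c t) orb)) \<and>
    cusp_function x\<^sub>0 \<Gamma> H R (c t) * exp (- \<delta> * infdist (c t) orb) \<le> C1 * measure (\<mu> (c t)) (V \<xi> t)"
    using shadow_mass_ray_point[OF R] by blast
  define Y where "Y = exp (\<delta> * (6 * D))"
  have Y: "0 < Y" "1 \<le> Y" unfolding Y_def using \<delta>_pos D_ge_1 by auto
  define C where "C = Y * C0 * C1 + 1"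
  have C: "1 \<le> C" "0 < C" using Y(1) C0_ge_1 C1(1) by (auto simp: C_def add_pos_pos)
  show ?thesis
  proof (intro exI conjI ballI allI impI)
    show "1 \<le> C" by (rule C)
    fix \<xi> c t assume \<xi>: "\<xi> \<in> \<Lambda>" and c: "geodesic_ray_to x\<^sub>0 \<xi> c" and t: "0 \<le> (t::real)"
    define m where "m = measure (\<mu> (c t)) (V \<xi> t)"
    define m' where "m' = measure (\<mu> x\<^sub>0) (V \<xi> t)"
    define F where "F = cusp_function x\<^sub>0 \<Gamma> H R (c t) * exp (- \<delta> * infdist (c t) orb)"
    have mm: "0 \<le> m" "0 \<le> m'" by (auto simp: m_def m'_def)
    have F: "m \<le> C1 * F" "F \<le> C1 * m" using C1(2)[OF \<xi> c t] by (auto simp: F_def m_def)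
    have F0: "0 \<le> F" using F(1) mm(1) C1(1) by (metis order_trans zero_le_mult_iff not_le)
    have \<xi>b: "\<xi> \<in> bdry" by (rule limit_bdry[OF \<xi>])
    have Vs: "V \<xi> t \<in> sets (bdry_borel x\<^sub>0)" by (rule shadow_measurable[OF \<xi>b])
    have sb: "\<bar>bus \<eta> (c t) + t\<bar> \<le> 6 * D" if "\<eta> \<in> V \<xi> t" for \<eta> by (rule shadow_busemann[OF c t \<xi>b that])
    have "m \<le> C0 * exp (- \<delta> * (- t - 6 * D)) * m'"
      unfolding m_def m'_def using sb by (intro measure_conformal_le[OF Vs]) (force simp: abs_le_iff)
    also have "exp (- \<delta> * (- t - 6 * D)) = Y * exp (\<delta> * t)" by (simp add: Y_def exp_add[symmetric] algebra_simps)
    finally have u: "m \<le> (C0 * Y * exp (\<delta> * t)) * m'" by (simp add: mult_ac)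
    have l0: "exp (- \<delta> * (- t + 6 * D)) * m' \<le> C0 * m"
      unfolding m_def m'_def using sb by (intro measure_conformal_ge[OF Vs]) (force simp: abs_le_iff)
    have "exp (- \<delta> * (- t + 6 * D)) = exp (\<delta> * t) / Y" by (simp add: Y_def exp_diff[symmetric] algebra_simps)
    then have "exp (\<delta> * t) / Y * m' \<le> C0 * m" using l0 by (simp only:)
    then have l: "exp (\<delta> * t) * m' \<le> (Y * C0) * m" using Y(1) by (simp add: pos_divide_le_eq mult_ac)
    have ee: "exp (- \<delta> * t) * exp (\<delta> * t) = 1" by (simp add: exp_add[symmetric])
    have "exp (\<delta> * t) * m' \<le> (Y * C0 * C1) * F"
      by (rule le_mult_trans[OF l F(1)]) (use Y(1) C0_ge_1 in simp)
    also have "\<dots> \<le> C * F" using F0 by (intro mult_right_mono) (auto simp: C_def)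
    finally have *: "exp (- \<delta> * t) * (exp (\<delta> * t) * m') \<le> exp (- \<delta> * t) * (C * F)" by (rule mult_left_mono) simp
    have cancel: "exp (- \<delta> * t) * (exp (\<delta> * t) * m') = m'" unfolding mult.assoc[symmetric] ee by simp
    have up: "m' \<le> C * (F * exp (- \<delta> * t))" using *[unfolded cancel] by (simp only: mult_ac)
    have "F \<le> (C1 * (C0 * Y * exp (\<delta> * t))) * m'" by (rule le_mult_trans[OF F(2) u]) (use C1(1) in simp)
    also have "\<dots> = (Y * C0 * C1) * (exp (\<delta> * t) * m')" by (simp add: mult_ac)
    also have "\<dots> \<le> C * (exp (\<delta> * t) * m')" using mm(2) by (intro mult_right_mono) (auto simp: C_def)
    finally have "exp (- \<delta> * t) * F \<le> exp (- \<delta> * t) * (C * (exp (\<delta> * t) * m'))" by (rule mult_left_mono) simp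
    also have "\<dots> = C * m'" using ee by (metis mult.left_commute mult.assoc mult_1)
    finally have lo: "F * exp (- \<delta> * t) \<le> C * m'" by (simp add: mult.commute)
    have Fe: "cusp_function x\<^sub>0 \<Gamma> H R (c t) * exp (- \<delta> * (t + infdist (c t) orb)) = F * exp (- \<delta> * t)"
      by (simp add: F_def mult.assoc exp_add[symmetric] algebra_simps)
    have "1 / C * (F * exp (- \<delta> * t)) \<le> m'" using lo C(2) by (simp add: pos_divide_le_eq mult.commute)
    then show "1 / C * cusp_function x\<^sub>0 \<Gamma> H R (c t) * exp (- \<delta> * (t + infdist (c t) orb)) \<le> measure (\<mu> x\<^sub>0) (V \<xi> t)"
      unfolding mult.assoc Fe m'_def .
    show "measure (\<mu> x\<^sub>0) (V \<xi> t) \<le> C * cusp_function x\<^sub>0 \<Gamma> H R (c t) * exp (- \<delta> * (t + infdist (c t) orb))"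
      unfolding mult.assoc Fe using up by (simp add: m'_def)
  qed
qed

end

theorem theorem1p4:
  fixes x\<^sub>0 :: "'a::heine_borel"
    and \<Gamma> :: "('a \<Rightarrow> 'a) set"
    and H :: "'a bdry \<Rightarrow> 'a set"
    and R :: "'a bdry set"
    and \<mu> :: "'a \<Rightarrow> 'a bdry measure"
    and \<delta> :: real
  assumes "geodesic_space TYPE('a)"
    and "gromov_hyperbolic TYPE('a)"
    and "isometry_group \<Gamma>"
    and "properly_discontinuous \<Gamma>"
    and "geometrically_finite x\<^sub>0 \<Gamma>"
    and "horoball_decomposition x\<^sub>0 \<Gamma> H"
    and "parabolic_representatives x\<^sub>0 \<Gamma> R"
    and "quasi_conformal_density x\<^sub>0 \<Gamma> \<delta> \<mu>"
    and "\<forall>x. \<forall>\<eta>\<in>gromov_boundary x\<^sub>0. emeasure (\<mu> x) {\<eta>} = 0"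
    and "tempered_parabolic_subgroups x\<^sub>0 \<delta> \<Gamma>"
  shows "\<exists>C\<ge>1. \<forall>\<xi>\<in>limit_set x\<^sub>0 \<Gamma>. \<forall>c. geodesic_ray_to x\<^sub>0 \<xi> c \<longrightarrow> (\<forall>t\<ge>0.
           1 / C * cusp_function x\<^sub>0 \<Gamma> H R (c t) * exp (- \<delta> * (t + infdist (c t) (orbit_of \<Gamma> x\<^sub>0)))
             \<le> measure (\<mu> x\<^sub>0) (shadow x\<^sub>0 \<xi> t) \<and>
           measure (\<mu> x\<^sub>0) (shadow x\<^sub>0 \<xi> t)
             \<le> C * cusp_function x\<^sub>0 \<Gamma> H R (c t) * exp (- \<delta> * (t + infdist (c t) (orbit_of \<Gamma> x\<^sub>0))))"
proof -
  obtain E :: real where E: "\<And>w x y z::'a.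
        gromov_product w x z \<ge> min (gromov_product w x y) (gromov_product w y z) - E"
    using assms(2) unfolding gromov_hyperbolic_def by blast
  define D where "D = max 1 E"
  interpret hyp_group x\<^sub>0 D \<Gamma>
  proof
    show "1 \<le> D" by (simp add: D_def)
    show "min (gromov_product w x y) (gromov_product w y z) - D \<le> gromov_product w x z" for w x y z :: 'a
      using E[of w x y z] unfolding D_def by linarith
  qed (use assms in auto)
  obtain T where T: "T \<subseteq> \<Lambda>" "card T = 3" using assms(5) unfolding geometrically_finite_def by blast
  obtain a T' where a: "T = insert a T'" "a \<notin> T'" "card T' = 2" using T(2) card_Suc_eq[of T 2] by auto
  obtain a' where "a' \<in> T'" using a(3) by (metis card.empty ex_in_conv zero_neq_numeral)
  interpret cusped x\<^sub>0 D \<Gamma> H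
  proof
    have "a \<noteq> a'" "a \<in> \<Lambda>" "a' \<in> \<Lambda>" using T(1) a(1,2) \<open>a' \<in> T'\<close> by auto
    then show "\<exists>a\<in>\<Lambda>. \<exists>b\<in>\<Lambda>. a \<noteq> b" by blast
  qed (rule assms(6))
  obtain K where "cusp_const x\<^sub>0 D \<Gamma> H K" using cusp_const_exists by blast
  then interpret cusp_const x\<^sub>0 D \<Gamma> H K .
  obtain C0 where "qc_density x\<^sub>0 D \<Gamma> \<delta> \<mu> C0" using qc_density_exists[OF assms(8)] assms(9) by blast
  then interpret qc_density x\<^sub>0 D \<Gamma> \<delta> \<mu> C0 .
  obtain b Cg rg where g: "0 \<le> b" "b < \<delta>" "1 \<le> Cg" "0 < rg" "\<And>p. p \<in> P0 \<Longrightarrow> growth_bounds p b Cg rg"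
    using uniform_growth_bounds[OF assms(10) \<delta>_pos] by blast
  obtain c1 where c1: "0 \<le> c1" "\<And>p \<eta>. p \<in> P0 \<Longrightarrow> \<eta> \<in> \<Lambda> \<Longrightarrow> \<eta> \<noteq> p \<Longrightarrow> \<exists>g\<in>stab p. \<eta> \<in> bdry_act g ` dom p c1"
    using dom_translates_cover by blast
  obtain c2 where c2: "\<And>p c. p \<in> bdry \<Longrightarrow> c2 \<le> c \<Longrightarrow> M0 / 2 \<le> measure (\<mu> x\<^sub>0) (dom p c)"
    using dom_large by blast
  \<comment> \<open>A larger parameter enlarges \<open>dom\<close>, so the maximum of the two
    constants keeps both the covering and the mass bound.\<close>
  have dmono: "dom p c1 \<subseteq> dom p (max c1 c2)" for p
    unfolding dom_def using shadow_antimono[of c1 "max c1 c2" x\<^sub>0 p] by auto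
  interpret cusp_density x\<^sub>0 D \<Gamma> H K \<delta> \<mu> C0 b Cg rg "max c1 c2"
  proof
    show "\<exists>g\<in>stab p. \<eta> \<in> bdry_act g ` dom p (max c1 c2)" if "p \<in> P0" "\<eta> \<in> \<Lambda>" "\<eta> \<noteq> p" for p \<eta>
      using c1(2)[OF that] dmono by blast
  qed (use g c1(1) c2 in auto)
  show ?thesis by (rule global_shadow_formula[OF assms(7)])
qed

end
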